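(* Let $D=\{Z_1,\dots,Z_n\}$ be a dataset of length $n$, i.e. $Z_1,\dots,Z_n$ are i.i.d. with law $\mu$ on $\mathbb{R}^k\times\mathbb{R}^m$, with log-Sobolev constant $C_1:=\sigma^2(\mu)<\infty$, and let $Z$ be a further independent random variable with law $\mu$. Suppose that the pair $(T,L)$ is $(\delta_1,\delta_2,\delta_3)$-stable and that $\mathbb{E}[L(T_D(x),y)]$ has linear or quadratic growth in $z=(x,y)$. Then there exists a constant $C$, depending on the linear or quadratic growth of $\mathbb{E}[L(T_D(x),y)]$ and on $C_1$, such that with $$\theta_1(n,t,z)=e^{-\frac{t^2}{8C_1[\delta_1^2(n,z)+\delta_2^2(n,z)\,n(\mathbb{E}[\|Z_i\|^2]+16C_1)]}}\vee e^{-\frac{t}{8C_1\delta_2(n,z)}},$$ $$\theta_2(n,t)=\begin{cases}e^{-\frac{t^2n}{2C}}, & \mathbb{E}[f_i(z)]\text{ has linear growth},\\ e^{-\frac{t^2n}{2C}}\vee e^{-\frac{tn}{2\sqrt C}}, & \mathbb{E}[f_i(z)]\text{ has quadratic growth},\end{cases}$$ $$\theta_3(n,t)=e^{-\frac{t^2}{8C_1[\mathbb{E}[\delta_1(n,Z)]^2+\mathbb{E}[\delta_2(n,Z)]^2\,n(\mathbb{E}[\|Z_i\|^2]+16C_1)]}}\vee e^{-\frac{t}{8C_1\mathbb{E}[\delta_2(n,Z)]}},$$ for $\varepsilon>3\delta_3(n)$ we have $$\mathbb{P}\big(L_{LOO}-\hat L_{LOO}>\varepsilon\big)\le n\,\m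athbb{E}[\theta_1(n,\varepsilon/3,Z)]+\theta_2(n,\varepsilon/3)+\theta_3(n,\varepsilon/3-\delta_3(n)).$$
   Context: Dataset: $Z_i=(X_i,Y_i)\in\mathbb{R}^k\times\mathbb{R}^m$; $D_{(-i)}$ is $D$ with $Z_i$ removed. $\|\cdot\|$ is the Euclidean norm, $a\vee b=\max(a,b)$. When $\delta_2\equiv0$ the terms $e^{-t/(8C_1\cdot 0)}$ are read as $0$. Log-Sobolev constant: $\sigma^2(\mu)=\sup_{f\in W^{1,2}(\mu)} \frac12\,\frac{\mathrm{Ent}_\mu(f^2)}{\mathbb{E}_\mu[\|\nabla f\|^2]}$, where $\mathrm{Ent}_\mu(g)=\mathbb{E}_\mu[g\log g]-\mathbb{E}_\mu[g]\log\mathbb{E}_\mu[g]$ and $W^{1,2}(\mu)$ is the Sobolev Hilbert space associated with $\mu$. Statistic and loss: for each $n$, $T_n:(\mathbb{R}^{k+m})^n\to C(\mathbb{R}^k;\mathbb{R}^m)$ is a statistic, with $T_D=T_n[D]$ and $T_{D_{(-i)}}=T_{n-1}[D_{(-i)}]$; $L:\mathbb{R}^m\times\mathbb{R}^m\to\mathbb{R}$ is a loss function. For $z=(x,y)$ put $f_D(z)=L(T_D(x),y)$ and $f_i(z)=L(T_{D_{(-i)}}(x),y)$; $\mathbb{E}[L(T_D(x),y)]$ and $\mathbb{E}[f_i(z)]$ are expectations over the data with $z$ fixed, and $\mathbb{E}[f_i(z)]$ does not depend on $i$. Growth: a function $g$ of $z$ has linear growth if $\|\nabla g\|_\infty<\infty$,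 and quadratic growth if $|g(z_1)-g(z_2)|\le c_l\|z_1-z_2\|+c_q\|z_1-z_2\|^2$ for some constants $c_l,c_q$ and all $z_1,z_2$. Leave-one-out quantities: $\hat L_{LOO}=\frac1n\sum_{i=1}^n f_i(Z_i)$ and $L_{LOO}=\mathbb{E}[f_D(Z)\mid D]$, where $Z=(X,Y)\sim\mu$ is independent of $D$. Stability: $(T,L)$ is $(\delta_1,\delta_2,\delta_3)$-stable if $\delta_1(n,z),\delta_2(n,z),\delta_3(n)$ are non-negative functions tending to $0$ as $n\to\infty$ such that (i) for any point $D\in\mathbb{R}^{(k+m)n}$ and any $z=(x,y)\in\mathbb{R}^{k+m}$, $\|\nabla_D L(T_D(x),y)\|\le\delta_1(n,z)+\delta_2(n,z)\|D\|$; and (ii) for a dataset $D$ of length $n$ whose distribution $\mu$ satisfies $\sigma^2(\mu)<\infty$, $|\mathbb{E}[L(T_{D_{(-i)}}(X_i),Y_i)]-\mathbb{E}[L(T_D(X),Y)]|<\delta_3(n)$ for $i=1,\dots,n$, with $(X,Y)\sim\mu$ independent of $D$.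
   Formalization: θ1 uses δ_j(n−1,z), since f_i is built from T_{n−1}; the displayed δ_j(n,z) form is false in general and is proved if the index-n gradient bound also holds for T_{n−1}. Growth is assumed for both E[f_D(z)] and E[f_i(z)], same type and constants. *)

theory Defs
  imports "HOL-Probability.Probability"
begin

subsection \<open>The log-Sobolev constant\<close>

text \<open>For a general law \<open>\<mu>\<close> the Sobolev Hilbert space is the closure, in the graph norm of
  \<open>L\<^sup>2(\<mu>)\<close>, of the \<open>C\<^sup>1\<close> functions that are square integrable together with their gradient. Its
  elements are recorded as pairs of a function and a gradient, because for singular \<open>\<mu>\<close> the
  function need not determine the gradient.\<close>

definition C1_L2 :: "'z::euclidean_space measure \<Rightarrow> (('z \<Rightarrow> real) \<times> ('z \<Rightarrow> 'z)) set" where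
  "C1_L2 \<mu> = {(\<phi>, \<Phi>). (\<forall>z. GDERIV \<phi> z :> \<Phi> z) \<and> continuous_on UNIV \<Phi> \<and>
      integrable \<mu> (\<lambda>z. (\<phi> z)\<^sup>2) \<and> integrable \<mu> (\<lambda>z. (norm (\<Phi> z))\<^sup>2)}"

definition W12 :: "'z::euclidean_space measure \<Rightarrow> (('z \<Rightarrow> real) \<times> ('z \<Rightarrow> 'z)) set" where
  "W12 \<mu> = {(f, G). f \<in> borel_measurable \<mu> \<and> G \<in> borel_measurable \<mu> \<and>
      integrable \<mu> (\<lambda>z. (f z)\<^sup>2) \<and> integrable \<mu> (\<lambda>z. (norm (G z))\<^sup>2) \<and>
      (\<exists>\<phi> \<Phi>. (\<forall>j::nat. (\<phi> j, \<Phi> j) \<in> C1_L2 \<mu>) \<and>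
        (\<lambda>j. \<integral>z. (\<phi> j z - f z)\<^sup>2 \<partial>\<mu>) \<longlonglongrightarrow> 0 \<and>
        (\<lambda>j. \<integral>z. (norm (\<Phi> j z - G z))\<^sup>2 \<partial>\<mu>) \<longlonglongrightarrow> 0)}"

text \<open>Used for nonnegative \<open>\<mu>\<close>-integrable \<open>g\<close> and a probability measure \<open>\<mu>\<close>. As \<open>g ln g\<close> is bounded
  below, its integral is \<open>+\<infinity>\<close> when it is not integrable; otherwise the difference is
  nonnegative by Jensen's inequality, so \<open>ennreal\<close> does not truncate.\<close>

definition ent :: "'z measure \<Rightarrow> ('z \<Rightarrow> real) \<Rightarrow> ennreal" where
  "ent \<mu> g = (if integrable \<mu> (\<lambda>z. g z * ln (g z))
     then ennreal ((\<integral>z. g z * ln (g z) \<partial>\<mu>) - (\<integral>z. g z \<partial>\<mu>) * ln (\<integral>z. g z \<partial>\<mu>))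
     else \<infinity>)"

text \<open>In \<open>ennreal\<close>, \<open>0 / 0 = 0\<close> and \<open>a / 0 = \<infinity>\<close> for \<open>a > 0\<close>; so constants do not contribute, and
  a function with vanishing gradient and positive entropy makes the constant infinite.\<close>

definition log_sobolev :: "'z::euclidean_space measure \<Rightarrow> ennreal" where
  "log_sobolev \<mu> = (SUP (f, G) \<in> W12 \<mu>.
     (1 / 2) * (ent \<mu> (\<lambda>z. (f z)\<^sup>2) / (\<integral>\<^sup>+z. ennreal ((norm (G z))\<^sup>2) \<partial>\<mu>)))"

subsection \<open>Datasets\<close>

text \<open>A dataset of length \<open>n\<close> is an extensional function in \<open>{..<n} \<rightarrow>\<^sub>E UNIV\<close>, the underlying
  space of the product measure of \<open>n\<close> copies of the law; samples are numbered from 0.\<close>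

definition data_norm :: "nat \<Rightarrow> (nat \<Rightarrow> 'z::real_normed_vector) \<Rightarrow> real" where
  "data_norm n D = L2_set (\<lambda>i. norm (D i)) {..<n}"

definition leave_out :: "nat \<Rightarrow> nat \<Rightarrow> (nat \<Rightarrow> 'z) \<Rightarrow> nat \<Rightarrow> 'z" where
  "leave_out n i D = (\<lambda>j\<in>{..<n - 1}. if j < i then D j else D (Suc j))"

text \<open>\<open>G\<close> is the (Frechet) gradient at \<open>D\<close> of a function of \<open>n\<close> data points.\<close>

definition has_data_gradient ::
  "nat \<Rightarrow> ((nat \<Rightarrow> 'z::euclidean_space) \<Rightarrow> real) \<Rightarrow> (nat \<Rightarrow> 'z) \<Rightarrow> (nat \<Rightarrow> 'z) \<Rightarrow> bool" where
  "has_data_gradient n F D G \<longleftrightarrow>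
     (\<forall>e>0. \<exists>d>0. \<forall>D' \<in> {..<n} \<rightarrow>\<^sub>E UNIV. data_norm n (\<lambda>i. D' i - D i) < d \<longrightarrow>
        \<bar>F D' - F D - (\<Sum>i<n. G i \<bullet> (D' i - D i))\<bar> \<le> e * data_norm n (\<lambda>i. D' i - D i))"

subsection \<open>Statistics, losses and growth\<close>

type_synonym ('a, 'b) statistic = "nat \<Rightarrow> (nat \<Rightarrow> 'a \<times> 'b) \<Rightarrow> 'a \<Rightarrow> 'b"

definition is_statistic ::
  "('a::euclidean_space, 'b::euclidean_space) statistic \<Rightarrow> bool" where
  "is_statistic T \<longleftrightarrow> (\<forall>n. \<forall>D \<in> {..<n} \<rightarrow>\<^sub>E UNIV. continuous_on UNIV (T n D))"

text \<open>\<open>loss T L n D\<close> is \<open>f_D\<close>, and \<open>loss T L (n - 1) (leave_out n i D)\<close> is \<open>f_i\<close>.\<close>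

definition loss ::
  "('a, 'b) statistic \<Rightarrow> ('b \<Rightarrow> 'b \<Rightarrow> real) \<Rightarrow> nat \<Rightarrow> (nat \<Rightarrow> 'a \<times> 'b) \<Rightarrow> 'a \<times> 'b \<Rightarrow> real" where
  "loss T L n D z = L (T n D (fst z)) (snd z)"

definition expected_loss ::
  "('a \<times> 'b) measure \<Rightarrow> ('a, 'b) statistic \<Rightarrow> ('b \<Rightarrow> 'b \<Rightarrow> real) \<Rightarrow> nat \<Rightarrow> 'a \<times> 'b \<Rightarrow> real" where
  "expected_loss \<mu> T L n z = (\<integral>D. loss T L n D z \<partial>(\<Pi>\<^sub>M i\<in>{..<n}. \<mu>))"

text \<open>\<open>Linear K\<close>: the gradient is bounded by \<open>K\<close>. \<open>Quadratic cl cq\<close>: the constants \<open>c_l\<close>, \<open>c_q\<close>.\<close>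

datatype growth = Linear real | Quadratic real real

fun has_growth :: "growth \<Rightarrow> ('z::euclidean_space \<Rightarrow> real) \<Rightarrow> bool" where
  "has_growth (Linear K) g \<longleftrightarrow> (\<forall>z. \<exists>G. (GDERIV g z :> G) \<and> norm G \<le> K)"
| "has_growth (Quadratic cl cq) g \<longleftrightarrow>
     (\<forall>z1 z2. \<bar>g z1 - g z2\<bar> \<le> cl * norm (z1 - z2) + cq * (norm (z1 - z2))\<^sup>2)"

subsection \<open>Stability\<close>

definition gradient_bound ::
  "('a::euclidean_space, 'b::euclidean_space) statistic \<Rightarrow> ('b \<Rightarrow> 'b \<Rightarrow> real) \<Rightarrow> nat
    \<Rightarrow> ('a \<times> 'b \<Rightarrow> real) \<Rightarrow> ('a \<times> 'b \<Rightarrow> real) \<Rightarrow> bool" where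
  "gradient_bound T L n d1 d2 \<longleftrightarrow>
     (\<forall>D \<in> {..<n} \<rightarrow>\<^sub>E UNIV. \<forall>z. \<exists>G. has_data_gradient n (\<lambda>D. loss T L n D z) D G \<and>
        data_norm n G \<le> d1 z + d2 z * data_norm n D)"

text \<open>The integrability clauses say that the two expectations being compared exist. Only the
  law \<open>\<mu>\<close> at hand is used in the comparison of expectations; \<open>(T, L)\<close> is stable for all laws with
  finite log-Sobolev constant iff this predicate holds for each of them.\<close>

definition is_stable ::
  "('a::euclidean_space \<times> 'b::euclidean_space) measure \<Rightarrow> ('a, 'b) statistic \<Rightarrow> ('b \<Rightarrow> 'b \<Rightarrow> real)
    \<Rightarrow> (nat \<Rightarrow> 'a \<times> 'b \<Rightarrow> real) \<Rightarrow> (nat \<Rightarrow> 'a \<times> 'b \<Rightarrow> real) \<Rightarrow> (nat \<Rightarrow> real) \<Rightarrow> bool" where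
  "is_stable \<mu> T L \<delta>1 \<delta>2 \<delta>3 \<longleftrightarrow>
     (\<forall>n z. 0 \<le> \<delta>1 n z \<and> 0 \<le> \<delta>2 n z \<and> 0 \<le> \<delta>3 n) \<and>
     (\<forall>n. \<delta>1 n \<in> borel_measurable borel \<and> \<delta>2 n \<in> borel_measurable borel) \<and>
     (\<forall>z. (\<lambda>n. \<delta>1 n z) \<longlonglongrightarrow> 0 \<and> (\<lambda>n. \<delta>2 n z) \<longlonglongrightarrow> 0) \<and> \<delta>3 \<longlonglongrightarrow> 0 \<and>
     (\<forall>n. gradient_bound T L n (\<delta>1 n) (\<delta>2 n)) \<and>
     (log_sobolev \<mu> < \<infinity> \<longrightarrow>
       (\<forall>n. \<forall>i<n.
          integrable (\<Pi>\<^sub>M i\<in>{..<n}. \<mu>) (\<lambda>D. loss T L (n - 1) (leave_out n i D) (D i)) \<and>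
          integrable ((\<Pi>\<^sub>M i\<in>{..<n}. \<mu>) \<Otimes>\<^sub>M \<mu>) (\<lambda>(D, z). loss T L n D z) \<and>
          \<bar>(\<integral>D. loss T L (n - 1) (leave_out n i D) (D i) \<partial>(\<Pi>\<^sub>M i\<in>{..<n}. \<mu>)) -
            (\<integral>(D, z). loss T L n D z \<partial>((\<Pi>\<^sub>M i\<in>{..<n}. \<mu>) \<Otimes>\<^sub>M \<mu>))\<bar> < \<delta>3 n))"

subsection \<open>Random data and the leave-one-out quantities\<close>

definition dataset :: "nat \<Rightarrow> (nat \<Rightarrow> 'w \<Rightarrow> 'z) \<Rightarrow> 'w \<Rightarrow> nat \<Rightarrow> 'z" where
  "dataset n Zs \<omega> = (\<lambda>i\<in>{..<n}. Zs i \<omega>)"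

text \<open>In the independent family the index \<open>n\<close> stands for the further copy \<open>Z\<close>.\<close>

definition iid_data ::
  "'w measure \<Rightarrow> 'z::euclidean_space measure \<Rightarrow> nat \<Rightarrow> (nat \<Rightarrow> 'w \<Rightarrow> 'z) \<Rightarrow> ('w \<Rightarrow> 'z) \<Rightarrow> bool" where
  "iid_data P \<mu> n Zs Z \<longleftrightarrow> prob_space P \<and>
     prob_space.indep_vars P (\<lambda>_. borel) (\<lambda>i. if i < n then Zs i else Z) {..n} \<and>
     (\<forall>i<n. distr P borel (Zs i) = \<mu>) \<and> distr P borel Z = \<mu>"

definition L_loo_hat ::
  "('a, 'b) statistic \<Rightarrow> ('b \<Rightarrow> 'b \<Rightarrow> real) \<Rightarrow> nat \<Rightarrow> (nat \<Rightarrow> 'w \<Rightarrow> 'a \<times> 'b) \<Rightarrow> 'w \<Rightarrow> real" where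
  "L_loo_hat T L n Zs \<omega> =
     (\<Sum>i<n. loss T L (n - 1) (leave_out n i (dataset n Zs \<omega>)) (Zs i \<omega>)) / real n"

text \<open>The conditional expectation given the sigma-algebra generated by the dataset.\<close>

definition L_loo ::
  "'w measure \<Rightarrow> ('a::euclidean_space, 'b::euclidean_space) statistic \<Rightarrow> ('b \<Rightarrow> 'b \<Rightarrow> real) \<Rightarrow> nat
    \<Rightarrow> (nat \<Rightarrow> 'w \<Rightarrow> 'a \<times> 'b) \<Rightarrow> ('w \<Rightarrow> 'a \<times> 'b) \<Rightarrow> 'w \<Rightarrow> real" where
  "L_loo P T L n Zs Z =
     real_cond_exp P (vimage_algebra (space P) (dataset n Zs) (\<Pi>\<^sub>M i\<in>{..<n}. borel))
       (\<lambda>\<omega>. loss T L n (dataset n Zs \<omega>) (Z \<omega>))"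

subsection \<open>The bounds\<close>

text \<open>The exponential of \<open>- a / b\<close> for \<open>a > 0\<close> and \<open>b \<ge> 0\<close>, read as 0 when \<open>b = 0\<close>
  (in HOL the quotient would be 0).\<close>

definition exp_frac :: "real \<Rightarrow> real \<Rightarrow> real" where
  "exp_frac a b = (if b = 0 then 0 else exp (- (a / b)))"

definition second_moment :: "'z::euclidean_space measure \<Rightarrow> real" where
  "second_moment \<mu> = (\<integral>z. (norm z)\<^sup>2 \<partial>\<mu>)"

definition theta1 ::
  "'z::euclidean_space measure \<Rightarrow> real \<Rightarrow> ('z \<Rightarrow> real) \<Rightarrow> ('z \<Rightarrow> real) \<Rightarrow> nat \<Rightarrow> real \<Rightarrow> 'z \<Rightarrow> real" where
  "theta1 \<mu> C1 d1 d2 n t z =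
     max (exp_frac (t\<^sup>2)
            (8 * C1 * ((d1 z)\<^sup>2 + (d2 z)\<^sup>2 * real n * (second_moment \<mu> + 16 * C1))))
         (exp_frac t (8 * C1 * d2 z))"

fun theta2 :: "growth \<Rightarrow> real \<Rightarrow> nat \<Rightarrow> real \<Rightarrow> real" where
  "theta2 (Linear _) C n t = exp (- (t\<^sup>2 * real n) / (2 * C))"
| "theta2 (Quadratic _ _) C n t =
     max (exp (- (t\<^sup>2 * real n) / (2 * C))) (exp (- (t * real n) / (2 * sqrt C)))"

text \<open>An infinite expectation of \<open>d1\<close> or \<open>d2\<close> in the denominator makes the exponential equal to 1.\<close>

definition theta3 ::
  "'z::euclidean_space measure \<Rightarrow> real \<Rightarrow> ('z \<Rightarrow> real) \<Rightarrow> ('z \<Rightarrow> real) \<Rightarrow> nat \<Rightarrow> real \<Rightarrow> real" where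
  "theta3 \<mu> C1 d1 d2 n t =
     (if integrable \<mu> d1 \<and> integrable \<mu> d2 then
        max (exp_frac (t\<^sup>2)
               (8 * C1 * ((\<integral>z. d1 z \<partial>\<mu>)\<^sup>2
                  + (\<integral>z. d2 z \<partial>\<mu>)\<^sup>2 * real n * (second_moment \<mu> + 16 * C1))))
            (exp_frac t (8 * C1 * (\<integral>z. d2 z \<partial>\<mu>)))
      else 1)"

text \<open>The right-hand side of the deviation inequality. The index \<open>N\<close> selects the stability
  coefficients used in \<open>theta1\<close>. This term controls the leave-one-out losses, which are built from
  the statistic on \<open>n - 1\<close> points: stability bounds their gradient by the coefficients with index
  \<open>n - 1\<close>, and \<open>N = n\<close> requires that those with index \<open>n\<close> bound it as well.\<close>

definition deviation_bound ::
  "'z::euclidean_space measure \<Rightarrow> (nat \<Rightarrow> 'z \<Rightarrow> real) \<Rightarrow> (nat \<Rightarrow> 'z \<Rightarrow> real) \<Rightarrow> (nat \<Rightarrow> real)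
    \<Rightarrow> growth \<Rightarrow> real \<Rightarrow> real \<Rightarrow> nat \<Rightarrow> nat \<Rightarrow> real \<Rightarrow> real" where
  "deviation_bound \<mu> \<delta>1 \<delta>2 \<delta>3 \<gamma> C C1 n N \<epsilon> =
     real n * (\<integral>z. theta1 \<mu> C1 (\<delta>1 N) (\<delta>2 N) n (\<epsilon> / 3) z \<partial>\<mu>)
     + theta2 \<gamma> C n (\<epsilon> / 3)
     + theta3 \<mu> C1 (\<delta>1 n) (\<delta>2 n) n (\<epsilon> / 3 - \<delta>3 n)"

end

theory Submission
  imports Defs
begin

text \<open>The log-Sobolev inequality passes to products by tensorization of entropy, and Herbst's argument
  turns it into exponential moments. For a function \<open>F\<close> of the data with gradient at most
  \<open>a + b \<parallel>D\<parallel>\<close>, the entropy of \<open>exp (\<lambda> F)\<close> involves \<open>\<parallel>D\<parallel>\<^sup>2 exp (\<lambda> F)\<close>; this term is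
  absorbed by entropy duality, because the data norm is sub-Gaussian, and a Bernstein type tail for
  \<open>F\<close> results. Only increments of \<open>F\<close> are used: \<open>F\<close> is truncated and mollified first, since the
  law may be singular and the inequality is only available for \<open>C\<^sup>1\<close> functions. The deviation
  \<open>L_LOO - L_LOO_hat\<close> splits into the fluctuation of the conditional loss around its mean (\<open>theta3\<close>),
  the bias \<open>\<delta>3\<close>, the fluctuation of the mean of \<open>g (Z_i)\<close> with \<open>g = E f_i\<close> (\<open>theta2\<close>), and the
  differences \<open>g (Z_i) - f_i (Z_i)\<close>, which are bounded conditionally on \<open>Z_i\<close> (\<open>theta1\<close>).\<close>

section \<open>Entropy\<close>

text \<open>The Lipschitz constant of the losses in the data may grow linearly with the norm of
  \<open>D\<close>, so a purely Gaussian tail cannot be expected, and finiteness of exponential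
  moments is itself part of the claim. Every estimate is therefore proved for bounded
  approximations, with constants that do not see the bound, and transferred by Fatou's lemma.
  Truncation destroys differentiability but keeps bounds on increments, which makes them the
  invariant; Rademacher's theorem would not repair this, as its exceptional null set may carry all
  of a singular law. The second moment in the exponents is not assumed finite: it comes from
  Herbst's argument for a bounded version of minus the squared norm. The tail has the two regimes of
  a sub-gamma variable: the log moment generating function of \<open>F\<close> minus its mean is at
  most \<open>c v l^2 / (1 - 2 c b l)\<close> with \<open>v = a^2 + b^2 n M\<close> and
  \<open>M\<close> the second moment. For \<open>V\<close> at least \<open>v\<close>, the choices
  \<open>l = t / (4 c V)\<close> and \<open>l = 1 / (4 c b)\<close> give the two exponentials and
  the factor 8.\<close>

definition real_ent :: "'a measure \<Rightarrow> ('a \<Rightarrow> real) \<Rightarrow> real" where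
  "real_ent M Y = (\<integral>x. Y x * ln (Y x) \<partial>M) - (\<integral>x. Y x \<partial>M) * ln (\<integral>x. Y x \<partial>M)"

context prob_space
begin

lemma integrable_bdd:
  fixes f :: "'a \<Rightarrow> 'b::{banach, second_countable_topology}"
  assumes "f \<in> borel_measurable M" "\<And>x. x \<in> space M \<Longrightarrow> norm (f x) \<le> B"
  shows "integrable M f"
  using assms by (intro integrable_const_bound[where B=B]) auto

lemma integral_mono_bounds:
  assumes "integrable M f" "\<And>x. x \<in> space M \<Longrightarrow> c \<le> f x" "\<And>x. x \<in> space M \<Longrightarrow> f x \<le> (d::real)"
  shows "c \<le> (\<integral>x. f x \<partial>M)" "(\<integral>x. f x \<partial>M) \<le> d"
  using integral_ge_const[OF assms(1)] integral_le_const[OF assms(1)] assms(2,3) by auto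

lemma abs_ln_bound:
  fixes y :: real
  assumes "0 < c" "c \<le> y" "y \<le> C"
  shows "\<bar>ln y\<bar> \<le> \<bar>ln c\<bar> + \<bar>ln C\<bar>"
  using assms ln_le_cancel_iff[of c y] ln_le_cancel_iff[of y C] by linarith

lemma integrable_xlnx:
  fixes Y :: "'a \<Rightarrow> real"
  assumes "Y \<in> borel_measurable M" "0 < c" "\<And>x. x \<in> space M \<Longrightarrow> c \<le> Y x" "\<And>x. x \<in> space M \<Longrightarrow> Y x \<le> C"
  shows "integrable M (\<lambda>x. Y x * ln (Y x))"
proof (rule integrable_bdd[where B="C * (\<bar>ln c\<bar> + \<bar>ln C\<bar>)"])
  fix x assume "x \<in> space M"
  then show "norm (Y x * ln (Y x)) \<le> C * (\<bar>ln c\<bar> + \<bar>ln C\<bar>)"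
    using assms(2) assms(3,4)[of x] abs_ln_bound[of c "Y x" C] by (auto simp: abs_mult intro!: mult_mono)
qed (use assms in measurable)

text \<open>Gibbs' variational inequality for an unnormalized density: with \<open>A\<close> and
  \<open>B\<close> the integrals of \<open>Y\<close> and \<open>exp g\<close>, the difference of the
  two sides is \<open>A\<close> times the relative entropy of the density \<open>Y / A\<close> with
  respect to \<open>exp g / B\<close>.\<close>

lemma entropy_duality:
  assumes Y: "Y \<in> borel_measurable M" "0 < c" "\<And>x. x \<in> space M \<Longrightarrow> c \<le> Y x" "\<And>x. x \<in> space M \<Longrightarrow> Y x \<le> C"
    and g: "integrable M (\<lambda>x. exp (g x))" "integrable M (\<lambda>x. Y x * g x)"
  shows "(\<integral>x. Y x * g x \<partial>M) \<le> real_ent M Y + (\<integral>x. Y x \<partial>M) * ln (\<integral>x. exp (g x) \<partial>M)"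
proof -
  define A where "A = (\<integral>x. Y x \<partial>M)"
  define B where "B = (\<integral>x. exp (g x) \<partial>M)"
  have iY: "integrable M Y"
    using Y by (intro integrable_bdd[where B=C]) force+
  have iL: "integrable M (\<lambda>x. Y x * ln (Y x))"
    by (rule integrable_xlnx[OF Y])
  have A: "A > 0" using integral_mono_bounds(1)[OF iY Y(3)] Y(2,4) unfolding A_def
    by fastforce
  have B: "B > 0"
    unfolding B_def by (rule expectation_greater) (use g in auto)
  have "(\<integral>x. Y x * g x - Y x * ln (Y x) - Y x * (ln B - ln A) \<partial>M)
      \<le> (\<integral>x. A / B * exp (g x) - Y x \<partial>M)"
  proof (rule integral_mono)
    fix x assume "x \<in> space M"
    then have y: "Y x > 0" using Y(2,3) by fastforce
    \<comment> \<open>The ratio of the two normalized densities. Multiplied by \<open>Y x\<close>,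
      the bound \<open>ln t \<le> t - 1\<close> has a right-hand side of integral zero.\<close>
    define t where "t = exp (g x) * A / (B * Y x)"
    have t: "t > 0" unfolding t_def using A B y by auto
    have "ln t = g x + ln A - (ln B + ln (Y x))"
      unfolding t_def using A B y by (simp add: ln_div ln_mult)
    moreover have "ln t \<le> t - 1" using t by (rule ln_le_minus_one)
    ultimately have "Y x * (g x + ln A - (ln B + ln (Y x))) \<le> Y x * (t - 1)"
      using y by (intro mult_left_mono) auto
    moreover have "Y x * (t - 1) = A / B * exp (g x) - Y x"
      unfolding t_def using y B by (simp add: field_simps)
    ultimately show "Y x * g x - Y x * ln (Y x) - Y x * (ln B - ln A) \<le> A / B * exp (g x) - Y x"
      by (simp add: algebra_simps)
  qed (use g iY iL in auto)
  also have "(\<integral>x. A / B * exp (g x) - Y x \<partial>M) = 0"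
    using g iY B by (simp add: A_def[symmetric] B_def[symmetric])
  also have "(\<integral>x. Y x * g x - Y x * ln (Y x) - Y x * (ln B - ln A) \<partial>M)
      = (\<integral>x. Y x * g x \<partial>M) - (\<integral>x. Y x * ln (Y x) \<partial>M) - A * (ln B - ln A)"
    using g iY iL by (simp add: A_def[symmetric])
  finally show ?thesis
    unfolding real_ent_def A_def[symmetric] B_def[symmetric] by (simp add: algebra_simps)
qed

end

section \<open>Fubini for one added coordinate and the subadditivity of entropy\<close>

lemma integral_PiM_insert:
  fixes f :: "_ \<Rightarrow> 'b::{banach, second_countable_topology}"
  assumes M: "prob_space N" "\<And>j. j \<in> I \<Longrightarrow> prob_space (M j)" "M i = N" and i: "finite I" "i \<notin> I"
    and f: "integrable (Pi\<^sub>M (insert i I) M) f"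
  shows "(\<integral>x. f x \<partial>Pi\<^sub>M (insert i I) M) = (\<integral>x. (\<integral>z. f (x(i:=z)) \<partial>N) \<partial>Pi\<^sub>M I M)" (is ?fst)
    and "(\<integral>x. f x \<partial>Pi\<^sub>M (insert i I) M) = (\<integral>z. (\<integral>x. f (x(i:=z)) \<partial>Pi\<^sub>M I M) \<partial>N)" (is ?snd)
    and "integrable N (\<lambda>z. (\<integral>x. f (x(i:=z)) \<partial>Pi\<^sub>M I M))"
    and "integrable (Pi\<^sub>M I M) (\<lambda>x. (\<integral>z. f (x(i:=z)) \<partial>N))"
proof -
  interpret N: prob_space N by fact
  interpret P: prob_space "Pi\<^sub>M I M" by (intro prob_space_PiM M)
  interpret NP: pair_prob_space N "Pi\<^sub>M I M" ..
  have d: "distr (N \<Otimes>\<^sub>M Pi\<^sub>M I M) (Pi\<^sub>M (insert i I) M) (\<lambda>(z, x). x(i := z)) = Pi\<^sub>M (insert i I) M"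
    using distr_pair_PiM_eq_PiM[of I M i] M by simp
  have m: "(\<lambda>(z, x). x(i := z)) \<in> measurable (N \<Otimes>\<^sub>M Pi\<^sub>M I M) (Pi\<^sub>M (insert i I) M)"
    unfolding case_prod_beta' using M(3)
    by (intro measurable_fun_upd[where J=I] measurable_snd) auto
  have ip: "integrable (N \<Otimes>\<^sub>M Pi\<^sub>M I M) (\<lambda>(z, x). f (x(i:=z)))"
    using integrable_distr[OF m] f unfolding d by (simp add: case_prod_beta')
  have e: "(\<integral>x. f x \<partial>Pi\<^sub>M (insert i I) M) = (\<integral>(z, x). f (x(i:=z)) \<partial>(N \<Otimes>\<^sub>M Pi\<^sub>M I M))"
    using integral_distr[OF m, of f] f unfolding d by (simp add: case_prod_beta' borel_measurable_integrable)
  show ?snd unfolding e using NP.integral_fst'[OF ip] by simp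
  show ?fst unfolding e using NP.integral_snd[OF ip] by simp
  show "integrable N (\<lambda>z. (\<integral>x. f (x(i:=z)) \<partial>Pi\<^sub>M I M))" using NP.integrable_fst'[OF ip] by simp
  show "integrable (Pi\<^sub>M I M) (\<lambda>x. (\<integral>z. f (x(i:=z)) \<partial>N))" using NP.integrable_snd[OF ip] by simp
qed

lemma measurable_upd_fixed[measurable (raw)]:
  assumes "z \<in> space (M i)"
  shows "(\<lambda>x. x(i := z)) \<in> measurable (Pi\<^sub>M I M) (Pi\<^sub>M (insert i I) M)"
  using assms by (intro measurable_fun_upd[where J=I]) auto

text \<open>Induction on the coordinates by the chain rule: the entropy on \<open>insert i I\<close>
  is the mean entropy in coordinate \<open>i\<close> plus the entropy of the average
  \<open>h\<close> over that coordinate. Duality bounds the latter by the mean over \<open>z\<close>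
  of the entropies of the slices \<open>Y (x(i:=z))\<close>, to which the induction hypothesis
  applies. The coordinate bounds are carried by functions \<open>G i\<close> and assumed at every
  \<open>x\<close>, so that slices inherit them. The lower bound \<open>c\<close> keeps all
  logarithms bounded.\<close>

lemma entropy_tensor:
  fixes \<mu> :: "'z measure" and Y :: "('i \<Rightarrow> 'z) \<Rightarrow> real"
  assumes "prob_space \<mu>" "finite I" "0 < c"
    and "Y \<in> borel_measurable (Pi\<^sub>M I (\<lambda>_. \<mu>))" "\<And>x. c \<le> Y x" "\<And>x. Y x \<le> C"
    and "\<And>i. i \<in> I \<Longrightarrow> G i \<in> borel_measurable (Pi\<^sub>M I (\<lambda>_. \<mu>))" "\<And>i x. \<bar>G i x\<bar> \<le> B"
    and "\<And>i x. i \<in> I \<Longrightarrow> real_ent \<mu> (\<lambda>z. Y (x(i:=z))) \<le> (\<integral>z. G i (x(i:=z)) \<partial>\<mu>)"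
  shows "real_ent (Pi\<^sub>M I (\<lambda>_. \<mu>)) Y \<le> (\<Sum>i\<in>I. \<integral>x. G i x \<partial>Pi\<^sub>M I (\<lambda>_. \<mu>))"
  using assms(2,4-)
proof (induction I arbitrary: Y G rule: finite_induct)
  case empty
  interpret P: prob_space "Pi\<^sub>M {} (\<lambda>_. \<mu>)" by (intro prob_space_PiM assms(1))
  show ?case
    unfolding real_ent_def by (simp add: PiM_empty lebesgue_integral_count_space_finite)
next
  case (insert i I)
  interpret N: prob_space \<mu> by fact
  let ?P = "Pi\<^sub>M I (\<lambda>_. \<mu>)" and ?Q = "Pi\<^sub>M (insert i I) (\<lambda>_. \<mu>)"
  interpret P: prob_space ?P by (intro prob_space_PiM assms(1))
  interpret Q: prob_space ?Q by (intro prob_space_PiM assms(1))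
  interpret NP: pair_prob_space \<mu> ?P ..
  note ins = integral_PiM_insert[OF \<open>prob_space \<mu>\<close> \<open>prob_space \<mu>\<close> refl insert(1,2)]
  have Yb: "\<bar>Y x\<bar> \<le> C" for x using insert.prems(2,3)[of x] \<open>0 < c\<close> by linarith
  have Y_[measurable]: "Y \<in> borel_measurable ?Q" by fact
  have G_[measurable]: "\<And>j. j \<in> insert i I \<Longrightarrow> G j \<in> borel_measurable ?Q" by fact
  have YP: "(\<lambda>x. Y (x(i:=z))) \<in> borel_measurable ?P" if "z \<in> space \<mu>" for z
    using that by (intro measurable_compose[OF _ Y_]) measurable
  have GP: "(\<lambda>x. G j (x(i:=z))) \<in> borel_measurable ?P" if "z \<in> space \<mu>" "j \<in> I" for z j
    using that by (intro measurable_compose[OF _ G_]) measurable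
  have YN: "(\<lambda>z. Y (x(i:=z))) \<in> borel_measurable \<mu>" if "x \<in> space ?P" for x
    using that by (intro measurable_compose[OF _ Y_] measurable_component_update) (auto simp: insert)
  have iYN: "integrable \<mu> (\<lambda>z. Y (x(i:=z)))" if "x \<in> space ?P" for x
    using Yb by (intro N.integrable_bdd[where B=C] YN that) auto
  define h where "h x = (\<integral>z. Y (x(i:=z)) \<partial>\<mu>)" for x
  have iY: "integrable ?Q Y" using Yb by (intro Q.integrable_bdd[where B=C]) auto
  have iYl: "integrable ?Q (\<lambda>x. Y x * ln (Y x))"
    using insert.prems(2,3) \<open>0<c\<close> by (intro Q.integrable_xlnx[where c=c and C=C]) auto
  have ih: "integrable ?P h" unfolding h_def by (rule ins(4)[OF iY])
  have [measurable]: "h \<in> borel_measurable ?P" using ih by simp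
  have hb: "c \<le> h x" "h x \<le> C" if "x \<in> space ?P" for x
    unfolding h_def using N.integral_mono_bounds[OF iYN[OF that], of c C] insert.prems(2,3) by auto
  have ihl: "integrable ?P (\<lambda>x. h x * ln (h x))"
    using hb \<open>0<c\<close> by (intro P.integrable_xlnx[where c=c and C=C]) auto
  define A where "A = (\<integral>x. h x \<partial>?P)"
  have A: "A = (\<integral>x. Y x \<partial>?Q)" unfolding A_def h_def by (rule ins(1)[OF iY, symmetric])
  have A0: "c \<le> A" "A \<le> C" unfolding A_def using P.integral_mono_bounds[OF ih, of c C] hb by auto
  \<comment> \<open>Chain rule: the terms \<open>h ln h\<close> cancel after averaging over the
    remaining coordinates.\<close>
  have 1: "real_ent ?Q Y = (\<integral>x. real_ent \<mu> (\<lambda>z. Y (x(i:=z))) \<partial>?P) + real_ent ?P h"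
    unfolding real_ent_def h_def[symmetric] A_def[symmetric] A[symmetric] ins(1)[OF iYl]
    using ins(4)[OF iYl] ihl by simp
  have iGi: "integrable ?Q (G j)" if "j \<in> insert i I" for j
    using insert.prems(5) that by (intro Q.integrable_bdd[where B=B]) auto
  have 2: "(\<integral>x. real_ent \<mu> (\<lambda>z. Y (x(i:=z))) \<partial>?P) \<le> (\<integral>x. G i x \<partial>?Q)"
    unfolding ins(1)[OF iGi[OF insertI1]]
  proof (rule integral_mono)
    show "integrable ?P (\<lambda>x. real_ent \<mu> (\<lambda>z. Y (x(i:=z))))"
      unfolding real_ent_def h_def[symmetric] using ins(4)[OF iYl] ihl by simp
    show "integrable ?P (\<lambda>x. \<integral>z. G i (x(i:=z)) \<partial>\<mu>)" by (rule ins(4)[OF iGi[OF insertI1]])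
  qed (intro insert.prems(6) insertI1)
  \<comment> \<open>The optimal function in the dual formula for the entropy of \<open>h\<close>. As
    \<open>exp g\<close> has mean 1, the logarithm in \<open>entropy_duality\<close> vanishes for
    every slice.\<close>
  define g where "g x = ln (h x) - ln A" for x
  have gb: "\<bar>g x\<bar> \<le> 2 * (\<bar>ln c\<bar> + \<bar>ln C\<bar>)" if "x \<in> space ?P" for x
    unfolding g_def using P.abs_ln_bound[OF \<open>0<c\<close> hb[OF that]] P.abs_ln_bound[OF \<open>0<c\<close> A0]
    by (intro order_trans[OF abs_triangle_ineq4]) simp
  have [measurable]: "g \<in> borel_measurable ?P" unfolding g_def by measurable
  have eg: "exp (g x) = h x / A" if "x \<in> space ?P" for x
    unfolding g_def using hb[OF that] A0 \<open>0<c\<close> by (simp add: exp_diff)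
  have ieg: "(\<integral>x. exp (g x) \<partial>?P) = 1"
  proof -
    have "(\<integral>x. exp (g x) \<partial>?P) = (\<integral>x. h x / A \<partial>?P)" by (intro Bochner_Integration.integral_cong refl eg)
    also have "\<dots> = 1" using A0 \<open>0<c\<close> A_def by simp
    finally show ?thesis .
  qed
  \<comment> \<open>\<open>g\<close> is a function of the coordinates in \<open>I\<close>; the
    restriction lets it act on points of the larger product.\<close>
  have iYg: "integrable ?Q (\<lambda>x. Y x * g (restrict x I))"
  proof (rule Q.integrable_bdd[where B="C * (2 * (\<bar>ln c\<bar> + \<bar>ln C\<bar>))"])
    show "(\<lambda>x. Y x * g (restrict x I)) \<in> borel_measurable ?Q"
      by (intro borel_measurable_times Y_ measurable_compose[OF measurable_restrict_subset]) auto
    fix x assume "x \<in> space ?Q"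
    then have "restrict x I \<in> space ?P" by (auto simp: space_PiM PiE_def)
    then show "norm (Y x * g (restrict x I)) \<le> C * (2 * (\<bar>ln c\<bar> + \<bar>ln C\<bar>))"
      using gb Yb by (auto simp: abs_mult intro!: mult_mono intro: order_trans[OF abs_ge_zero])
  qed
  have rI: "restrict (x(i:=z)) I = x" if "x \<in> space ?P" for x z
    using that insert.hyps by (auto simp: space_PiM PiE_def extensional_def fun_eq_iff)
  have "real_ent ?P h = (\<integral>x. h x * g x \<partial>?P)"
    unfolding real_ent_def g_def A_def[symmetric] using ihl ih
    by (simp add: right_diff_distrib A_def[symmetric])
  also have "\<dots> = (\<integral>x. (\<integral>z. Y (x(i:=z)) * g (restrict (x(i:=z)) I) \<partial>\<mu>) \<partial>?P)"
    by (intro Bochner_Integration.integral_cong refl) (simp add: rI h_def)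
  also have "\<dots> = (\<integral>z. (\<integral>x. Y (x(i:=z)) * g (restrict (x(i:=z)) I) \<partial>?P) \<partial>\<mu>)"
    using ins(1,2)[OF iYg] by simp
  also have "\<dots> \<le> (\<integral>z. (\<Sum>j\<in>I. \<integral>x. G j (x(i:=z)) \<partial>?P) \<partial>\<mu>)"
  proof (rule integral_mono)
    show "integrable \<mu> (\<lambda>z. (\<integral>x. Y (x(i:=z)) * g (restrict (x(i:=z)) I) \<partial>?P))"
      by (rule ins(3)[OF iYg])
    show "integrable \<mu> (\<lambda>z. (\<Sum>j\<in>I. \<integral>x. G j (x(i:=z)) \<partial>?P))"
      by (intro Bochner_Integration.integrable_sum ins(3) iGi) auto
    fix z assume z: "z \<in> space \<mu>"
    have "(\<integral>x. Y (x(i:=z)) * g (restrict (x(i:=z)) I) \<partial>?P) = (\<integral>x. Y (x(i:=z)) * g x \<partial>?P)"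
      by (intro Bochner_Integration.integral_cong refl) (simp add: rI)
    also have "\<dots> \<le> real_ent ?P (\<lambda>x. Y (x(i:=z))) + (\<integral>x. Y (x(i:=z)) \<partial>?P) * ln (\<integral>x. exp (g x) \<partial>?P)"
    proof (rule P.entropy_duality[where c=c and C=C])
      show "integrable ?P (\<lambda>x. exp (g x))"
        using gb by (intro P.integrable_bdd[where B="exp (2 * (\<bar>ln c\<bar> + \<bar>ln C\<bar>))"]) (auto simp: abs_le_iff)
      show "integrable ?P (\<lambda>x. Y (x(i:=z)) * g x)"
        using gb Yb YP[OF z]
        by (intro P.integrable_bdd[where B="C * (2 * (\<bar>ln c\<bar> + \<bar>ln C\<bar>))"])
          (auto simp: abs_mult intro!: mult_mono intro: order_trans[OF abs_ge_zero])
    qed (use YP[OF z] insert.prems(2,3) \<open>0<c\<close> in auto)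
    also have "\<dots> = real_ent ?P (\<lambda>x. Y (x(i:=z)))" by (simp add: ieg)
    also have "\<dots> \<le> (\<Sum>j\<in>I. \<integral>x. G j (x(i:=z)) \<partial>?P)"
    proof (rule insert.IH)
      fix j x assume j: "j \<in> I"
      then have "i \<noteq> j" using insert by auto
      then have sw: "x(j:=w, i:=z) = (x(i:=z))(j:=w)" for w by (auto simp: fun_eq_iff)
      show "real_ent \<mu> (\<lambda>w. Y (x(j:=w, i:=z))) \<le> (\<integral>w. G j (x(j:=w, i:=z)) \<partial>\<mu>)"
        unfolding sw by (intro insert.prems(6) insertI2 j)
    qed (intro YP GP z insert.prems; assumption)+
    finally show "(\<integral>x. Y (x(i:=z)) * g (restrict (x(i:=z)) I) \<partial>?P)
      \<le> (\<Sum>j\<in>I. \<integral>x. G j (x(i:=z)) \<partial>?P)" .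
  qed
  also have "\<dots> = (\<Sum>j\<in>I. \<integral>x. G j x \<partial>?Q)"
    by (subst Bochner_Integration.integral_sum) (auto intro!: ins(3) iGi sum.cong ins(2)[symmetric])
  finally show ?case using 1 2 insert.hyps by simp
qed

section \<open>The Herbst argument\<close>

text \<open>Supplies a remainder that is uniform over the sample points when a moment generating
  function is differentiated.\<close>

lemma exp_quadratic_bound:
  assumes "\<bar>y::real\<bar> \<le> 1"
  shows "\<bar>exp y - 1 - y\<bar> \<le> y\<^sup>2"
proof (cases "0 \<le> y")
  case True
  then have "exp y \<le> 1 + y + y\<^sup>2" using exp_bound[of y] assms by auto
  then show ?thesis using exp_ge_add_one_self[of y] zero_le_power2[of y]
    by (intro abs_leI) linarith+
next
  case False
  define x where "x = - y"
  have x: "0 \<le> x" "x \<le> 1" using False assms by (auto simp: x_def)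
  \<comment> \<open>The quadratic Taylor polynomial is a lower bound for \<open>exp x\<close>, so
    this product bound gives \<open>exp (- x) \<le> 1 - x + x\<^sup>2\<close>.\<close>
  have "1 \<le> (1 - x + x\<^sup>2) * (1 + x + x\<^sup>2 / 2)"
  proof -
    have "(1 - x + x\<^sup>2) * (1 + x + x\<^sup>2 / 2) = 1 + (x\<^sup>2 + x^3 + x^4) / 2"
      by (simp add: field_simps power2_eq_square power3_eq_cube power4_eq_xxxx)
    then show ?thesis using x by simp
  qed
  also have "\<dots> \<le> (1 - x + x\<^sup>2) * exp x"
    using exp_lower_Taylor_quadratic[OF x(1)] x by (intro mult_left_mono) auto
  finally have "exp (- x) \<le> 1 - x + x\<^sup>2"
    by (simp add: exp_minus field_simps)
  then show ?thesis using exp_ge_add_one_self[of y] zero_le_power2[of y] unfolding x_def power2_minus minus_minus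
    by (intro abs_leI) linarith+
qed

text \<open>Herbst's argument follows quotients such as \<open>ln (E l) / l\<close>, which have no
  value of their own at 0; the right limit takes its place.\<close>

lemma nonincreasing_from_zero:
  fixes f f' :: "real \<Rightarrow> real"
  assumes "(f \<longlongrightarrow> L) (at_right 0)" "0 < x"
    and "\<And>y. 0 < y \<Longrightarrow> y \<le> x \<Longrightarrow> DERIV f y :> f' y" "\<And>y. 0 < y \<Longrightarrow> y \<le> x \<Longrightarrow> f' y \<le> 0"
  shows "f x \<le> L"
proof (rule tendsto_lowerbound[OF assms(1)])
  have "f x \<le> f y" if "0 < y" "y < x" for y
    using that assms(3,4) by (intro DERIV_nonpos_imp_nonincreasing[of y x f]) fastforce+
  then show "\<forall>\<^sub>F y in at_right 0. f x \<le> f y"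
    using assms(2) by (auto simp: eventually_at_right[of 0 "1"] intro!: exI[of _ x])
qed simp

context prob_space
begin

text \<open>Passes bounds from truncations to the limit without a dominating function, and yields
  integrability of the limit as part of the conclusion. Fatou is applied to nonnegative integrals in
  \<open>ennreal\<close>, where no integrability of \<open>g\<close> has to be known
  beforehand.\<close>

lemma fatou_tendsto:
  fixes f :: "nat \<Rightarrow> 'a \<Rightarrow> real"
  assumes "\<And>m. integrable M (f m)" "\<And>m x. x \<in> space M \<Longrightarrow> 0 \<le> f m x"
    and "\<And>x. x \<in> space M \<Longrightarrow> (\<lambda>m. f m x) \<longlonglongrightarrow> g x" "\<And>m. (\<integral>x. f m x \<partial>M) \<le> k m" "k \<longlonglongrightarrow> K"
  shows "integrable M g" "(\<integral>x. g x \<partial>M) \<le> K"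
proof -
  have [measurable]: "\<And>m. f m \<in> borel_measurable M" using assms(1) by auto
  have [measurable]: "g \<in> borel_measurable M"
    by (rule borel_measurable_LIMSEQ_real[OF assms(3)]) auto
  have g0: "0 \<le> g x" if "x \<in> space M" for x
    using assms(2,3) that by (intro LIMSEQ_le_const[OF assms(3)[OF that]]) auto
  have k0: "0 \<le> k m" for m
    by (rule order_trans[OF Bochner_Integration.integral_nonneg assms(4)]) (rule assms(2))
  have K0: "0 \<le> K" using k0 by (intro LIMSEQ_le_const[OF assms(5)]) auto
  have "(\<integral>\<^sup>+x. ennreal (g x) \<partial>M) = (\<integral>\<^sup>+x. liminf (\<lambda>m. ennreal (f m x)) \<partial>M)"
    by (intro nn_integral_cong lim_imp_Liminf[symmetric] tendsto_ennrealI assms(3)) auto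
  also have "\<dots> \<le> liminf (\<lambda>m. \<integral>\<^sup>+x. ennreal (f m x) \<partial>M)"
    by (intro nn_integral_liminf) auto
  also have "\<dots> \<le> liminf (\<lambda>m. ennreal (k m))"
  proof (intro Liminf_mono always_eventually allI)
    fix m
    have "(\<integral>\<^sup>+x. ennreal (f m x) \<partial>M) = ennreal (\<integral>x. f m x \<partial>M)"
      using assms(1,2) by (intro nn_integral_eq_integral) auto
    then show "(\<integral>\<^sup>+x. ennreal (f m x) \<partial>M) \<le> ennreal (k m)" using assms(4) by (simp add: ennreal_leI)
  qed
  also have "\<dots> = ennreal K"
    by (intro lim_imp_Liminf tendsto_ennrealI assms(5)) auto
  finally have *: "(\<integral>\<^sup>+x. ennreal (g x) \<partial>M) \<le> ennreal K" .
  then show i: "integrable M g" using g0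
    by (intro integrableI_nonneg) (auto intro: le_less_trans)
  show "(\<integral>x. g x \<partial>M) \<le> K"
    using * K0 nn_integral_eq_integral[OF i] g0 by (simp add: ennreal_le_iff)
qed

section \<open>Moment generating functions of bounded random variables and Herbst's differential
  inequality\<close>

context
  fixes X :: "'a \<Rightarrow> real" and B :: real
  assumes X[measurable]: "X \<in> borel_measurable M" and XB: "\<And>x. x \<in> space M \<Longrightarrow> \<bar>X x\<bar> \<le> B"
begin

lemma bounded_exp_integrable: "integrable M (\<lambda>x. exp (l * X x))"
proof (rule integrable_bdd[where B="exp (\<bar>l\<bar> * B)"])
  fix x assume "x \<in> space M"
  then have "\<bar>l * X x\<bar> \<le> \<bar>l\<bar> * B" using XB by (auto simp: abs_mult intro!: mult_left_mono)
  then show "norm (exp (l * X x)) \<le> exp (\<bar>l\<bar> * B)" by simp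
qed measurable

lemma bounded_mult_exp_integrable: "integrable M (\<lambda>x. X x * exp (l * X x))"
proof (rule integrable_bdd[where B="B * exp (\<bar>l\<bar> * B)"])
  fix x assume x: "x \<in> space M"
  then have "\<bar>l * X x\<bar> \<le> \<bar>l\<bar> * B" using XB by (auto simp: abs_mult intro!: mult_left_mono)
  then show "norm (X x * exp (l * X x)) \<le> B * exp (\<bar>l\<bar> * B)"
    unfolding real_norm_def abs_mult abs_exp_cancel using XB[OF x]
    by (intro mult_mono) (auto intro: order_trans[OF abs_ge_self] simp: abs_mult)
qed measurable

lemma mgf_pos: "0 < (\<integral>x. exp (l * X x) \<partial>M)"
  by (rule expectation_greater[OF bounded_exp_integrable]) auto

text \<open>Boundedness of \<open>X\<close> makes the second-order remainder at most
  \<open>h\<^sup>2 * K\<close> at all sample points at once, as long as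
  \<open>\<bar>h\<bar> * B \<le> 1\<close>.\<close>

lemma mgf_deriv:
  "DERIV (\<lambda>l. \<integral>x. exp (l * X x) \<partial>M) l :> (\<integral>x. X x * exp (l * X x) \<partial>M)"
proof -
  let ?f = "\<lambda>l. \<integral>x. exp (l * X x) \<partial>M" and ?D = "\<integral>x. X x * exp (l * X x) \<partial>M"
  define K where "K = exp (\<bar>l\<bar> * B) * B\<^sup>2"
  have B0: "0 \<le> B" using XB not_empty by force
  have est: "\<bar>(?f (l + h) - ?f l) / h - ?D\<bar> \<le> \<bar>h\<bar> * K" if h: "h \<noteq> 0" "\<bar>h\<bar> * B \<le> 1" for h
  proof -
    have "\<bar>?f (l + h) - ?f l - h * ?D\<bar>
        = \<bar>\<integral>x. exp ((l + h) * X x) - exp (l * X x) - h * (X x * exp (l * X x)) \<partial>M\<bar>"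
      using bounded_exp_integrable bounded_mult_exp_integrable by simp
    also have "\<dots> \<le> (\<integral>x. \<bar>exp ((l + h) * X x) - exp (l * X x) - h * (X x * exp (l * X x))\<bar> \<partial>M)"
      by (rule integral_abs_bound)
    also have "\<dots> \<le> h\<^sup>2 * K"
    proof (rule integral_le_const)
      show "integrable M (\<lambda>x. \<bar>exp ((l + h) * X x) - exp (l * X x) - h * (X x * exp (l * X x))\<bar>)"
        using bounded_exp_integrable bounded_mult_exp_integrable by auto
      show "AE x in M. \<bar>exp ((l + h) * X x) - exp (l * X x) - h * (X x * exp (l * X x))\<bar> \<le> h\<^sup>2 * K"
      proof (rule AE_I2)
        fix x assume x: "x \<in> space M"
        have hX: "\<bar>h * X x\<bar> \<le> \<bar>h\<bar> * B" using XB[OF x] by (auto simp: abs_mult intro!: mult_left_mono)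
        have lX: "\<bar>l * X x\<bar> \<le> \<bar>l\<bar> * B" using XB[OF x] by (auto simp: abs_mult intro!: mult_left_mono)
        have "exp ((l + h) * X x) - exp (l * X x) - h * (X x * exp (l * X x))
            = exp (l * X x) * (exp (h * X x) - 1 - h * X x)"
          by (simp add: algebra_simps exp_add)
        also have "\<bar>\<dots>\<bar> \<le> exp (\<bar>l\<bar> * B) * (h * X x)\<^sup>2"
          unfolding abs_mult using lX hX h exp_quadratic_bound[of "h * X x"]
          by (intro mult_mono) (auto simp del: abs_mult)
        also have "\<dots> \<le> exp (\<bar>l\<bar> * B) * (h\<^sup>2 * B\<^sup>2)"
          using hX B0 power_mono[OF hX, of 2] by (intro mult_left_mono) (auto simp: power_mult_distrib)
        finally show "\<bar>exp ((l + h) * X x) - exp (l * X x) - h * (X x * exp (l * X x))\<bar> \<le> h\<^sup>2 * K"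
          by (simp add: K_def mult_ac)
      qed
    qed
    finally have "\<bar>?f (l + h) - ?f l - h * ?D\<bar> / \<bar>h\<bar> \<le> h\<^sup>2 * K / \<bar>h\<bar>"
      by (rule divide_right_mono) auto
    moreover have "h\<^sup>2 * K / \<bar>h\<bar> = \<bar>h\<bar> * K"
      using h by (simp add: power2_eq_square field_simps abs_if)
    moreover have "\<bar>?f (l + h) - ?f l - h * ?D\<bar> / \<bar>h\<bar> = \<bar>(?f (l + h) - ?f l) / h - ?D\<bar>"
      using h by (simp add: abs_divide[symmetric] diff_divide_distrib)
    ultimately show ?thesis by simp
  qed
  have "((\<lambda>h. (?f (l + h) - ?f l) / h - ?D) \<longlongrightarrow> 0) (at 0)"
  proof (rule Lim_null_comparison)
    show "\<forall>\<^sub>F h in at 0. norm ((?f (l + h) - ?f l) / h - ?D) \<le> \<bar>h\<bar> * K"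
      unfolding eventually_at
    \<comment> \<open>Adding 1 to \<open>B\<close> keeps the radius meaningful when
      \<open>B = 0\<close>.\<close>
    proof (intro exI[of _ "1 / (B + 1)"] conjI ballI impI)
      fix h :: real assume "h \<noteq> 0 \<and> dist h 0 < 1 / (B + 1)"
      then have h: "h \<noteq> 0" "\<bar>h\<bar> * (B + 1) < 1" using B0 by (auto simp: field_simps)
      then have "\<bar>h\<bar> * B \<le> 1" by (simp add: algebra_simps)
      then show "norm ((?f (l + h) - ?f l) / h - ?D) \<le> \<bar>h\<bar> * K" using est h by simp
    qed (use B0 in auto)
    show "((\<lambda>h. \<bar>h\<bar> * K) \<longlongrightarrow> 0) (at 0)" by (auto intro!: tendsto_eq_intros)
  qed
  then show ?thesis unfolding DERIV_def by (rule LIM_zero_cancel)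
qed

text \<open>The first integral on the right is the derivative of the moment generating function
  \<open>E\<close>, so the right-hand side equals \<open>l^2 * E l\<close> times the derivative of
  \<open>ln (E l) / l\<close>. This turns entropy bounds into differential inequalities.\<close>

lemma real_ent_exp:
  "real_ent M (\<lambda>x. exp (l * X x)) = l * (\<integral>x. X x * exp (l * X x) \<partial>M)
     - (\<integral>x. exp (l * X x) \<partial>M) * ln (\<integral>x. exp (l * X x) \<partial>M)"
proof -
  have "(\<integral>x. exp (l * X x) * ln (exp (l * X x)) \<partial>M) = (\<integral>x. l * (X x * exp (l * X x)) \<partial>M)"
    by (intro Bochner_Integration.integral_cong) auto
  then show ?thesis unfolding real_ent_def by simp
qed

lemma log_mgf_deriv:
  "DERIV (\<lambda>l. ln (\<integral>x. exp (l * X x) \<partial>M)) l :> (\<integral>x. X x * exp (l * X x) \<partial>M) / (\<integral>x. exp (l * X x) \<partial>M)"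
  using DERIV_chain2[OF DERIV_ln_divide[OF mgf_pos] mgf_deriv] by simp

text \<open>The limit is the derivative of \<open>ln E\<close> at 0, where \<open>ln E\<close>
  vanishes.\<close>

lemma log_mgf_at_0: "((\<lambda>l. ln (\<integral>x. exp (l * X x) \<partial>M) / l) \<longlongrightarrow> (\<integral>x. X x \<partial>M)) (at_right 0)"
proof -
  have "((\<lambda>l. ln (\<integral>x. exp (l * X x) \<partial>M) / l) \<longlongrightarrow> (\<integral>x. X x \<partial>M)) (at 0)"
    using log_mgf_deriv[of 0] unfolding DERIV_def by (simp add: prob_space)
  then show ?thesis by (rule filterlim_mono) (auto simp: at_within_le_at)
qed

text \<open>With \<open>K l = ln (E l) / l\<close> the hypothesis reads
  \<open>K' \<le> 2 c (l K)'\<close>; hence \<open>K l * (1 - 2 * c * l)\<close> is nonincreasing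
  and starts from the mean. The sign of \<open>c\<close> is left open, since the lemma is applied to
  a truncated squared norm and, with \<open>- c\<close>, to its negative.\<close>

lemma herbst_self_bounding:
  assumes ent: "\<And>l. 0 < l \<Longrightarrow> 2 * c * l < 1 \<Longrightarrow>
      real_ent M (\<lambda>x. exp (l * X x)) \<le> 2 * c * l\<^sup>2 * (\<integral>x. X x * exp (l * X x) \<partial>M)"
    and l: "0 < l" "2 * c * l < 1"
  shows "ln (\<integral>x. exp (l * X x) \<partial>M) * (1 - 2 * c * l) \<le> l * (\<integral>x. X x \<partial>M)"
proof -
  define E where "E l = (\<integral>x. exp (l * X x) \<partial>M)" for l
  define F where "F l = (\<integral>x. X x * exp (l * X x) \<partial>M)" for l
  have E: "E l > 0" for l using mgf_pos E_def by simp
  have ent': "l * F l - E l * ln (E l) \<le> 2 * c * l\<^sup>2 * F l" if "0 < l" "2 * c * l < 1" for l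
    using ent[OF that] unfolding real_ent_exp E_def F_def .
  have d: "DERIV (\<lambda>l. ln (E l)) l :> F l / E l" for l
    using log_mgf_deriv unfolding E_def F_def .
  have "ln (E l) / l * (1 - 2 * c * l) \<le> (\<integral>x. X x \<partial>M)"
  proof (rule nonincreasing_from_zero[where x=l and f="\<lambda>l. ln (E l) / l * (1 - 2 * c * l)"])
    show "((\<lambda>l. ln (E l) / l * (1 - 2 * c * l)) \<longlongrightarrow> (\<integral>x. X x \<partial>M)) (at_right 0)"
    proof -
      have "((\<lambda>l. 1 - 2 * c * l) \<longlongrightarrow> 1) (at_right 0)"
        by (auto intro!: tendsto_eq_intros)
      from tendsto_mult[OF log_mgf_at_0[folded E_def] this] show ?thesis by simp
    qed
    fix y assume y: "0 < y" "y \<le> l"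
    have c: "2 * c * y < 1"
    proof (cases "0 \<le> c")
      case True then show ?thesis using y l(2) mult_left_mono[of y l "2 * c"] by simp
    next
      case False then show ?thesis using y mult_neg_pos[of c y] by simp
    qed
    show "DERIV (\<lambda>l. ln (E l) / l * (1 - 2 * c * l)) y :>
        (F y / E y * y - ln (E y)) / y\<^sup>2 * (1 - 2 * c * y) - ln (E y) / y * (2 * c)"
    proof -
      have "DERIV (\<lambda>l. ln (E l) / l) y :> (F y / E y * y - ln (E y)) / y\<^sup>2"
        using DERIV_divide[OF d[of y] DERIV_ident] y(1) by (simp add: power2_eq_square)
      moreover have "DERIV (\<lambda>l. 1 - 2 * c * l) y :> - (2 * c)"
        by (auto intro!: derivative_eq_intros)
      ultimately show ?thesis using DERIV_mult by (fastforce simp: mult_ac)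
    qed
    have "(y * F y - E y * ln (E y)) / E y \<le> 2 * c * y\<^sup>2 * F y / E y"
      using ent'[OF y(1) c] E[of y] by (intro divide_right_mono) auto
    then have "y * (F y / E y) - ln (E y) - 2 * c * y\<^sup>2 * (F y / E y) \<le> 0"
      using E[of y] by (simp add: diff_divide_distrib)
    then have "(y * (F y / E y) - ln (E y) - 2 * c * y\<^sup>2 * (F y / E y)) / y\<^sup>2 \<le> 0"
      by (intro divide_nonpos_nonneg) auto
    moreover have "(F y / E y * y - ln (E y)) / y\<^sup>2 * (1 - 2 * c * y) - ln (E y) / y * (2 * c)
      = (y * (F y / E y) - ln (E y) - 2 * c * y\<^sup>2 * (F y / E y)) / y\<^sup>2"
      using y(1) by (simp add: divide_simps) (simp add: algebra_simps power2_eq_square)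
    ultimately show "(F y / E y * y - ln (E y)) / y\<^sup>2 * (1 - 2 * c * y) - ln (E y) / y * (2 * c) \<le> 0"
      by simp
  qed (use l in auto)
  then show ?thesis using l(1) unfolding E_def by (simp add: field_simps)
qed

text \<open>After division by \<open>l^2 * E l\<close> the entropy bound is the derivative of
  \<open>v * l / (1 - 2 * u * l)\<close>. Subtracting that function from \<open>ln (E l) / l\<close>
  therefore gives a nonincreasing function whose right limit at 0 is the mean.\<close>

lemma herbst_sub_gamma:
  assumes ent: "\<And>l. 0 < l \<Longrightarrow> 2 * u * l < 1 \<Longrightarrow>
      real_ent M (\<lambda>x. exp (l * X x)) \<le> v * l\<^sup>2 / (1 - 2 * u * l)\<^sup>2 * (\<integral>x. exp (l * X x) \<partial>M)"
    and l: "0 < l" "2 * u * l < 1" and u: "0 \<le> u"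
  shows "ln (\<integral>x. exp (l * X x) \<partial>M) \<le> l * (\<integral>x. X x \<partial>M) + v * l\<^sup>2 / (1 - 2 * u * l)"
proof -
  define E where "E l = (\<integral>x. exp (l * X x) \<partial>M)" for l
  define F where "F l = (\<integral>x. X x * exp (l * X x) \<partial>M)" for l
  have E: "E l > 0" for l using mgf_pos E_def by simp
  have ent': "l * F l - E l * ln (E l) \<le> v * l\<^sup>2 / (1 - 2 * u * l)\<^sup>2 * E l" if "0 < l" "2 * u * l < 1" for l
    using ent[OF that] unfolding real_ent_exp E_def F_def .
  have d: "DERIV (\<lambda>l. ln (E l)) l :> F l / E l" for l
    using log_mgf_deriv unfolding E_def F_def .
  have "ln (E l) / l - v * l / (1 - 2 * u * l) \<le> (\<integral>x. X x \<partial>M)"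
  proof (rule nonincreasing_from_zero[where x=l and f="\<lambda>l. ln (E l) / l - v * l / (1 - 2 * u * l)"])
    show "((\<lambda>l. ln (E l) / l - v * l / (1 - 2 * u * l)) \<longlongrightarrow> (\<integral>x. X x \<partial>M)) (at_right 0)"
    proof -
      have "((\<lambda>l. v * l / (1 - 2 * u * l)) \<longlongrightarrow> 0) (at_right 0)"
        by (auto intro!: tendsto_eq_intros)
      from tendsto_diff[OF log_mgf_at_0[folded E_def] this] show ?thesis by simp
    qed
    fix y assume y: "0 < y" "y \<le> l"
    have c: "2 * u * y < 1" using y l(2) mult_left_mono[of y l "2 * u"] u by simp
    show "DERIV (\<lambda>l. ln (E l) / l - v * l / (1 - 2 * u * l)) y :>
        (F y / E y * y - ln (E y)) / y\<^sup>2 - v / (1 - 2 * u * y)\<^sup>2"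
    proof -
      have "DERIV (\<lambda>l. v * l / (1 - 2 * u * l)) y :> v / (1 - 2 * u * y)\<^sup>2"
        using c by (auto intro!: derivative_eq_intros simp: power2_eq_square divide_simps)
          (auto simp: algebra_simps)
      moreover have "DERIV (\<lambda>l. ln (E l) / l) y :> (F y / E y * y - ln (E y)) / y\<^sup>2"
        using DERIV_divide[OF d[of y] DERIV_ident] y(1) by (simp add: power2_eq_square)
      ultimately show ?thesis by (rule DERIV_diff[rotated])
    qed
    have "(y * F y - E y * ln (E y)) / E y \<le> v * y\<^sup>2 / (1 - 2 * u * y)\<^sup>2 * E y / E y"
      using ent'[OF y(1) c] E[of y] by (intro divide_right_mono) auto
    then have "F y / E y * y - ln (E y) \<le> v * y\<^sup>2 / (1 - 2 * u * y)\<^sup>2"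
      using E[of y] by (simp add: diff_divide_distrib mult.commute)
    then have "(F y / E y * y - ln (E y)) / y\<^sup>2 \<le> v * y\<^sup>2 / (1 - 2 * u * y)\<^sup>2 / y\<^sup>2"
      by (intro divide_right_mono) auto
    then show "(F y / E y * y - ln (E y)) / y\<^sup>2 - v / (1 - 2 * u * y)\<^sup>2 \<le> 0"
      using y by simp
  qed (use l in auto)
  then have "l * (ln (E l) / l - v * l / (1 - 2 * u * l)) \<le> l * (\<integral>x. X x \<partial>M)"
    using l(1) by (intro mult_left_mono) auto
  then show ?thesis using l(1) unfolding E_def by (simp add: right_diff_distrib power2_eq_square mult_ac)
qed

end
end

section \<open>Measures satisfying a log-Sobolev inequality\<close>

lemma gderiv_continuous_on:
  "(\<And>z. GDERIV f z :> G z) \<Longrightarrow> continuous_on UNIV f"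
  unfolding gderiv_def by (intro continuous_at_imp_continuous_on ballI has_derivative_continuous)

text \<open>A bounded C1 version of the squared norm that increases to it as \<open>r\<close> tends
  to 0 and keeps the self-bounding property: its squared gradient is at most four times the
  function.\<close>

definition clip_sq :: "real \<Rightarrow> 'z::real_inner \<Rightarrow> real" where
  "clip_sq r z = (z \<bullet> z) / (1 + r * (z \<bullet> z))"

lemma clip_sq_bounds:
  assumes "0 < r"
  shows "0 \<le> clip_sq r z" "clip_sq r z \<le> 1 / r" "clip_sq r z \<le> (norm z)\<^sup>2"
proof -
  define x where "x = z \<bullet> z"
  have x: "0 \<le> x" "0 < 1 + r * x" using assms by (auto simp: x_def add_pos_nonneg)
  show "0 \<le> clip_sq r z" "clip_sq r z \<le> 1 / r"
    unfolding clip_sq_def x_def[symmetric] using x assms by (auto simp: field_simps)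
  have "x / (1 + r * x) \<le> x / 1" using x assms by (intro divide_left_mono) auto
  then show "clip_sq r z \<le> (norm z)\<^sup>2" by (simp add: clip_sq_def x_def power2_norm_eq_inner)
qed

lemma abs_clip_sq_le: "0 < r \<Longrightarrow> \<bar>clip_sq r z\<bar> \<le> 1 / r"
  using clip_sq_bounds[of r z] by simp

lemma clip_sq_gderiv:
  assumes "0 < r"
  shows "GDERIV (clip_sq r) z :> (2 / (1 + r * (z \<bullet> z))\<^sup>2) *\<^sub>R z"
proof -
  have p: "0 < 1 + r * (z \<bullet> z)" using assms by (auto simp: add_pos_nonneg)
  have 1: "GDERIV (\<lambda>z. z \<bullet> z) z :> 2 *\<^sub>R z"
    unfolding gderiv_def by (auto intro!: derivative_eq_intros simp: inner_commute)
  have "DERIV (\<lambda>x. x / (1 + r * x)) (z \<bullet> z) :> 1 / (1 + r * (z \<bullet> z))\<^sup>2"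
    using p by (auto intro!: derivative_eq_intros simp: power2_eq_square divide_simps)
  from GDERIV_DERIV_compose[OF 1 this] show ?thesis unfolding clip_sq_def[abs_def] by (simp add: mult.commute)
qed

text \<open>Classical functions with their own gradients suffice below, so the Sobolev closure stays
  outside the locale. The integrability premise is there because \<open>real_ent\<close>, unlike
  \<open>ent\<close>, does not become infinite when \<open>f ln f\<close> fails to be
  integrable.\<close>

locale log_sobolev_space = prob_space \<mu> for \<mu> :: "'z::euclidean_space measure" +
  fixes c :: real
  assumes sets_mu: "sets \<mu> = sets borel" and c_nonneg: "0 \<le> c"
    and lsi: "\<And>\<phi> \<Phi>. (\<phi>, \<Phi>) \<in> C1_L2 \<mu> \<Longrightarrow> integrable \<mu> (\<lambda>z. (\<phi> z)\<^sup>2 * ln ((\<phi> z)\<^sup>2)) \<Longrightarrow>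
      real_ent \<mu> (\<lambda>z. (\<phi> z)\<^sup>2) \<le> 2 * c * (\<integral>z. (norm (\<Phi> z))\<^sup>2 \<partial>\<mu>)"
begin

lemma borel_mu[measurable_cong]: "sets \<mu> = sets borel" by (rule sets_mu)

lemma space_mu[simp]: "space \<mu> = UNIV" using sets_eq_imp_space_eq[OF sets_mu] by simp

lemma continuous_measurable: "continuous_on UNIV f \<Longrightarrow> f \<in> borel_measurable \<mu>"
  for f :: "'z \<Rightarrow> 'b::topological_space"
  by (simp add: measurable_cong_sets[OF sets_mu refl] borel_measurable_continuous_onI)

text \<open>The inequality for \<open>\<phi> = exp (w / 2)\<close>: its square is
  \<open>exp w\<close>, and its squared gradient carries a factor 1/4, which turns
  \<open>2 * c\<close> into \<open>c / 2\<close>.\<close>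

lemma lsi_exp:
  assumes w: "\<And>z. GDERIV w z :> W z" and W: "continuous_on UNIV W"
    and b: "\<And>z. \<bar>w z\<bar> \<le> B" "\<And>z. norm (W z) \<le> B'"
  shows "real_ent \<mu> (\<lambda>z. exp (w z)) \<le> c / 2 * (\<integral>z. (norm (W z))\<^sup>2 * exp (w z) \<partial>\<mu>)"
proof -
  define \<phi> where "\<phi> z = exp (w z / 2)" for z
  define \<Phi> where "\<Phi> z = (exp (w z / 2) / 2) *\<^sub>R W z" for z
  have cw: "continuous_on UNIV w"
    using w by (rule gderiv_continuous_on)
  have [measurable]: "w \<in> borel_measurable \<mu>" "W \<in> borel_measurable \<mu>"
    using cw W by (auto intro: continuous_measurable)
  have sq: "(\<phi> z)\<^sup>2 = exp (w z)" for z unfolding \<phi>_def by (simp add: exp_double[symmetric])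
  have sq': "(norm (\<Phi> z))\<^sup>2 = (norm (W z))\<^sup>2 * exp (w z) / 4" for z
    unfolding \<Phi>_def by (simp add: power_mult_distrib power_divide exp_double[symmetric])
  have i1: "integrable \<mu> (\<lambda>z. exp (w z))"
    using b(1) by (intro integrable_bdd[where B="exp B"]) (auto simp: abs_le_iff)
  have i2: "integrable \<mu> (\<lambda>z. (norm (W z))\<^sup>2 * exp (w z))"
    using b by (intro integrable_bdd[where B="B'\<^sup>2 * exp B"]) (auto simp: abs_le_iff intro!: mult_mono power_mono)
  have i3: "integrable \<mu> (\<lambda>z. exp (w z) * ln (exp (w z)))"
    using b(1) by (intro integrable_xlnx[where c="exp (-B)" and C="exp B"]) (auto simp: abs_le_iff minus_le_iff)
  have "(\<phi>, \<Phi>) \<in> C1_L2 \<mu>"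
    unfolding C1_L2_def
  proof (clarsimp, intro conjI allI)
    fix z
    have "DERIV (\<lambda>t. exp (t / 2)) (w z) :> exp (w z / 2) / 2"
      by (auto intro!: derivative_eq_intros)
    from GDERIV_DERIV_compose[OF w this]
    show "GDERIV \<phi> z :> \<Phi> z" unfolding \<phi>_def \<Phi>_def .
    show "continuous_on UNIV \<Phi>" unfolding \<Phi>_def by (intro continuous_intros cw W) auto
    show "integrable \<mu> (\<lambda>z. (\<phi> z)\<^sup>2)" "integrable \<mu> (\<lambda>z. (norm (\<Phi> z))\<^sup>2)"
      unfolding sq sq' using i1 i2 by auto
  qed
  from lsi[OF this] show ?thesis unfolding sq sq' using i3 by simp
qed

text \<open>The squared gradient of \<open>l * clip_sq r\<close> is at most
  \<open>4 * l\<^sup>2 * clip_sq r\<close>, so the bound of \<open>lsi_exp\<close> is expressed by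
  the function itself, as \<open>herbst_self_bounding\<close> requires. Both signs of
  \<open>l\<close> are used later.\<close>

lemma clip_sq_entropy:
  assumes r: "0 < r"
  shows "real_ent \<mu> (\<lambda>z. exp (l * clip_sq r z)) \<le> 2 * c * l\<^sup>2 * (\<integral>z. clip_sq r z * exp (l * clip_sq r z) \<partial>\<mu>)"
proof -
  define W where "W z = (l * (2 / (1 + r * (z \<bullet> z))\<^sup>2)) *\<^sub>R z" for z :: 'z
  have p: "0 < 1 + r * (z \<bullet> z)" for z :: 'z using r by (auto simp: add_pos_nonneg)
  have W2: "(norm (W z))\<^sup>2 \<le> l\<^sup>2 * (4 * clip_sq r z)" for z
  proof -
    have ge1: "1 \<le> 1 + r * (z \<bullet> z)" using r by simp
    have "(norm (W z))\<^sup>2 = l\<^sup>2 * (4 * ((z \<bullet> z) / (1 + r * (z \<bullet> z))^4))"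
      unfolding W_def power2_norm_eq_inner by (simp add: power2_eq_square power4_eq_xxxx mult_ac)
    also have "\<dots> \<le> l\<^sup>2 * (4 * ((z \<bullet> z) / (1 + r * (z \<bullet> z))^1))"
      using power_increasing[OF _ ge1, of 1 4] p[of z] by (intro mult_left_mono divide_left_mono) auto
    finally show ?thesis by (simp add: clip_sq_def)
  qed
  have g: "GDERIV (\<lambda>z. l * clip_sq r z) z :> W z" for z
    using GDERIV_mult[OF GDERIV_const clip_sq_gderiv[OF r], of l z] by (simp add: W_def)
  have cw: "continuous_on UNIV (clip_sq r)"
    using clip_sq_gderiv[OF r] by (rule gderiv_continuous_on)
  have cW: "continuous_on UNIV W" unfolding W_def using p by (intro continuous_intros) (auto simp: less_imp_neq[THEN not_sym])
  have [measurable]: "clip_sq r \<in> borel_measurable \<mu>" "W \<in> borel_measurable \<mu>"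
    using cw cW by (auto intro: continuous_measurable)
  have b: "\<bar>clip_sq r z\<bar> \<le> 1 / r" for z using clip_sq_bounds[OF r, of z] by auto
  have bl: "\<bar>l * clip_sq r z\<bar> \<le> \<bar>l\<bar> * (1 / r)" for z
    unfolding abs_mult using b by (intro mult_left_mono) auto
  have bW: "norm (W z) \<le> sqrt (l\<^sup>2 * (4 * (1 / r)))" for z
    using clip_sq_bounds(2)[OF r, of z] by (intro real_le_rsqrt order_trans[OF W2] mult_left_mono) auto
  have "real_ent \<mu> (\<lambda>z. exp (l * clip_sq r z)) \<le> c / 2 * (\<integral>z. (norm (W z))\<^sup>2 * exp (l * clip_sq r z) \<partial>\<mu>)"
    by (rule lsi_exp[OF g cW bl bW])
  also have "\<dots> \<le> c / 2 * (\<integral>z. l\<^sup>2 * 4 * (clip_sq r z * exp (l * clip_sq r z)) \<partial>\<mu>)"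
  proof (intro mult_left_mono integral_mono)
    have e: "integrable \<mu> (\<lambda>z. clip_sq r z * exp (l * clip_sq r z))"
      by (rule bounded_mult_exp_integrable[where B="1/r"]) (use b in auto)
    then show "integrable \<mu> (\<lambda>z. l\<^sup>2 * 4 * (clip_sq r z * exp (l * clip_sq r z)))" by auto
    show *: "(norm (W z))\<^sup>2 * exp (l * clip_sq r z) \<le> l\<^sup>2 * 4 * (clip_sq r z * exp (l * clip_sq r z))" for z
      using W2[of z] by (auto simp: mult_ac)
    have abs: "\<bar>clip_sq r z\<bar> = clip_sq r z" for z :: 'z
      by (rule abs_of_nonneg[OF clip_sq_bounds(1)[OF r]])
    show "integrable \<mu> (\<lambda>z. (norm (W z))\<^sup>2 * exp (l * clip_sq r z))"
      by (rule Bochner_Integration.integrable_bound[OF integrable_mult_right[OF e, of "l\<^sup>2 * 4"]])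
        (use W2 abs in \<open>auto simp: abs_mult intro!: AE_I2\<close>)
  qed (use c_nonneg in auto)
  finally show ?thesis by simp
qed

section \<open>Second moment and exponential moments of the squared norm\<close>

lemma clip_sq_tendsto: "(\<lambda>m. clip_sq (1 / Suc m) z) \<longlonglongrightarrow> (norm z)\<^sup>2"
proof -
  have "(\<lambda>m. (z \<bullet> z) / (1 + 1 / real (Suc m) * (z \<bullet> z))) \<longlonglongrightarrow> (z \<bullet> z) / (1 + 0 * (z \<bullet> z))"
    using LIMSEQ_inverse_real_of_nat by (intro tendsto_intros) (auto simp: inverse_eq_divide)
  then show ?thesis by (simp add: clip_sq_def power2_norm_eq_inner)
qed

lemma clip_sq_measurable:
  assumes "0 < r" shows "clip_sq r \<in> borel_measurable \<mu>"
proof (rule continuous_measurable)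
  show "continuous_on UNIV (clip_sq r :: 'z \<Rightarrow> real)"
    using clip_sq_gderiv[OF assms] by (rule gderiv_continuous_on)
qed

lemma clip_sq_integrable:
  assumes r: "0 < r" shows "integrable \<mu> (clip_sq r)"
  using abs_clip_sq_le[OF r] by (intro integrable_bdd[OF clip_sq_measurable[OF r], of "1/r"]) simp

text \<open>Positive exponential moments of the truncated square are controlled only through its
  mean, which is what has to be bounded. The negative exponential runs the other way: Herbst's
  argument with \<open>- c\<close> bounds the mean by a multiple of minus the logarithm of the
  integral of \<open>exp (- clip_sq r)\<close>, and that integral is at least \<open>q > 0\<close>
  whatever \<open>r\<close> is.\<close>

lemma second_moment_finite: "integrable \<mu> (\<lambda>z. (norm z)\<^sup>2)"
proof -
  define q where "q = (\<integral>z. exp (- (norm z)\<^sup>2) \<partial>\<mu>)"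
  have iq: "integrable \<mu> (\<lambda>z. exp (- (norm z)\<^sup>2))"
    by (rule integrable_bdd[where B=1]) auto
  have q: "0 < q" unfolding q_def by (rule expectation_greater[OF iq]) auto
  have bound: "(\<integral>z. clip_sq (1 / Suc m) z \<partial>\<mu>) \<le> - ln q * (1 + 2 * c)" for m
  proof -
    define r :: real where "r = 1 / Suc m"
    have r: "0 < r" by (simp add: r_def)
    have b: "\<bar>- clip_sq r z\<bar> \<le> 1 / r" for z using clip_sq_bounds[OF r, of z] by auto
    have [measurable]: "clip_sq r \<in> borel_measurable \<mu>" using r by (rule clip_sq_measurable)
    have "ln (\<integral>z. exp (1 * - clip_sq r z) \<partial>\<mu>) * (1 - 2 * (- c) * 1) \<le> 1 * (\<integral>z. - clip_sq r z \<partial>\<mu>)"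
    proof (rule herbst_self_bounding[where B="1/r"])
      fix l :: real
      \<comment> \<open>Two sign changes cancel: the bound for \<open>clip_sq r\<close> at
        \<open>- l\<close> is the self-bounding hypothesis for its negative with constant
        \<open>- c\<close>.\<close>
      show "real_ent \<mu> (\<lambda>x. exp (l * - clip_sq r x)) \<le> 2 * - c * l\<^sup>2 * (\<integral>z. - clip_sq r z * exp (l * - clip_sq r z) \<partial>\<mu>)"
        using clip_sq_entropy[OF r, of "-l"] by simp
    qed (use b c_nonneg in auto)
    then have 1: "(\<integral>z. clip_sq r z \<partial>\<mu>) \<le> - ln (\<integral>z. exp (- clip_sq r z) \<partial>\<mu>) * (1 + 2 * c)" by simp
    have "q \<le> (\<integral>z. exp (- clip_sq r z) \<partial>\<mu>)"
      unfolding q_def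
    proof (rule integral_mono[OF iq])
      show "integrable \<mu> (\<lambda>z. exp (- clip_sq r z))"
        using clip_sq_bounds(1)[OF r] by (intro integrable_bdd[where B=1]) auto
    qed (use clip_sq_bounds(3)[OF r] in auto)
    then have "ln q \<le> ln (\<integral>z. exp (- clip_sq r z) \<partial>\<mu>)" using q by simp
    then have "- ln (\<integral>z. exp (- clip_sq r z) \<partial>\<mu>) * (1 + 2 * c) \<le> - ln q * (1 + 2 * c)"
      using c_nonneg by (intro mult_right_mono) auto
    then show ?thesis using 1 by (simp add: r_def)
  qed
  have i: "integrable \<mu> (clip_sq (1 / Suc m))" for m by (rule clip_sq_integrable) simp
  have nn: "0 \<le> clip_sq (1 / Suc m) z" for m and z :: 'z by (rule clip_sq_bounds(1)) simp
  show ?thesis by (rule fatou_tendsto(1)[OF i nn clip_sq_tendsto bound tendsto_const])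
qed

text \<open>Herbst's argument bounds the exponential moment of \<open>clip_sq\<close> through its
  mean, hence through the second moment, uniformly in the truncation; Fatou gives the limit. The
  pole at \<open>2 * c * l = 1\<close> is that of a Gaussian with variance \<open>c\<close>.\<close>

lemma exp_square_moment:
  assumes l: "0 < l" "2 * c * l < 1"
  shows "integrable \<mu> (\<lambda>z. exp (l * (norm z)\<^sup>2))"
    "(\<integral>z. exp (l * (norm z)\<^sup>2) \<partial>\<mu>) \<le> exp (l * second_moment \<mu> / (1 - 2 * c * l))"
proof -
  have *: "(\<integral>z. exp (l * clip_sq (1 / Suc m) z) \<partial>\<mu>) \<le> exp (l * second_moment \<mu> / (1 - 2 * c * l))"
    (is "?E \<le> _") for m
  proof -
    define r :: real where "r = 1 / Suc m"
    have r: "0 < r" by (simp add: r_def)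
    have b: "\<bar>clip_sq r z\<bar> \<le> 1 / r" for z using clip_sq_bounds[OF r, of z] by auto
    have [measurable]: "clip_sq r \<in> borel_measurable \<mu>" using r by (rule clip_sq_measurable)
    have "ln (\<integral>z. exp (l * clip_sq r z) \<partial>\<mu>) * (1 - 2 * c * l) \<le> l * (\<integral>z. clip_sq r z \<partial>\<mu>)"
      using b l clip_sq_entropy[OF r] by (intro herbst_self_bounding[where B="1/r"]) auto
    also have "\<dots> \<le> l * second_moment \<mu>"
      unfolding second_moment_def using l clip_sq_bounds(3)[OF r]
      by (intro mult_left_mono integral_mono clip_sq_integrable second_moment_finite r) auto
    finally have "ln (\<integral>z. exp (l * clip_sq r z) \<partial>\<mu>) \<le> l * second_moment \<mu> / (1 - 2 * c * l)"
      using l by (simp add: pos_le_divide_eq)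
    then have "exp (ln (\<integral>z. exp (l * clip_sq r z) \<partial>\<mu>)) \<le> exp (l * second_moment \<mu> / (1 - 2 * c * l))"
      by simp
    also have "exp (ln (\<integral>z. exp (l * clip_sq r z) \<partial>\<mu>)) = (\<integral>z. exp (l * clip_sq r z) \<partial>\<mu>)"
      using b by (intro exp_ln mgf_pos[where B="1/r"]) auto
    finally show ?thesis unfolding r_def .
  qed
  have i: "integrable \<mu> (\<lambda>z. exp (l * clip_sq (1 / Suc m) z))" for m
    using abs_clip_sq_le[of "1 / Suc m"]
    by (intro bounded_exp_integrable[where B="Suc m"] clip_sq_measurable) auto
  have t: "(\<lambda>m. exp (l * clip_sq (1 / Suc m) z)) \<longlonglongrightarrow> exp (l * (norm z)\<^sup>2)" for z :: 'z
    by (intro tendsto_intros clip_sq_tendsto)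
  show "integrable \<mu> (\<lambda>z. exp (l * (norm z)\<^sup>2))"
    "(\<integral>z. exp (l * (norm z)\<^sup>2) \<partial>\<mu>) \<le> exp (l * second_moment \<mu> / (1 - 2 * c * l))"
    by (rule fatou_tendsto[OF i exp_ge_zero t * tendsto_const])+
qed

end

section \<open>Functions of the data\<close>

lemma data_norm_nonneg[simp]: "0 \<le> data_norm n D"
  by (simp add: data_norm_def)

lemma data_norm_triangle: "data_norm n (\<lambda>i. D i + D' i) \<le> data_norm n D + data_norm n D'"
proof -
  have "data_norm n (\<lambda>i. D i + D' i) \<le> L2_set (\<lambda>i. norm (D i) + norm (D' i)) {..<n}"
    unfolding data_norm_def by (intro L2_set_mono norm_triangle_ineq) auto
  also have "\<dots> \<le> data_norm n D + data_norm n D'"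
    unfolding data_norm_def by (rule L2_set_triangle_ineq)
  finally show ?thesis .
qed

lemma data_norm_scaleR: "data_norm n (\<lambda>i. s *\<^sub>R D i) = \<bar>s\<bar> * data_norm n D"
  by (simp add: data_norm_def L2_set_right_distrib)

lemma data_norm_cong: "(\<And>i. i < n \<Longrightarrow> D i = D' i) \<Longrightarrow> data_norm n D = data_norm n D'"
  by (simp add: data_norm_def cong: L2_set_cong_simp)

lemma data_norm_eq_0: "(\<And>i. i < n \<Longrightarrow> D i = 0) \<Longrightarrow> data_norm n D = 0"
  using data_norm_cong[of n D "\<lambda>_. 0"] by (simp add: data_norm_def L2_set_def)

lemma data_norm_sq: "(data_norm n D)\<^sup>2 = (\<Sum>i<n. (norm (D i))\<^sup>2)"
  by (simp add: data_norm_def L2_set_def sum_nonneg)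

lemma data_norm_le_const:
  assumes "\<And>i. i < n \<Longrightarrow> norm (D i) \<le> e" "0 \<le> e"
  shows "data_norm n D \<le> e * sqrt n"
proof -
  have "data_norm n D \<le> L2_set (\<lambda>_. e) {..<n}"
    unfolding data_norm_def using assms by (intro L2_set_mono) auto
  also have "\<dots> = e * sqrt n" using assms(2) by (simp add: L2_set_def real_sqrt_mult)
  finally show ?thesis .
qed

lemma continuous_data_norm: "continuous_on UNIV (data_norm n)"
  unfolding data_norm_def[abs_def] L2_set_def by (intro continuous_intros) auto

lemma tendsto_product_coordinatewise:
  fixes x :: "'c \<Rightarrow> 'i \<Rightarrow> 'a::topological_space"
  assumes "\<And>i. ((\<lambda>m. x m i) \<longlongrightarrow> y i) F"
  shows "(x \<longlongrightarrow> y) F"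
proof -
  have "limitin (product_topology (\<lambda>_. euclidean) UNIV) x y F"
    unfolding limitin_componentwise using assms by simp
  then show ?thesis by (simp add: euclidean_product_topology)
qed

definition data_lip :: "nat \<Rightarrow> real \<Rightarrow> real \<Rightarrow> ((nat \<Rightarrow> 'z::real_normed_vector) \<Rightarrow> real) \<Rightarrow> bool" where
  "data_lip n a b F \<longleftrightarrow> (\<forall>D D'. \<bar>F D - F D'\<bar> \<le>
     (a + b * max (data_norm n D) (data_norm n D')) * data_norm n (\<lambda>i. D i - D' i))"

lemma data_lipD:
  "data_lip n a b F \<Longrightarrow> \<bar>F D - F D'\<bar> \<le>
     (a + b * max (data_norm n D) (data_norm n D')) * data_norm n (\<lambda>i. D i - D' i)"
  by (simp add: data_lip_def)

lemma data_lip_continuous: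
  fixes F :: "(nat \<Rightarrow> 'z::real_normed_vector) \<Rightarrow> real"
  assumes F: "data_lip n a b F"
  shows "continuous_on UNIV F"
  unfolding continuous_on_def
proof
  fix D :: "nat \<Rightarrow> 'z"
  let ?g = "\<lambda>D'. (a + b * max (data_norm n D') (data_norm n D)) * data_norm n (\<lambda>i. D' i - D i)"
  have "continuous_on UNIV (\<lambda>D'. data_norm n (\<lambda>i. D' i - D i))"
    by (rule continuous_on_compose2[OF continuous_data_norm]) (auto intro!: continuous_intros)
  then have "continuous_on UNIV ?g"
    by (intro continuous_intros continuous_data_norm)
  then have "(?g \<longlongrightarrow> ?g D) (at D within UNIV)" unfolding continuous_on_def by blast
  then have "(?g \<longlongrightarrow> 0) (at D within UNIV)" by (simp add: data_norm_eq_0)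
  then have "((\<lambda>D'. F D' - F D) \<longlongrightarrow> 0) (at D within UNIV)"
    by (rule Lim_null_comparison[rotated]) (use data_lipD[OF F] in auto)
  then show "(F \<longlongrightarrow> F D) (at D within UNIV)" by (rule LIM_zero_cancel)
qed

lemma data_lip_clip:
  assumes "data_lip n a b F"
  shows "data_lip n a b (\<lambda>D. max (- R) (min R (F D)))"
proof -
  have "\<bar>max (- R) (min R x) - max (- R) (min R y)\<bar> \<le> \<bar>x - y\<bar>" for x y :: real by auto
  then show ?thesis using assms unfolding data_lip_def by (meson order_trans)
qed

lemma data_lip_linear_growth:
  assumes "data_lip n a b F"
  shows "\<bar>F D\<bar> \<le> \<bar>F (\<lambda>_. 0)\<bar> + a * data_norm n D + b * (data_norm n D)\<^sup>2"
  using data_lipD[OF assms, of D "\<lambda>_. 0"]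
  by (simp add: data_norm_eq_0 algebra_simps power2_eq_square)

text \<open>A smooth function only inherits the bound on its increments from \<open>F\<close>; differentiating along
  the gradient itself turns this into a bound on the gradient. The increment is telescoped over the
  coordinates, since only the partial gradients are known to exist.\<close>

lemma data_lip_gradient_bound:
  fixes F :: "(nat \<Rightarrow> 'z::euclidean_space) \<Rightarrow> real"
  assumes F: "data_lip n a b F" and ab: "0 \<le> a" "0 \<le> b"
    and G: "\<And>i D z. i < n \<Longrightarrow> GDERIV (\<lambda>z. F (D(i:=z))) z :> G i (D(i:=z))"
    and cG: "\<And>i. i < n \<Longrightarrow> continuous_on UNIV (G i)"
  shows "(\<Sum>i<n. (norm (G i D))\<^sup>2) \<le> (a + b * data_norm n D)\<^sup>2"
proof -
  define h where "h i = G i D" for i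
  define c where "c = data_norm n h"
  define s where "s m = 1 / real (Suc m)" for m
  have s: "0 < s m" "s \<longlonglongrightarrow> 0" for m
    using LIMSEQ_inverse_real_of_nat by (auto simp: s_def[abs_def] inverse_eq_divide)
  \<comment> \<open>A staircase from \<open>D\<close> to \<open>D + s m * h\<close>, moved one
    coordinate at a time, so that each step involves a single partial gradient.\<close>
  define P where "P m j = (\<lambda>i. if i < j then D i + s m *\<^sub>R h i else D i)" for m and j :: nat
  have ex: "\<exists>t. 0 < t \<and> t < s m \<and> F (P m (Suc j)) - F (P m j) = s m * (G j ((P m j)(j := D j + t *\<^sub>R h j)) \<bullet> h j)"
    if j: "j < n" for m j
  proof -
    let ?f = "\<lambda>t. F ((P m j)(j := D j + t *\<^sub>R h j))"
    have d: "DERIV ?f t :> G j ((P m j)(j := D j + t *\<^sub>R h j)) \<bullet> h j" for t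
    proof -
      have "((\<lambda>t. D j + t *\<^sub>R h j) has_derivative (\<lambda>t. t *\<^sub>R h j)) (at t)"
        by (auto intro!: derivative_eq_intros)
      from has_derivative_compose[OF this G[OF j, unfolded gderiv_def]]
      show ?thesis by (simp add: has_field_derivative_def inner_commute mult_commute_abs)
    qed
    obtain t where "0 < t" "t < s m" "?f (s m) - ?f 0 = (s m - 0) * (G j ((P m j)(j := D j + t *\<^sub>R h j)) \<bullet> h j)"
      using MVT2[OF s(1)[of m] d] by blast
    moreover have "(P m j)(j := D j + s m *\<^sub>R h j) = P m (Suc j)" "(P m j)(j := D j + 0 *\<^sub>R h j) = P m j"
      by (auto simp: P_def fun_eq_iff)
    ultimately show ?thesis by auto
  qed
  have "\<forall>m j. \<exists>t. j < n \<longrightarrow> 0 < t \<and> t < s m \<and>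
      F (P m (Suc j)) - F (P m j) = s m * (G j ((P m j)(j := D j + t *\<^sub>R h j)) \<bullet> h j)"
    using ex by blast
  then obtain t where "\<forall>m j. j < n \<longrightarrow> 0 < t m j \<and> t m j < s m \<and>
      F (P m (Suc j)) - F (P m j) = s m * (G j ((P m j)(j := D j + t m j *\<^sub>R h j)) \<bullet> h j)"
    unfolding choice_iff by blast
  then have t: "\<And>m j. j < n \<Longrightarrow> 0 < t m j" "\<And>m j. j < n \<Longrightarrow> t m j < s m"
    "\<And>m j. j < n \<Longrightarrow> F (P m (Suc j)) - F (P m j) = s m * (G j ((P m j)(j := D j + t m j *\<^sub>R h j)) \<bullet> h j)"
    by blast+
  have lim: "(\<lambda>m. G j ((P m j)(j := D j + t m j *\<^sub>R h j)) \<bullet> h j) \<longlonglongrightarrow> h j \<bullet> h j" if j: "j < n" for j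
  proof -
    have tj: "(\<lambda>m. t m j) \<longlonglongrightarrow> 0"
      by (rule tendsto_sandwich[OF _ _ tendsto_const s(2)])
        (use t(1,2)[OF j] in \<open>auto intro!: always_eventually less_imp_le\<close>)
    \<comment> \<open>The intermediate points of the mean value theorem shrink to \<open>D\<close>,
      where \<open>G j\<close> is continuous.\<close>
    have "(\<lambda>m. (P m j)(j := D j + t m j *\<^sub>R h j)) \<longlonglongrightarrow> D"
    proof (rule tendsto_product_coordinatewise)
      fix i
      have "(\<lambda>m. D i + s m *\<^sub>R h i) \<longlonglongrightarrow> D i + 0 *\<^sub>R h i" by (intro tendsto_intros s)
      moreover have "(\<lambda>m. D j + t m j *\<^sub>R h j) \<longlonglongrightarrow> D j + 0 *\<^sub>R h j" by (intro tendsto_intros tj)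
      ultimately show "(\<lambda>m. ((P m j)(j := D j + t m j *\<^sub>R h j)) i) \<longlonglongrightarrow> D i"
        by (cases "i = j"; cases "i < j") (auto simp: P_def)
    qed
    then have "(\<lambda>m. G j ((P m j)(j := D j + t m j *\<^sub>R h j))) \<longlonglongrightarrow> G j D"
      by (rule continuous_on_tendsto_compose[OF cG[OF j]]) auto
    then show ?thesis unfolding h_def[symmetric] by (intro tendsto_intros)
  qed
  have "(\<lambda>m. \<Sum>j<n. G j ((P m j)(j := D j + t m j *\<^sub>R h j)) \<bullet> h j) \<longlonglongrightarrow> (\<Sum>j<n. h j \<bullet> h j)"
    by (intro tendsto_sum lim) auto
  moreover have "(\<lambda>m. (a + b * (data_norm n D + s m * c)) * c) \<longlonglongrightarrow> (a + b * (data_norm n D + 0 * c)) * c"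
    by (intro tendsto_intros s)
  moreover have "(\<Sum>j<n. G j ((P m j)(j := D j + t m j *\<^sub>R h j)) \<bullet> h j)
      \<le> (a + b * (data_norm n D + s m * c)) * c" for m
  proof -
    have "s m * (\<Sum>j<n. G j ((P m j)(j := D j + t m j *\<^sub>R h j)) \<bullet> h j) = (\<Sum>j<n. F (P m (Suc j)) - F (P m j))"
      using t(3) by (simp add: sum_distrib_left)
    also have "\<dots> = F (P m n) - F (P m 0)" by (rule sum_lessThan_telescope)
    also have "\<dots> \<le> (a + b * max (data_norm n (P m n)) (data_norm n (P m 0))) * data_norm n (\<lambda>i. P m n i - P m 0 i)"
      using data_lipD[OF F, of "P m n" "P m 0"] by (rule order_trans[OF abs_ge_self])
    also have "data_norm n (\<lambda>i. P m n i - P m 0 i) = data_norm n (\<lambda>i. s m *\<^sub>R h i)"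
      by (rule data_norm_cong) (simp add: P_def)
    also have "\<dots> = s m * c" using s(1)[of m] by (simp add: data_norm_scaleR c_def)
    also have "data_norm n (P m 0) = data_norm n D" by (simp add: P_def)
    also have "data_norm n (P m n) = data_norm n (\<lambda>i. D i + s m *\<^sub>R h i)"
      by (rule data_norm_cong) (simp add: P_def)
    also have "(a + b * max (data_norm n (\<lambda>i. D i + s m *\<^sub>R h i)) (data_norm n D)) * (s m * c)
        \<le> (a + b * (data_norm n D + s m * c)) * (s m * c)"
      using data_norm_triangle[of n D "\<lambda>i. s m *\<^sub>R h i"] s(1)[of m] ab
      by (intro mult_right_mono add_left_mono mult_left_mono) (auto simp: data_norm_scaleR c_def)
    finally have "s m * (\<Sum>j<n. G j ((P m j)(j := D j + t m j *\<^sub>R h j)) \<bullet> h j)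
        \<le> s m * ((a + b * (data_norm n D + s m * c)) * c)" by (simp only: mult_ac)
    then show ?thesis using s(1)[of m] by simp
  qed
  \<comment> \<open>The left-hand side is \<open>c\<^sup>2\<close>, so one factor \<open>c\<close>
    cancels and the bound on the norm of the gradient remains.\<close>
  ultimately have "(\<Sum>j<n. h j \<bullet> h j) \<le> (a + b * (data_norm n D + 0 * c)) * c"
    by (intro LIMSEQ_le) auto
  moreover have c2: "(\<Sum>j<n. h j \<bullet> h j) = c\<^sup>2" by (simp add: c_def data_norm_sq power2_norm_eq_inner)
  ultimately have "c * c \<le> (a + b * data_norm n D) * c" by (simp add: power2_eq_square)
  moreover have "0 \<le> c" by (simp add: c_def)
  ultimately have "c \<le> a + b * data_norm n D"
    using ab by (cases "c = 0") auto
  then have "c\<^sup>2 \<le> (a + b * data_norm n D)\<^sup>2" using \<open>0 \<le> c\<close> by (rule power_mono)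
  then show ?thesis using c2 by (simp add: h_def power2_norm_eq_inner)
qed

section \<open>Mollification\<close>

text \<open>The kernel is not smooth, but differentiable with a Lipschitz gradient.\<close>

definition bump :: "real \<Rightarrow> 'z::euclidean_space \<Rightarrow> real" where
  "bump e u = (max 0 (e\<^sup>2 - u \<bullet> u))\<^sup>2"

text \<open>The gradient of \<open>bump e\<close> at \<open>u\<close> is
  \<open>- bump_slope e u *\<^sub>R u\<close>. The sign suits the shifted kernel
  \<open>bump e (u - k)\<close>, whose first-order change is
  \<open>bump_slope e u * (u \<bullet> k)\<close>.\<close>

definition bump_slope :: "real \<Rightarrow> 'z::euclidean_space \<Rightarrow> real" where
  "bump_slope e u = 4 * max 0 (e\<^sup>2 - u \<bullet> u)"

lemma bump_eq_0: "0 \<le> e \<Longrightarrow> e \<le> norm u \<Longrightarrow> bump e u = 0" "0 \<le> e \<Longrightarrow> e \<le> norm u \<Longrightarrow> bump_slope e u = 0"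
proof -
  assume "0 \<le> e" "e \<le> norm u"
  then have "e\<^sup>2 \<le> (norm u)\<^sup>2" by (simp add: power_mono)
  then show "bump e u = 0" "bump_slope e u = 0" by (simp_all add: bump_def bump_slope_def power2_norm_eq_inner)
qed

lemma continuous_bump: "continuous_on UNIV (bump e)" "continuous_on UNIV (bump_slope e)"
  unfolding bump_def[abs_def] bump_slope_def[abs_def] by (intro continuous_intros)+

lemma bump_nonneg: "0 \<le> bump e u" "0 \<le> bump_slope e u"
  by (simp_all add: bump_def bump_slope_def)

lemma bump_le: "bump e u \<le> (e\<^sup>2)\<^sup>2"
  unfolding bump_def by (rule power_mono) auto

lemma bump_slope_le: "bump_slope e u \<le> 4 * e\<^sup>2"
  by (simp add: bump_slope_def)

lemma bump_borel[measurable]: "bump e \<in> borel_measurable borel" "bump_slope e \<in> borel_measurable borel"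
  using continuous_bump by (auto intro: borel_measurable_continuous_onI)

lemma compact_support_integrable:
  fixes f :: "'z::euclidean_space \<Rightarrow> 'b::{banach, second_countable_topology}"
  assumes [measurable]: "f \<in> borel_measurable borel"
    and "\<And>u. norm u \<le> e \<Longrightarrow> norm (f u) \<le> B" "\<And>u. e < norm u \<Longrightarrow> f u = 0"
  shows "integrable lborel f" "norm (\<integral>u. f u \<partial>lborel) \<le> B * measure lborel (cball (0::'z) e)"
proof -
  have b: "integrable lborel (\<lambda>u. indicator (cball (0::'z) e) u * B)"
    using emeasure_lborel_cball_finite[of 0 e] by (intro integrable_mult_left integrable_real_indicator) auto
  have le: "norm (f u) \<le> indicator (cball (0::'z) e) u * B" for u
    using assms(2,3)[of u] by (auto simp: indicator_def)
  show i: "integrable lborel f"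
    by (rule Bochner_Integration.integrable_bound[OF b]) (auto intro!: AE_I2 order_trans[OF le])
  have "norm (\<integral>u. f u \<partial>lborel) \<le> (\<integral>u. norm (f u) \<partial>lborel)" by (rule integral_norm_bound)
  also have "\<dots> \<le> (\<integral>u. indicator (cball (0::'z) e) u * B \<partial>lborel)"
    using i b le by (intro integral_mono) auto
  also have "\<dots> = B * measure lborel (cball (0::'z) e)" by simp
  finally show "norm (\<integral>u. f u \<partial>lborel) \<le> B * measure lborel (cball (0::'z) e)" .
qed

lemma bump_integrable: "0 < e \<Longrightarrow> integrable lborel (bump e :: 'z::euclidean_space \<Rightarrow> real)"
proof (rule compact_support_integrable(1)[where e=e and B="(e\<^sup>2)\<^sup>2"])
  fix u :: 'z assume "norm u \<le> e"
  show "norm (bump e u) \<le> (e\<^sup>2)\<^sup>2"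
    using bump_le[of e u] bump_nonneg(1)[of e u] by (simp only: real_norm_def abs_of_nonneg)
qed (auto intro: bump_eq_0)

lemma bump_integral_pos: "0 < e \<Longrightarrow> 0 < (\<integral>u. bump e (u::'z::euclidean_space) \<partial>lborel)"
proof -
  assume e: "0 < e"
  define d where "d = (e\<^sup>2 - (e / 2)\<^sup>2)\<^sup>2"
  have d: "0 < d" using e by (auto simp: d_def power2_eq_square)
  have le: "indicator (ball (0::'z) (e/2)) u * d \<le> bump e u" for u
  proof (cases "u \<in> ball 0 (e/2)")
    case True
    then have "(norm u)\<^sup>2 \<le> (e / 2)\<^sup>2" by (intro power_mono) auto
    moreover have "0 \<le> e\<^sup>2 - (e / 2)\<^sup>2" by (simp add: power_divide)
    ultimately show ?thesis using True
      by (auto simp: bump_def d_def power2_norm_eq_inner intro!: power_mono)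
  qed (auto simp: bump_nonneg)
  have "0 < measure lborel (ball (0::'z) (e/2)) * d"
    using content_ball_pos[of "e/2" "0::'z"] e d by simp
  also have "\<dots> = (\<integral>u. indicator (ball (0::'z) (e/2)) u * d \<partial>lborel)" by simp
  also have "\<dots> \<le> (\<integral>u. bump e (u::'z) \<partial>lborel)"
  proof (rule integral_mono[OF _ bump_integrable[OF e] le])
    have "emeasure lborel (ball (0::'z) (e/2)) < \<infinity>"
      by (rule le_less_trans[OF emeasure_mono emeasure_lborel_cball_finite[of 0 "e/2"]]) auto
    then show "integrable lborel (\<lambda>u. indicator (ball (0::'z) (e/2)) u * d)"
      by (intro integrable_mult_left integrable_real_indicator) auto
  qed
  finally show ?thesis .
qed

text \<open>\<open>bump\<close> is the square of the positive part of
  \<open>x = e\<^sup>2 - u \<bullet> u\<close>, and a shift by \<open>k\<close> changes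
  \<open>x\<close> by \<open>d = 2 * (u \<bullet> k) - (norm k)\<^sup>2\<close>. On the ball of
  radius \<open>e + 1\<close> one has \<open>\<bar>d\<bar> \<le> (2 * e + 3) * norm k\<close>; the
  part of \<open>d\<close> that is quadratic in \<open>k\<close> contributes
  \<open>2 * e\<^sup>2\<close>. Taking \<open>norm k \<le> 1\<close> confines the remainder to this
  fixed ball, which makes it integrable.\<close>

lemma bump_taylor:
  fixes u k :: "'z::euclidean_space"
  assumes e: "0 < e" and k: "norm k \<le> 1"
  shows "\<bar>bump e (u - k) - bump e u - bump_slope e u * (u \<bullet> k)\<bar>
     \<le> (if norm u \<le> e + 1 then ((2 * e + 3)\<^sup>2 + 2 * e\<^sup>2) * (norm k)\<^sup>2 else 0)"
proof (cases "norm u \<le> e + 1")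
  case True
  define x where "x = e\<^sup>2 - u \<bullet> u"
  define d where "d = 2 * (u \<bullet> k) - (norm k)\<^sup>2"
  define p where "p = max 0 x"
  have y: "e\<^sup>2 - (u - k) \<bullet> (u - k) = x + d"
    by (simp add: x_def d_def algebra_simps inner_commute power2_norm_eq_inner)
  \<comment> \<open>First-order expansion of the squared positive part, whose derivative
    \<open>2 * max 0 x\<close> is Lipschitz with constant 2.\<close>
  have "\<bar>(max 0 (x + d))\<^sup>2 - p\<^sup>2 - 2 * p * d\<bar> \<le> d\<^sup>2"
  proof (cases "0 \<le> x"; cases "0 \<le> x + d")
    assume "0 \<le> x" "0 \<le> x + d" then show ?thesis by (simp add: p_def power2_sum)
  next
    assume x: "0 \<le> x" "\<not> 0 \<le> x + d"
    then have "(x + d)\<^sup>2 \<le> d\<^sup>2" by (simp add: abs_le_square_iff[symmetric])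
    moreover have "- x\<^sup>2 - 2 * x * d = d\<^sup>2 - (x + d)\<^sup>2" by (simp add: power2_sum)
    ultimately show ?thesis using x zero_le_power2[of "x + d"] by (simp add: p_def)
  next
    assume x: "\<not> 0 \<le> x" "0 \<le> x + d"
    then have "(x + d)\<^sup>2 \<le> d\<^sup>2" by (intro power_mono) auto
    then show ?thesis using x by (simp add: p_def)
  next
    assume x: "\<not> 0 \<le> x" "\<not> 0 \<le> x + d"
    then show ?thesis by (simp add: p_def)
  qed
  moreover have "bump_slope e u * (u \<bullet> k) = 2 * p * d + 2 * p * (norm k)\<^sup>2"
    by (simp add: bump_slope_def p_def x_def d_def algebra_simps)
  ultimately have "\<bar>bump e (u - k) - bump e u - bump_slope e u * (u \<bullet> k)\<bar> \<le> d\<^sup>2 + \<bar>2 * p * (norm k)\<^sup>2\<bar>"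
    unfolding bump_def y p_def[symmetric] x_def[symmetric] by linarith
  also have "\<dots> \<le> (2 * e + 3)\<^sup>2 * (norm k)\<^sup>2 + 2 * e\<^sup>2 * (norm k)\<^sup>2"
  proof (rule add_mono)
    have "\<bar>d\<bar> \<le> 2 * (norm u * norm k) + norm k * norm k"
      using Cauchy_Schwarz_ineq2[of u k] zero_le_square[of "norm k"]
      unfolding d_def power2_eq_square by linarith
    also have "\<dots> \<le> 2 * ((e + 1) * norm k) + 1 * norm k"
      using True k e by (intro add_mono mult_left_mono mult_right_mono) auto
    finally have "\<bar>d\<bar> \<le> (2 * e + 3) * norm k" by (simp add: algebra_simps)
    then have "\<bar>d\<bar>\<^sup>2 \<le> ((2 * e + 3) * norm k)\<^sup>2" by (rule power_mono) simp
    then show "d\<^sup>2 \<le> (2 * e + 3)\<^sup>2 * (norm k)\<^sup>2" by (simp add: power_mult_distrib)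
    have "p \<le> e\<^sup>2" "0 \<le> p" by (simp_all add: p_def x_def)
    then show "\<bar>2 * p * (norm k)\<^sup>2\<bar> \<le> 2 * e\<^sup>2 * (norm k)\<^sup>2" by (simp add: abs_mult mult_right_mono)
  qed
  finally show ?thesis using True by (simp add: algebra_simps)
next
  case False
  then have "e \<le> norm u" "e \<le> norm (u - k)"
    using k norm_triangle_ineq2[of u k] by auto
  then show ?thesis using e False by (simp add: bump_eq_0)
qed

text \<open>\<open>h\<close> is merely bounded and measurable, so the derivative has to fall on the
  kernel: translation invariance moves the shift from \<open>h\<close> to \<open>bump\<close>, and
  the remainder of \<open>bump_taylor\<close> is integrated over a ball.\<close>

lemma smoothing_gderiv:
  fixes h :: "'z::euclidean_space \<Rightarrow> real"
  assumes e: "0 < e" and h[measurable]: "h \<in> borel_measurable borel" and hR: "\<And>z. \<bar>h z\<bar> \<le> R"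
  shows "GDERIV (\<lambda>z. \<integral>u. h (z + u) * bump e u \<partial>lborel) z :>
    (\<integral>u. (h (z + u) * bump_slope e u) *\<^sub>R u \<partial>lborel)"
proof -
  let ?S = "\<lambda>z. \<integral>u. h (z + u) * bump e u \<partial>lborel" and ?G = "\<integral>u. (h (z + u) * bump_slope e u) *\<^sub>R u \<partial>lborel"
  have R: "0 \<le> R" using hR[of 0] by linarith
  define C where "C = ((2 * e + 3)\<^sup>2 + 2 * e\<^sup>2)"
  define V where "V = measure lborel (cball (0::'z) (e + 1))"
  have shift: "(\<integral>u. f (k + u) \<partial>lborel) = (\<integral>u. f u \<partial>lborel)" if [measurable]: "f \<in> borel_measurable borel"
    for f :: "'z \<Rightarrow> real" and k
    using integral_distr[of "(+) k" lborel borel f] by (simp add: lborel_distr_plus)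
  have i1: "integrable lborel (\<lambda>u. h (w + u) * bump e u)" for w
    by (rule Bochner_Integration.integrable_bound[OF integrable_mult_right[OF bump_integrable[OF e], of R]])
      (use hR R in \<open>auto simp: abs_mult bump_nonneg abs_of_nonneg intro!: AE_I2 mult_right_mono\<close>)
  have iG: "integrable lborel (\<lambda>u. (h (z + u) * bump_slope e u) *\<^sub>R u)"
  proof (rule compact_support_integrable(1)[where e=e and B="(R * (4 * e\<^sup>2)) * e"])
    fix u :: 'z assume "norm u \<le> e"
    then show "norm ((h (z + u) * bump_slope e u) *\<^sub>R u) \<le> (R * (4 * e\<^sup>2)) * e"
      unfolding norm_scaleR abs_mult using hR R e bump_slope_le[of e u] bump_nonneg(2)[of e u]
      by (intro mult_mono) auto
  qed (use e in \<open>auto simp: bump_eq_0\<close>)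
  have iG': "integrable lborel (\<lambda>u. h (z + u) * (bump_slope e u * (u \<bullet> k)))" for k
    using integrable_inner_left[OF iG, of k] by (simp add: mult_ac)
  have est: "\<bar>?S (z + k) - ?S z - k \<bullet> ?G\<bar> \<le> (R * (C * (norm k)\<^sup>2)) * V" if k: "norm k \<le> 1" for k
  proof -
    have S: "?S (z + k) = (\<integral>u. h (z + u) * bump e (u - k) \<partial>lborel)"
      using shift[of "\<lambda>u. h (z + u) * bump e (u - k)" k] by (simp add: add_ac)
    have iS: "integrable lborel (\<lambda>u. h (z + u) * bump e (u - k))"
    proof (rule compact_support_integrable(1)[where e="e+1" and B="R * (e\<^sup>2)\<^sup>2"])
      fix u :: 'z
      show "norm (h (z + u) * bump e (u - k)) \<le> R * (e\<^sup>2)\<^sup>2"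
        unfolding real_norm_def abs_mult using hR R bump_nonneg(1)[of e "u - k"] bump_le[of e "u - k"]
        by (intro mult_mono) (simp_all only: abs_of_nonneg abs_ge_zero)
      assume "e + 1 < norm u"
      then have "e \<le> norm (u - k)" using k norm_triangle_ineq2[of u k] by auto
      then show "h (z + u) * bump e (u - k) = 0" using e by (simp add: bump_eq_0)
    qed measurable
    have G: "k \<bullet> ?G = (\<integral>u. h (z + u) * (bump_slope e u * (u \<bullet> k)) \<partial>lborel)"
      using integral_inner_left[OF iG, of k] by (simp add: mult_ac inner_commute)
    have "?S (z + k) - ?S z - k \<bullet> ?G
        = (\<integral>u. h (z + u) * (bump e (u - k) - bump e u - bump_slope e u * (u \<bullet> k)) \<partial>lborel)"
      unfolding S G using iS i1[of z] iG'[of k] by (simp add: right_diff_distrib)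
    also have "norm \<dots> \<le> (R * (C * (norm k)\<^sup>2)) * V"
      unfolding V_def
    proof (rule compact_support_integrable(2))
      fix u :: 'z
      note T = bump_taylor[OF e k, of u, folded C_def]
      show "norm u \<le> e + 1 \<Longrightarrow> norm (h (z + u) * (bump e (u - k) - bump e u - bump_slope e u * (u \<bullet> k))) \<le> R * (C * (norm k)\<^sup>2)"
        unfolding real_norm_def abs_mult using hR R T by (intro mult_mono) auto
      show "e + 1 < norm u \<Longrightarrow> h (z + u) * (bump e (u - k) - bump e u - bump_slope e u * (u \<bullet> k)) = 0"
        using T by auto
    qed measurable
    finally show ?thesis by simp
  qed
  show ?thesis
    unfolding gderiv_def has_derivative_at
  proof
    show "bounded_linear (\<lambda>k. k \<bullet> ?G)" by (rule bounded_linear_inner_left)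
    show "(\<lambda>k. norm (?S (z + k) - ?S z - k \<bullet> ?G) / norm k) \<midarrow>0\<rightarrow> 0"
    proof (rule Lim_null_comparison)
      show "\<forall>\<^sub>F k in at 0. norm (norm (?S (z + k) - ?S z - k \<bullet> ?G) / norm k) \<le> R * C * V * norm k"
        unfolding eventually_at
      proof (intro exI[of _ 1] conjI ballI impI)
        fix k :: 'z assume k: "k \<noteq> 0 \<and> dist k 0 < 1"
        then have "\<bar>?S (z + k) - ?S z - k \<bullet> ?G\<bar> / norm k \<le> (R * (C * (norm k)\<^sup>2)) * V / norm k"
          by (intro divide_right_mono est) auto
        then show "norm (norm (?S (z + k) - ?S z - k \<bullet> ?G) / norm k) \<le> R * C * V * norm k"
          using k by (simp add: power2_eq_square mult_ac)
      qed simp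
      show "((\<lambda>k::'z. R * C * V * norm k) \<longlongrightarrow> 0) (at 0)" by (auto intro!: tendsto_eq_intros)
    qed
  qed
qed

text \<open>Continuity refers to the product topology over all of \<open>nat\<close>, whose Borel
  sets are those of the countable product. The space of \<open>Pi\<^sub>M I M\<close> embeds
  measurably, since coordinates outside \<open>I\<close> have the constant value
  \<open>undefined\<close> there.\<close>

lemma continuous_measurable_PiM:
  fixes f :: "(nat \<Rightarrow> 'z::second_countable_topology) \<Rightarrow> 'b::topological_space"
  assumes f: "continuous_on UNIV f" and M: "\<And>i. i \<in> I \<Longrightarrow> sets (M i) = sets borel"
  shows "f \<in> borel_measurable (Pi\<^sub>M I M)"
proof -
  have c: "(\<lambda>x. x i) \<in> borel_measurable (Pi\<^sub>M I (\<lambda>_. borel :: 'z measure))" for i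
  proof (cases "i \<in> I")
    case False
    have "(\<lambda>x. x i) \<in> borel_measurable (Pi\<^sub>M I (\<lambda>_. borel :: 'z measure)) \<longleftrightarrow>
        (\<lambda>x. undefined :: 'z) \<in> borel_measurable (Pi\<^sub>M I (\<lambda>_. borel :: 'z measure))"
      using False by (intro measurable_cong) (auto simp: space_PiM PiE_def extensional_def)
    then show ?thesis by simp
  qed (rule measurable_component_singleton)
  have "(\<lambda>x. x) \<in> measurable (Pi\<^sub>M I (\<lambda>_. borel :: 'z measure)) (Pi\<^sub>M UNIV (\<lambda>_. borel :: 'z measure))"
    using measurable_PiM_single'[where f="\<lambda>i x. x i" and I=UNIV, OF c] by (simp add: PiE_UNIV_domain)
  moreover have "f \<in> borel_measurable (Pi\<^sub>M UNIV (\<lambda>_. borel))"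
    using borel_measurable_continuous_onI[OF f] measurable_cong_sets[OF sets_PiM_equal_borel refl] by blast
  ultimately have "(\<lambda>x. f x) \<in> borel_measurable (Pi\<^sub>M I (\<lambda>_. borel :: 'z measure))"
    by (rule measurable_compose)
  moreover have "sets (Pi\<^sub>M I M) = sets (Pi\<^sub>M I (\<lambda>_. borel))" by (intro sets_PiM_cong refl M)
  ultimately show ?thesis by (simp add: measurable_cong_sets[of "Pi\<^sub>M I M"])
qed

lemma continuous_shift:
  fixes D :: "'i \<Rightarrow> 'z::real_normed_vector"
  shows "continuous_on UNIV (\<lambda>U j. D j + U j)" "continuous_on UNIV (\<lambda>U. (\<lambda>j. D j + U j)(i := w))"
proof -
  have *: "continuous_on UNIV (\<lambda>U. D j + U j)" for j
    by (intro continuous_on_add continuous_on_const continuous_on_product_coordinates)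
  then show "continuous_on UNIV (\<lambda>U j. D j + U j)"
    by (rule continuous_on_coordinatewise_then_product)
  show "continuous_on UNIV (\<lambda>U. (\<lambda>j. D j + U j)(i := w))"
  proof (rule continuous_on_coordinatewise_then_product)
    show "continuous_on UNIV (\<lambda>U. ((\<lambda>j. D j + U j)(i := w)) j)" for j
      using * by (cases "j = i") auto
  qed
qed

lemma continuous_fun_upd:
  fixes D :: "nat \<Rightarrow> 'z::topological_space"
  shows "continuous_on UNIV (\<lambda>z. D(i := z))"
proof (rule continuous_on_coordinatewise_then_product)
  show "continuous_on UNIV (\<lambda>z. (D(i := z)) j)" for j by (cases "j = i") (auto intro: continuous_intros)
qed

text \<open>Average over independent noise \<open>U\<close> with density proportional to
  \<open>bump e\<close> in each coordinate. As \<open>data_norm n U \<le> e * sqrt n\<close> almost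
  surely, values and increment bounds change by errors that vanish with \<open>e\<close>. For the
  partial gradient in coordinate \<open>i\<close> the other coordinates are integrated out before
  smoothing in the remaining one. The bound \<open>B\<close> depends on \<open>e\<close>, which is
  harmless because it serves integrability only.\<close>

lemma mollification:
  fixes F :: "(nat \<Rightarrow> 'z::euclidean_space) \<Rightarrow> real"
  assumes F: "data_lip n a b F" and ab: "0 \<le> a" "0 \<le> b" and FR: "\<And>D. \<bar>F D\<bar> \<le> R" and e: "0 < e"
  obtains \<phi> :: "(nat \<Rightarrow> 'z) \<Rightarrow> real" and \<Phi> B where
    "\<And>D. \<bar>\<phi> D\<bar> \<le> R"
    "\<And>D. \<bar>\<phi> D - F D\<bar> \<le> (a + b * (data_norm n D + e * sqrt n)) * (e * sqrt n)"
    "data_lip n (a + b * (e * sqrt n)) b \<phi>"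
    "\<And>i D z. i < n \<Longrightarrow> GDERIV (\<lambda>z. \<phi> (D(i:=z))) z :> \<Phi> i (D(i:=z))"
    "\<And>i. i < n \<Longrightarrow> continuous_on UNIV (\<Phi> i)"
    "\<And>i D. i < n \<Longrightarrow> norm (\<Phi> i D) \<le> B"
proof -
  define Z where "Z = (\<integral>u. bump e (u::'z) \<partial>lborel)"
  have Z: "0 < Z" unfolding Z_def by (rule bump_integral_pos[OF e])
  define \<nu> where "\<nu> = density lborel (\<lambda>u::'z. ennreal (bump e u / Z))"
  have sets_nu[measurable_cong]: "sets \<nu> = sets borel" by (simp add: \<nu>_def)
  have space_nu: "space \<nu> = UNIV" by (simp add: \<nu>_def)
  interpret \<nu>: prob_space \<nu>
  proof
    have "emeasure \<nu> (space \<nu>) = (\<integral>\<^sup>+u. ennreal (bump e (u::'z) / Z) \<partial>lborel)"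
      by (simp add: \<nu>_def emeasure_density)
    also have "\<dots> = ennreal (\<integral>u. bump e (u::'z) / Z \<partial>lborel)"
      using bump_integrable[OF e] Z by (intro nn_integral_eq_integral) (auto simp: bump_nonneg)
    also have "\<dots> = 1" using Z by (simp add: Z_def[symmetric])
    finally show "emeasure \<nu> (space \<nu>) = 1" .
  qed
  have pn: "prob_space \<nu>" by unfold_locales
  interpret N: prob_space "Pi\<^sub>M I (\<lambda>_. \<nu>)" for I :: "nat set" by (rule prob_space_PiM) (rule pn)
  define N where "N = Pi\<^sub>M {..<n} (\<lambda>_. \<nu>)"
  define \<phi> where "\<phi> D = (\<integral>U. F (\<lambda>j. D j + U j) \<partial>N)" for D
  \<comment> \<open>Only the \<open>i\<close>-th argument stays free. The value does not depend on
    \<open>D i\<close>, so in \<open>\<Phi> i (D(i:=z))\<close> the variable \<open>z\<close> enters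
    through the translation alone.\<close>
  define H where "H i D w = (\<integral>U. F ((\<lambda>j. D j + U j)(i := w)) \<partial>Pi\<^sub>M ({..<n} - {i}) (\<lambda>_. \<nu>))" for i D w
  define \<Phi> where "\<Phi> i D = (1 / Z) *\<^sub>R (\<integral>u. (H i D (D i + u) * bump_slope e u) *\<^sub>R u \<partial>lborel)" for i D
  have R: "0 \<le> R" using FR[of "\<lambda>_. 0"] by linarith
  have cF: "continuous_on UNIV F" by (rule data_lip_continuous[OF F])
  have mF: "(\<lambda>U. F (\<lambda>j. D j + U j)) \<in> borel_measurable (Pi\<^sub>M I (\<lambda>_. \<nu>))" for D I
    by (intro continuous_measurable_PiM continuous_on_compose2[OF cF] continuous_shift) (auto simp: sets_nu)
  have mH: "(\<lambda>U. F ((\<lambda>j. D j + U j)(i := w))) \<in> borel_measurable (Pi\<^sub>M I (\<lambda>_. \<nu>))" for D i w I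
    by (intro continuous_measurable_PiM continuous_on_compose2[OF cF] continuous_shift) (auto simp: sets_nu)
  have iF: "integrable (Pi\<^sub>M I (\<lambda>_. \<nu>)) (\<lambda>U. F (\<lambda>j. D j + U j))" for D I
    using FR by (intro N.integrable_bdd[where B=R] mF) auto
  have iH: "integrable (Pi\<^sub>M I (\<lambda>_. \<nu>)) (\<lambda>U. F ((\<lambda>j. D j + U j)(i := w)))" for D i w I
    using FR by (intro N.integrable_bdd[where B=R] mH) auto
  have HR: "\<bar>H i D w\<bar> \<le> R" for i D w
    unfolding H_def
  proof (intro abs_leI)
    let ?P = "Pi\<^sub>M ({..<n} - {i}) (\<lambda>_. \<nu>)"
    have FR': "- R \<le> F x" "F x \<le> R" for x using FR[of x] by auto
    show "(\<integral>U. F ((\<lambda>j. D j + U j)(i := w)) \<partial>?P) \<le> R"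
      by (rule N.integral_mono_bounds(2)[OF iH FR'])
    have "- R \<le> (\<integral>U. F ((\<lambda>j. D j + U j)(i := w)) \<partial>?P)"
      by (rule N.integral_mono_bounds(1)[OF iH FR'])
    then show "- (\<integral>U. F ((\<lambda>j. D j + U j)(i := w)) \<partial>?P) \<le> R" by simp
  qed
  \<comment> \<open>Convergence in the data and in the free argument together; continuity of
    \<open>\<Phi> i\<close> needs both, as \<open>D\<close> enters \<open>H\<close> in both
    places.\<close>
  have Hlim: "(\<lambda>m. H i (x m) (y m)) \<longlonglongrightarrow> H i D w" if x: "x \<longlonglongrightarrow> D" and y: "y \<longlonglongrightarrow> w" for i x D y w
    unfolding H_def
  proof (rule integral_dominated_convergence[where w="\<lambda>_. R"])
    show "AE U in Pi\<^sub>M ({..<n} - {i}) (\<lambda>_. \<nu>).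
        (\<lambda>m. F ((\<lambda>j. x m j + U j)(i := y m))) \<longlonglongrightarrow> F ((\<lambda>j. D j + U j)(i := w))"
    proof (rule AE_I2)
      fix U
      have xj: "(\<lambda>m. x m j) \<longlonglongrightarrow> D j" for j
        by (rule continuous_on_tendsto_compose[OF _ x, where s=UNIV]) auto
      have "(\<lambda>m. (\<lambda>j. x m j + U j)(i := y m)) \<longlonglongrightarrow> (\<lambda>j. D j + U j)(i := w)"
      proof (rule tendsto_product_coordinatewise)
        fix j show "(\<lambda>m. ((\<lambda>j. x m j + U j)(i := y m)) j) \<longlonglongrightarrow> ((\<lambda>j. D j + U j)(i := w)) j"
          by (cases "j = i") (auto intro!: tendsto_intros y xj)
      qed
      then show "(\<lambda>m. F ((\<lambda>j. x m j + U j)(i := y m))) \<longlonglongrightarrow> F ((\<lambda>j. D j + U j)(i := w))"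
        by (rule continuous_on_tendsto_compose[OF cF]) auto
    qed
  qed (use FR in \<open>auto intro!: mH\<close>)
  have cH: "continuous_on UNIV (H i D)" for i D
    by (rule continuous_on_sequentiallyI) (auto intro: Hlim)
  have mH': "H i D \<in> borel_measurable borel" for i D
    using cH by (rule borel_measurable_continuous_onI)
  have aeU: "AE U in N. data_norm n U \<le> e * sqrt n"
  proof -
    have "AE u in \<nu>. norm u \<le> e"
      unfolding \<nu>_def
    proof (subst AE_density, measurable, rule AE_I2, intro impI)
      fix u :: 'z assume "0 < ennreal (bump e u / Z)"
      then show "norm u \<le> e" using bump_eq_0(1)[of e u] e by force
    qed
    then have "AE U in N. norm (U i) \<le> e" if "i < n" for i
      unfolding N_def using that by (intro AE_PiM_component pn) auto
    then have "AE U in N. \<forall>i\<in>{..<n}. norm (U i) \<le> e"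
      by (intro AE_finite_allI) auto
    then show ?thesis by (rule AE_mp) (auto intro!: AE_I2 data_norm_le_const less_imp_le[OF e])
  qed
  define r where "r = e * sqrt n"
  have r: "0 \<le> r" using e by (simp add: r_def)
  interpret NN: prob_space N unfolding N_def by (rule N.prob_space_axioms)
  have iN: "integrable N (\<lambda>U. F (\<lambda>j. D j + U j))" for D unfolding N_def by (rule iF)
  \<comment> \<open>Used with \<open>x = 0\<close> for the bound by \<open>R\<close> and with
    \<open>x = F D\<close> for the distance to \<open>F\<close>.\<close>
  have avg: "\<bar>\<phi> D - x\<bar> \<le> K" if "AE U in N. \<bar>F (\<lambda>j. D j + U j) - x\<bar> \<le> K" for D x K
  proof -
    have "\<phi> D - x = (\<integral>U. F (\<lambda>j. D j + U j) - x \<partial>N)"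
      unfolding \<phi>_def using iN by (simp add: NN.prob_space)
    also have "\<bar>\<dots>\<bar> \<le> (\<integral>U. \<bar>F (\<lambda>j. D j + U j) - x\<bar> \<partial>N)" by (rule integral_abs_bound)
    also have "\<dots> \<le> K"
      using iN that by (intro NN.integral_le_const integrable_abs) auto
    finally show ?thesis .
  qed
  show ?thesis
  proof (rule that[of \<phi> \<Phi> "1 / Z * (R * (4 * e\<^sup>2) * e * measure lborel (cball (0::'z) e))"])
    show "\<bar>\<phi> D\<bar> \<le> R" for D using avg[of D 0 R] FR by auto
    show "\<bar>\<phi> D - F D\<bar> \<le> (a + b * (data_norm n D + e * sqrt n)) * (e * sqrt n)" for D
    proof (rule avg, rule AE_mp[OF aeU], rule AE_I2, rule impI)
      fix U :: "nat \<Rightarrow> 'z" assume U: "data_norm n U \<le> e * sqrt n"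
      have "\<bar>F (\<lambda>j. D j + U j) - F D\<bar> \<le> (a + b * max (data_norm n (\<lambda>j. D j + U j)) (data_norm n D)) * data_norm n U"
        using data_lipD[OF F, of "\<lambda>j. D j + U j" D] by simp
      also have "\<dots> \<le> (a + b * (data_norm n D + e * sqrt n)) * (e * sqrt n)"
        using U ab e data_norm_triangle[of n D U]
        by (intro mult_mono add_left_mono mult_left_mono add_nonneg_nonneg mult_nonneg_nonneg) auto
      finally show "\<bar>F (\<lambda>j. D j + U j) - F D\<bar> \<le> (a + b * (data_norm n D + e * sqrt n)) * (e * sqrt n)" .
    qed
    show "data_lip n (a + b * (e * sqrt n)) b \<phi>"
      unfolding data_lip_def
    proof (intro allI)
      fix D D' :: "nat \<Rightarrow> 'z"
      let ?K = "(a + b * (e * sqrt n) + b * max (data_norm n D) (data_norm n D')) * data_norm n (\<lambda>i. D i - D' i)"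
      have "\<phi> D - \<phi> D' = (\<integral>U. F (\<lambda>j. D j + U j) - F (\<lambda>j. D' j + U j) \<partial>N)"
        unfolding \<phi>_def using iN by simp
      also have "\<bar>\<dots>\<bar> \<le> (\<integral>U. \<bar>F (\<lambda>j. D j + U j) - F (\<lambda>j. D' j + U j)\<bar> \<partial>N)" by (rule integral_abs_bound)
      also have "\<dots> \<le> ?K"
      proof (rule NN.integral_le_const)
        show "integrable N (\<lambda>U. \<bar>F (\<lambda>j. D j + U j) - F (\<lambda>j. D' j + U j)\<bar>)" using iN by auto
        show "AE U in N. \<bar>F (\<lambda>j. D j + U j) - F (\<lambda>j. D' j + U j)\<bar> \<le> ?K"
        proof (rule AE_mp[OF aeU], rule AE_I2, rule impI)
          fix U :: "nat \<Rightarrow> 'z" assume U: "data_norm n U \<le> e * sqrt n"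
          have "\<bar>F (\<lambda>j. D j + U j) - F (\<lambda>j. D' j + U j)\<bar>
            \<le> (a + b * max (data_norm n (\<lambda>j. D j + U j)) (data_norm n (\<lambda>j. D' j + U j))) * data_norm n (\<lambda>i. D i - D' i)"
            using data_lipD[OF F, of "\<lambda>j. D j + U j" "\<lambda>j. D' j + U j"] by simp
          also have "\<dots> \<le> (a + b * (e * sqrt n + max (data_norm n D) (data_norm n D'))) * data_norm n (\<lambda>i. D i - D' i)"
            using U ab data_norm_triangle[of n D U] data_norm_triangle[of n D' U]
            by (intro mult_right_mono add_left_mono mult_left_mono) auto
          finally show "\<bar>F (\<lambda>j. D j + U j) - F (\<lambda>j. D' j + U j)\<bar> \<le> ?K" by (simp add: algebra_simps)
        qed
      qed
      finally show "\<bar>\<phi> D - \<phi> D'\<bar> \<le> ?K" .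
    qed
    fix i assume i: "i < n"
    have ins: "insert i ({..<n} - {i}) = {..<n}" using i by auto
    show "GDERIV (\<lambda>z. \<phi> (D(i:=z))) z :> \<Phi> i (D(i:=z))" for D z
    proof -
      have Hupd: "H i (D(i:=z)) = H i D" for z
        unfolding H_def by (intro ext Bochner_Integration.integral_cong arg_cong[of _ _ F]) auto
      have "\<phi> (D(i:=z)) = (1 / Z) * (\<integral>u. H i D (z + u) * bump e u \<partial>lborel)" for z
      proof -
        have "\<phi> (D(i:=z)) = (\<integral>u. (\<integral>U. F (\<lambda>j. (D(i:=z)) j + (U(i:=u)) j) \<partial>Pi\<^sub>M ({..<n} - {i}) (\<lambda>_. \<nu>)) \<partial>\<nu>)"
          using integral_PiM_insert(2)[where M="\<lambda>_. \<nu>" and I="{..<n} - {i}" and i=i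
              and f="\<lambda>U. F (\<lambda>j. (D(i:=z)) j + U j)", OF pn pn refl] iF
          unfolding \<phi>_def N_def ins by simp
        also have "\<dots> = (\<integral>u. H i D (z + u) \<partial>\<nu>)"
          unfolding H_def by (intro Bochner_Integration.integral_cong refl arg_cong[of _ _ F]) auto
        also have "\<dots> = (\<integral>u. (bump e u / Z) *\<^sub>R H i D (z + u) \<partial>lborel)"
          unfolding \<nu>_def using mH'[of i D] Z by (intro integral_density) (auto simp: bump_nonneg)
        also have "\<dots> = (1 / Z) * (\<integral>u. H i D (z + u) * bump e u \<partial>lborel)"
          by (subst integral_mult_right_zero[symmetric], intro Bochner_Integration.integral_cong) auto
        finally show ?thesis .
      qed
      moreover have "GDERIV (\<lambda>z. (1 / Z) * (\<integral>u. H i D (z + u) * bump e u \<partial>lborel)) z :>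
          (1 / Z) *\<^sub>R (\<integral>u. (H i D (z + u) * bump_slope e u) *\<^sub>R u \<partial>lborel)"
        using GDERIV_mult[OF GDERIV_const smoothing_gderiv[OF e mH' HR], of "1/Z"] by simp
      ultimately show ?thesis by (simp add: \<Phi>_def Hupd)
    qed
    have le: "norm ((H i D (D i + u) * bump_slope e u) *\<^sub>R u) \<le> R * (4 * e\<^sup>2) * e" if "norm u \<le> e" for u D
      unfolding norm_scaleR abs_mult using HR R e that bump_slope_le[of e u] bump_nonneg(2)[of e u]
      by (intro mult_mono) auto
    have m: "(\<lambda>u. (H i D (D i + u) * bump_slope e u) *\<^sub>R u) \<in> borel_measurable borel" for D
      using mH' by measurable
    show "norm (\<Phi> i D) \<le> 1 / Z * (R * (4 * e\<^sup>2) * e * measure lborel (cball (0::'z) e))" for D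
    proof -
      have "norm (\<integral>u. (H i D (D i + u) * bump_slope e u) *\<^sub>R u \<partial>lborel)
          \<le> R * (4 * e\<^sup>2) * e * measure lborel (cball (0::'z) e)"
        by (rule compact_support_integrable(2)[OF m le]) (use e in \<open>auto simp: bump_eq_0\<close>)
      then show ?thesis using Z unfolding \<Phi>_def norm_scaleR by (simp add: divide_right_mono)
    qed
    show "continuous_on UNIV (\<Phi> i)"
    proof (rule continuous_on_sequentiallyI)
      fix x :: "nat \<Rightarrow> nat \<Rightarrow> 'z" and D assume x: "x \<longlonglongrightarrow> D"
      have xi: "(\<lambda>m. x m i) \<longlonglongrightarrow> D i"
        by (rule continuous_on_tendsto_compose[OF _ x, where s=UNIV]) auto
      show "(\<lambda>m. \<Phi> i (x m)) \<longlonglongrightarrow> \<Phi> i D"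
        unfolding \<Phi>_def
      proof (intro tendsto_intros integral_dominated_convergence[where w="\<lambda>u. indicator (cball 0 e) u * (R * (4 * e\<^sup>2) * e)"])
        show "integrable lborel (\<lambda>u::'z. indicator (cball 0 e) u * (R * (4 * e\<^sup>2) * e))"
          using emeasure_lborel_cball_finite[of "0::'z" e] by (intro integrable_mult_left integrable_real_indicator) auto
        show "AE u in lborel. (\<lambda>m. (H i (x m) (x m i + u) * bump_slope e u) *\<^sub>R u) \<longlonglongrightarrow> (H i D (D i + u) * bump_slope e u) *\<^sub>R u"
          by (intro AE_I2 tendsto_intros Hlim x xi)
        show "AE u in lborel. norm ((H i (x m) (x m i + u) * bump_slope e u) *\<^sub>R u) \<le> indicator (cball 0 e) u * (R * (4 * e\<^sup>2) * e)" for m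
        proof (rule AE_I2)
          fix u :: 'z
          show "norm ((H i (x m) (x m i + u) * bump_slope e u) *\<^sub>R u) \<le> indicator (cball 0 e) u * (R * (4 * e\<^sup>2) * e)"
            using le[of u "x m"] bump_eq_0(2)[of e u] e by (cases "norm u \<le> e") (auto simp: indicator_def)
        qed
      qed (use m in auto)
    qed
  qed
qed

section \<open>Concentration for functions of independent data\<close>

context log_sobolev_space
begin

section \<open>Product laws and the moments of the data norm\<close>

abbreviation data_law :: "nat \<Rightarrow> (nat \<Rightarrow> 'z) measure" where
  "data_law n \<equiv> Pi\<^sub>M {..<n} (\<lambda>_. \<mu>)"

lemma prob_space_data: "prob_space (data_law n)"
  by (intro prob_space_PiM prob_space_axioms)

lemma continuous_measurable_data:
  "continuous_on UNIV f \<Longrightarrow> f \<in> borel_measurable (data_law n)"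
  for f :: "(nat \<Rightarrow> 'z) \<Rightarrow> 'b::topological_space"
  using continuous_measurable_PiM[of f "{..<n}" "\<lambda>_. \<mu>"] sets_mu by simp

lemma exp_data_norm_moment:
  assumes l: "0 < l" "2 * c * l < 1"
  shows "integrable (data_law n) (\<lambda>D. exp (l * (data_norm n D)\<^sup>2))"
    "ln (\<integral>D. exp (l * (data_norm n D)\<^sup>2) \<partial>data_law n) \<le> n * (l * second_moment \<mu> / (1 - 2 * c * l))"
proof -
  interpret P: product_prob_space "\<lambda>_::nat. \<mu>" by unfold_locales
  interpret N: prob_space "data_law n" by (rule prob_space_data)
  have eq: "exp (l * (data_norm n D)\<^sup>2) = (\<Prod>i<n. exp (l * (norm (D i))\<^sup>2))" for D :: "nat \<Rightarrow> 'z"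
    by (simp add: data_norm_sq sum_distrib_left exp_sum)
  show i: "integrable (data_law n) (\<lambda>D. exp (l * (data_norm n D)\<^sup>2))"
    unfolding eq by (intro P.product_integrable_prod exp_square_moment(1) l) auto
  have "(\<integral>D. exp (l * (data_norm n D)\<^sup>2) \<partial>data_law n) = (\<Prod>i<n. \<integral>z. exp (l * (norm z)\<^sup>2) \<partial>\<mu>)"
    unfolding eq by (intro P.product_integral_prod exp_square_moment(1) l) auto
  also have "\<dots> \<le> (\<Prod>i<n. exp (l * second_moment \<mu> / (1 - 2 * c * l)))"
    using exp_square_moment(2)[OF l] by (intro prod_mono) auto
  also have "\<dots> = exp (n * (l * second_moment \<mu> / (1 - 2 * c * l)))"
    unfolding exp_of_nat_mult by simp
  finally have "ln (\<integral>D. exp (l * (data_norm n D)\<^sup>2) \<partial>data_law n)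
      \<le> ln (exp (n * (l * second_moment \<mu> / (1 - 2 * c * l))))"
    using N.expectation_greater[OF i, of 0] by (subst ln_le_cancel_iff) auto
  then show "ln (\<integral>D. exp (l * (data_norm n D)\<^sup>2) \<partial>data_law n) \<le> n * (l * second_moment \<mu> / (1 - 2 * c * l))"
    by simp
qed

lemma data_norm_measurable[measurable]: "data_norm n \<in> borel_measurable (data_law n)"
  by (rule continuous_measurable_data[OF continuous_data_norm])

lemma data_norm_sq_integrable: "integrable (data_law n) (\<lambda>D. (data_norm n D)\<^sup>2)"
proof -
  \<comment> \<open>An admissible exponent for every \<open>c\<close>, including
    \<open>c = 0\<close>.\<close>
  define l where "l = 1 / (2 * c + 1)"
  have l: "0 < l" "2 * c * l < 1" using c_nonneg by (auto simp: l_def)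
  have le: "x \<le> exp (l * x) / l" for x
  proof -
    have "l * x \<le> exp (l * x)" using exp_ge_add_one_self[of "l * x"] by linarith
    then show ?thesis using l(1) by (simp add: field_simps)
  qed
  have i: "integrable (data_law n) (\<lambda>D. exp (l * (data_norm n D)\<^sup>2) / l)"
    using exp_data_norm_moment(1)[OF l] by simp
  show ?thesis
    by (rule Bochner_Integration.integrable_bound[OF i]) (use le l(1) in auto)
qed

lemma data_norm_integrable: "integrable (data_law n) (data_norm n)"
proof -
  interpret N: prob_space "data_law n" by (rule prob_space_data)
  have "x \<le> 1 + x\<^sup>2" for x :: real
    using zero_le_power2[of "x - 1"] zero_le_power2[of x] unfolding power2_diff one_power2 mult_1_right by linarith
  then have le: "norm (data_norm n D) \<le> norm (1 + (data_norm n D)\<^sup>2)" for D :: "nat \<Rightarrow> 'z" by simp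
  have i: "integrable (data_law n) (\<lambda>D. 1 + (data_norm n D)\<^sup>2)"
    using data_norm_sq_integrable by auto
  show ?thesis
    by (rule Bochner_Integration.integrable_bound[OF i data_norm_measurable]) (intro AE_I2 le)
qed

lemma data_lip_integrable:
  assumes F: "data_lip n a b F" and ab: "0 \<le> a" "0 \<le> b"
  shows "integrable (data_law n) F"
proof -
  interpret N: prob_space "data_law n" by (rule prob_space_data)
  have i: "integrable (data_law n) (\<lambda>D. \<bar>F (\<lambda>_. 0)\<bar> + a * data_norm n D + b * (data_norm n D)\<^sup>2)"
    by (intro Bochner_Integration.integrable_add integrable_mult_right data_norm_integrable data_norm_sq_integrable) auto
  show ?thesis
  proof (rule Bochner_Integration.integrable_bound[OF i continuous_measurable_data[OF data_lip_continuous[OF F]]])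
    show "AE D in data_law n. norm (F D) \<le> norm (\<bar>F (\<lambda>_. 0)\<bar> + a * data_norm n D + b * (data_norm n D)\<^sup>2)"
      using data_lip_linear_growth[OF F] ab by (intro AE_I2) (auto intro: order_trans[OF _ abs_ge_self])
  qed
qed

lemma smooth_entropy_bound:
  assumes \<phi>: "continuous_on UNIV \<phi>" "\<And>D. \<bar>\<phi> D\<bar> \<le> R"
    and G: "\<And>i D z. i < n \<Longrightarrow> GDERIV (\<lambda>z. \<phi> (D(i:=z))) z :> \<Phi> i (D(i:=z))"
    and cG: "\<And>i. i < n \<Longrightarrow> continuous_on UNIV (\<Phi> i)" and B: "\<And>i D. i < n \<Longrightarrow> norm (\<Phi> i D) \<le> B"
  shows "real_ent (data_law n) (\<lambda>D. exp (l * \<phi> D)) \<le>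
    c / 2 * l\<^sup>2 * (\<integral>D. (\<Sum>i<n. (norm (\<Phi> i D))\<^sup>2) * exp (l * \<phi> D) \<partial>data_law n)"
proof -
  interpret N: prob_space "data_law n" by (rule prob_space_data)
  \<comment> \<open>\<open>entropy_tensor\<close> asks for a bound at every index, so the value
    beyond \<open>n\<close> is set to 0.\<close>
  define g where "g i D = (if i < n then c / 2 * l\<^sup>2 * ((norm (\<Phi> i D))\<^sup>2 * exp (l * \<phi> D)) else 0)" for i D
  have R: "0 \<le> R" using \<phi>(2)[of "\<lambda>_. 0"] by linarith
  have lR: "\<bar>l * \<phi> D\<bar> \<le> \<bar>l\<bar> * R" for D unfolding abs_mult by (intro mult_left_mono \<phi>) auto
  have eb: "exp (- (\<bar>l\<bar> * R)) \<le> exp (l * \<phi> D)" "exp (l * \<phi> D) \<le> exp (\<bar>l\<bar> * R)" for D using lR[of D] by auto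
  have gb: "\<bar>g i D\<bar> \<le> c / 2 * l\<^sup>2 * (B\<^sup>2 * exp (\<bar>l\<bar> * R))" for i D
  proof (cases "i < n")
    case True
    have "(norm (\<Phi> i D))\<^sup>2 \<le> B\<^sup>2" using B[OF True] by (intro power_mono) auto
    then show ?thesis using True c_nonneg eb(2)[of D]
      by (auto simp: g_def abs_mult intro!: mult_left_mono mult_mono)
  qed (use c_nonneg in \<open>auto simp: g_def\<close>)
  have mg: "g i \<in> borel_measurable (data_law n)" if "i < n" for i
    unfolding g_def[abs_def] using that cG
    by (intro continuous_measurable_data) (auto intro!: continuous_intros \<phi>)
  have m\<phi>: "(\<lambda>D. exp (l * \<phi> D)) \<in> borel_measurable (data_law n)"
    by (intro continuous_measurable_data continuous_intros \<phi>)
  have "real_ent (data_law n) (\<lambda>D. exp (l * \<phi> D)) \<le> (\<Sum>i\<in>{..<n}. \<integral>D. g i D \<partial>data_law n)"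
  proof (rule entropy_tensor[OF prob_space_axioms, where c="exp (- (\<bar>l\<bar> * R))" and C="exp (\<bar>l\<bar> * R)"])
    show "\<bar>g i x\<bar> \<le> c / 2 * l\<^sup>2 * (B\<^sup>2 * exp (\<bar>l\<bar> * R))" for i x by (rule gb)
    fix i x assume "i \<in> {..<n}"
    then have i: "i < n" by simp
    have "real_ent \<mu> (\<lambda>z. exp (l * \<phi> (x(i:=z))))
        \<le> c / 2 * (\<integral>z. (norm (l *\<^sub>R \<Phi> i (x(i:=z))))\<^sup>2 * exp (l * \<phi> (x(i:=z))) \<partial>\<mu>)"
    proof (rule lsi_exp)
      show "GDERIV (\<lambda>z. l * \<phi> (x(i:=z))) z :> l *\<^sub>R \<Phi> i (x(i:=z))" for z
        using GDERIV_mult[OF GDERIV_const G[OF i], of l] by simp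
      show "continuous_on UNIV (\<lambda>z. l *\<^sub>R \<Phi> i (x(i:=z)))"
        by (intro continuous_intros continuous_on_compose2[OF cG[OF i] continuous_fun_upd]) auto
      show "norm (l *\<^sub>R \<Phi> i (x(i:=z))) \<le> \<bar>l\<bar> * B" for z using B[OF i] by (auto intro!: mult_left_mono)
    qed (rule lR)
    also have "\<dots> = c / 2 * (\<integral>z. l\<^sup>2 * ((norm (\<Phi> i (x(i:=z))))\<^sup>2 * exp (l * \<phi> (x(i:=z)))) \<partial>\<mu>)"
      by (simp add: power_mult_distrib mult_ac)
    also have "\<dots> = (\<integral>z. g i (x(i:=z)) \<partial>\<mu>)"
      using i by (simp add: g_def)
    finally show "real_ent \<mu> (\<lambda>z. exp (l * \<phi> (x(i:=z)))) \<le> (\<integral>z. g i (x(i:=z)) \<partial>\<mu>)" .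
  qed (use mg m\<phi> eb in auto)
  also have "\<dots> = (\<integral>D. (\<Sum>i<n. g i D) \<partial>data_law n)"
    using N.integrable_bdd[OF mg, of _ "c / 2 * l\<^sup>2 * (B\<^sup>2 * exp (\<bar>l\<bar> * R))"] gb
    by (intro Bochner_Integration.integral_sum[symmetric]) auto
  also have "\<dots> = (\<integral>D. c / 2 * l\<^sup>2 * ((\<Sum>i<n. (norm (\<Phi> i D))\<^sup>2) * exp (l * \<phi> D)) \<partial>data_law n)"
    by (intro Bochner_Integration.integral_cong refl) (simp add: g_def sum_distrib_left sum_distrib_right)
  also have "\<dots> = c / 2 * l\<^sup>2 * (\<integral>D. (\<Sum>i<n. (norm (\<Phi> i D))\<^sup>2) * exp (l * \<phi> D) \<partial>data_law n)"
    by simp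
  finally show ?thesis .
qed

text \<open>The quadratic part of the gradient bound is absorbed by entropy duality against
  \<open>exp (\<eta> \<parallel>D\<parallel>\<^sup>2)\<close>; the choice \<open>\<eta> = \<lambda> b / 2\<close> makes all error terms functions of \<open>c b \<lambda>\<close>.\<close>

lemma smooth_log_mgf_bound:
  assumes \<phi>: "continuous_on UNIV \<phi>" "\<And>D. \<bar>\<phi> D\<bar> \<le> R"
    and G: "\<And>i D z. i < n \<Longrightarrow> GDERIV (\<lambda>z. \<phi> (D(i:=z))) z :> \<Phi> i (D(i:=z))"
    and cG: "\<And>i. i < n \<Longrightarrow> continuous_on UNIV (\<Phi> i)" and B: "\<And>i D. i < n \<Longrightarrow> norm (\<Phi> i D) \<le> B"
    and gr: "\<And>D. (\<Sum>i<n. (norm (\<Phi> i D))\<^sup>2) \<le> (a + b * data_norm n D)\<^sup>2"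
    and ab: "0 \<le> a" "0 \<le> b" and l: "0 < l" "2 * (c * b) * l < 1"
  shows "ln (\<integral>D. exp (l * \<phi> D) \<partial>data_law n) \<le> l * (\<integral>D. \<phi> D \<partial>data_law n)
    + c * (a\<^sup>2 + b\<^sup>2 * (n * second_moment \<mu>)) * l\<^sup>2 / (1 - 2 * (c * b) * l)"
proof -
  interpret N: prob_space "data_law n" by (rule prob_space_data)
  have m\<phi>[measurable]: "\<phi> \<in> borel_measurable (data_law n)" by (rule continuous_measurable_data[OF \<phi>(1)])
  define M where "M = second_moment \<mu>"
  have M0: "0 \<le> M" unfolding M_def second_moment_def by (rule Bochner_Integration.integral_nonneg) auto
  define v where "v = a\<^sup>2 + b\<^sup>2 * (n * M)"
  have v0: "a\<^sup>2 \<le> v" "0 \<le> v" using M0 by (auto simp: v_def)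
  show ?thesis
    unfolding M_def[symmetric] v_def[symmetric]
  proof (rule N.herbst_sub_gamma[where B=R, OF m\<phi> \<phi>(2) _ l])
    show "0 \<le> c * b" using c_nonneg ab by simp
    fix l assume l: "0 < l" "2 * (c * b) * l < 1"
    define u where "u = c * b * l"
    have u: "0 \<le> u" "2 * u < 1" using c_nonneg ab l by (auto simp: u_def)
    define Y where "Y D = exp (l * \<phi> D)" for D
    define E where "E = (\<integral>D. Y D \<partial>data_law n)"
    define S where "S = (\<integral>D. Y D * (data_norm n D)\<^sup>2 \<partial>data_law n)"
    define \<rho> where "\<rho> = real_ent (data_law n) Y"
    have lR: "\<bar>l * \<phi> D\<bar> \<le> \<bar>l\<bar> * R" for D unfolding abs_mult by (intro mult_left_mono \<phi>) auto
    have Yb: "exp (- (\<bar>l\<bar> * R)) \<le> Y D" "Y D \<le> exp (\<bar>l\<bar> * R)" for D using lR[of D] by (auto simp: Y_def)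
    have [measurable]: "Y \<in> borel_measurable (data_law n)" unfolding Y_def by measurable
    have iY: "integrable (data_law n) Y"
      unfolding Y_def by (rule N.bounded_exp_integrable[OF m\<phi> \<phi>(2)])
    have E: "0 < E" unfolding E_def by (rule N.expectation_greater[OF iY]) (auto simp: Y_def)
    have iS: "integrable (data_law n) (\<lambda>D. Y D * (data_norm n D)\<^sup>2)"
      by (rule Bochner_Integration.integrable_bound[OF integrable_mult_right[OF data_norm_sq_integrable, where c="exp (\<bar>l\<bar> * R)"]])
        (use Yb in \<open>auto simp: abs_mult Y_def intro!: AE_I2 mult_right_mono\<close>)
    have "\<rho> \<le> c / 2 * l\<^sup>2 * (\<integral>D. (\<Sum>i<n. (norm (\<Phi> i D))\<^sup>2) * Y D \<partial>data_law n)"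
      unfolding \<rho>_def Y_def[abs_def] by (rule smooth_entropy_bound[OF \<phi> G cG B])
    \<comment> \<open>The square of the sum is split at the cost of a factor 2, which turns
      \<open>c / 2\<close> into \<open>c\<close>.\<close>
    also have "\<dots> \<le> c / 2 * l\<^sup>2 * (\<integral>D. 2 * a\<^sup>2 * Y D + 2 * b\<^sup>2 * (Y D * (data_norm n D)\<^sup>2) \<partial>data_law n)"
    proof (intro mult_left_mono integral_mono)
      show i: "integrable (data_law n) (\<lambda>D. 2 * a\<^sup>2 * Y D + 2 * b\<^sup>2 * (Y D * (data_norm n D)\<^sup>2))"
        using iY iS by auto
      show le: "(\<Sum>i<n. (norm (\<Phi> i D))\<^sup>2) * Y D \<le> 2 * a\<^sup>2 * Y D + 2 * b\<^sup>2 * (Y D * (data_norm n D)\<^sup>2)" for D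
      proof -
        have "(a + b * data_norm n D)\<^sup>2 \<le> 2 * a\<^sup>2 + 2 * b\<^sup>2 * (data_norm n D)\<^sup>2"
          using zero_le_power2[of "a - b * data_norm n D"] by (simp add: power2_sum power2_diff power_mult_distrib)
        then have "(\<Sum>i<n. (norm (\<Phi> i D))\<^sup>2) * Y D \<le> (2 * a\<^sup>2 + 2 * b\<^sup>2 * (data_norm n D)\<^sup>2) * Y D"
          using gr[of D] by (intro mult_right_mono) (auto simp: Y_def)
        then show ?thesis by (simp add: algebra_simps)
      qed
      have [measurable]: "(\<lambda>D. \<Sum>i<n. (norm (\<Phi> i D))\<^sup>2) \<in> borel_measurable (data_law n)"
        by (intro continuous_measurable_data continuous_intros cG) auto
      have le': "norm ((\<Sum>i<n. (norm (\<Phi> i D))\<^sup>2) * Y D) \<le> norm (2 * a\<^sup>2 * Y D + 2 * b\<^sup>2 * (Y D * (data_norm n D)\<^sup>2))" for D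
        using le[of D] by (simp add: abs_mult Y_def sum_nonneg)
      show "integrable (data_law n) (\<lambda>D. (\<Sum>i<n. (norm (\<Phi> i D))\<^sup>2) * Y D)"
        by (rule Bochner_Integration.integrable_bound[OF i]) (measurable, intro AE_I2 le')
    qed (use c_nonneg in auto)
    also have "\<dots> = c * l\<^sup>2 * (a\<^sup>2 * E + b\<^sup>2 * S)"
    proof -
      have "(\<integral>D. 2 * a\<^sup>2 * Y D + 2 * b\<^sup>2 * (Y D * (data_norm n D)\<^sup>2) \<partial>data_law n) = 2 * a\<^sup>2 * E + 2 * b\<^sup>2 * S"
        using iY iS unfolding E_def S_def by (subst Bochner_Integration.integral_add) auto
      then show ?thesis by (simp add: algebra_simps)
    qed
    finally have r: "\<rho> \<le> c * l\<^sup>2 * (a\<^sup>2 * E + b\<^sup>2 * S)" .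
    have "(1 - 2 * u) * \<rho> \<le> c * l\<^sup>2 * v / (1 - 2 * u) * E"
    \<comment> \<open>Duality is used with a positive exponent \<open>h\<close>; for
      \<open>b = 0\<close> there is no quadratic term to absorb.\<close>
    proof (cases "b = 0")
      case True
      then show ?thesis using r by (simp add: u_def v_def)
    next
      case False
      then have b: "0 < b" using ab by simp
      define h where "h = l * b / 2"
      have h: "0 < h" "2 * c * h < 1" "2 * c * h = u" using b l u by (auto simp: h_def u_def mult_ac)
      have "(\<integral>D. Y D * (h * (data_norm n D)\<^sup>2) \<partial>data_law n)
          \<le> \<rho> + E * ln (\<integral>D. exp (h * (data_norm n D)\<^sup>2) \<partial>data_law n)"
        unfolding \<rho>_def E_def
        by (rule N.entropy_duality[where c="exp (- (\<bar>l\<bar> * R))" and C="exp (\<bar>l\<bar> * R)"])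
          (use Yb iS integrable_mult_right[OF iS, where c=h] exp_data_norm_moment(1)[OF h(1,2)] in \<open>auto simp: mult_ac\<close>)
      also have "(\<integral>D. Y D * (h * (data_norm n D)\<^sup>2) \<partial>data_law n) = h * S"
        unfolding S_def by (subst integral_mult_right_zero[symmetric]) (simp add: mult_ac)
      also have "\<rho> + E * ln (\<integral>D. exp (h * (data_norm n D)\<^sup>2) \<partial>data_law n) \<le> \<rho> + E * (n * (h * M / (1 - u)))"
        using exp_data_norm_moment(2)[OF h(1,2), of n, unfolded h(3)] E
        unfolding M_def by (intro add_left_mono mult_left_mono) auto
      \<comment> \<open>Since \<open>2 * u * h = c * l\<^sup>2 * b\<^sup>2\<close>, the left-hand
        side is exactly the term with \<open>S\<close> in the entropy bound; replacing it costs
        \<open>2 * u * \<rho>\<close>, which moves to the other side.\<close>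
      finally have "2 * u * (h * S) \<le> 2 * u * (\<rho> + E * (n * (h * M / (1 - u))))"
        using u by (intro mult_left_mono) auto
      then have i: "2 * u * (h * S) \<le> 2 * u * \<rho> + 2 * u * (E * (n * (h * M / (1 - u))))"
        by (simp only: distrib_left)
      have eq1: "2 * u * (h * S) = c * l\<^sup>2 * b\<^sup>2 * S" by (simp add: u_def h_def power2_eq_square)
      have eq2: "2 * u * (E * (n * (h * M / (1 - u)))) = c * l\<^sup>2 * (b\<^sup>2 * (n * M)) / (1 - u) * E"
      proof -
        have "2 * u * (E * (n * (h * M / (1 - u)))) = (2 * u * h) * (n * M) / (1 - u) * E" by (simp add: mult_ac)
        also have "2 * u * h = c * l\<^sup>2 * b\<^sup>2" by (simp add: u_def h_def power2_eq_square)
        finally show ?thesis by (simp add: mult_ac)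
      qed
      have r': "\<rho> \<le> c * l\<^sup>2 * a\<^sup>2 * E + c * l\<^sup>2 * b\<^sup>2 * S"
        using r by (simp only: distrib_left mult.assoc)
      have "(1 - 2 * u) * \<rho> = \<rho> - 2 * u * \<rho>" by (simp add: algebra_simps)
      then have "(1 - 2 * u) * \<rho> \<le> c * l\<^sup>2 * a\<^sup>2 * E + c * l\<^sup>2 * (b\<^sup>2 * (n * M)) / (1 - u) * E"
        using i r' unfolding eq1 eq2 by linarith
      \<comment> \<open>All denominators are weakened to \<open>1 - 2 * u\<close>; together with the
        factor on the left they form the square in the hypothesis of
        \<open>herbst_sub_gamma\<close>.\<close>
      also have "\<dots> \<le> c * l\<^sup>2 * a\<^sup>2 / (1 - 2 * u) * E + c * l\<^sup>2 * (b\<^sup>2 * (n * M)) / (1 - 2 * u) * E"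
      proof (intro add_mono mult_right_mono)
        have "c * l\<^sup>2 * a\<^sup>2 / 1 \<le> c * l\<^sup>2 * a\<^sup>2 / (1 - 2 * u)"
          using u c_nonneg by (intro divide_left_mono) auto
        then show "c * l\<^sup>2 * a\<^sup>2 \<le> c * l\<^sup>2 * a\<^sup>2 / (1 - 2 * u)" by simp
        show "c * l\<^sup>2 * (b\<^sup>2 * (n * M)) / (1 - u) \<le> c * l\<^sup>2 * (b\<^sup>2 * (n * M)) / (1 - 2 * u)"
          using u c_nonneg M0 by (intro divide_left_mono) auto
      qed (use E in auto)
      also have "\<dots> = c * l\<^sup>2 * v / (1 - 2 * u) * E"
        by (simp add: v_def add_divide_distrib algebra_simps)
      finally show ?thesis .
    qed
    then have "\<rho> \<le> c * l\<^sup>2 * v / (1 - 2 * u) * E / (1 - 2 * u)"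
      using u by (subst pos_le_divide_eq) (simp, simp only: mult.commute)
    also have "\<dots> = c * v * l\<^sup>2 / (1 - 2 * (c * b) * l)\<^sup>2 * E"
      by (simp add: u_def power2_eq_square mult_ac)
    finally show "real_ent (data_law n) (\<lambda>D. exp (l * \<phi> D))
        \<le> c * v * l\<^sup>2 / (1 - 2 * (c * b) * l)\<^sup>2 * (\<integral>D. exp (l * \<phi> D) \<partial>data_law n)"
      unfolding \<rho>_def E_def Y_def[abs_def] .
  qed
qed

text \<open>Truncation at level \<open>m\<close> and mollification at scale
  \<open>1 / (m + 1)\<close> lead to functions covered by the smooth bound, which sees the level
  only through the mean and the vanishing scale. The means converge by domination, as
  \<open>F\<close> grows at most quadratically. The exponentials have no dominating function
  beforehand, so Fatou is used, and integrability of \<open>exp (l * F D)\<close> comes out of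
  it.\<close>

lemma data_lip_mgf_bound:
  assumes F: "data_lip n a b F" and ab: "0 \<le> a" "0 \<le> b"
    and l: "0 < l" "2 * (c * b) * l < 1"
  shows "integrable (data_law n) (\<lambda>D. exp (l * F D))"
    and "(\<integral>D. exp (l * F D) \<partial>data_law n) \<le> exp (l * (\<integral>D. F D \<partial>data_law n)
      + c * (a\<^sup>2 + b\<^sup>2 * (n * second_moment \<mu>)) * l\<^sup>2 / (1 - 2 * (c * b) * l))"
proof -
  interpret N: prob_space "data_law n" by (rule prob_space_data)
  define R where "R m = real m" for m
  define e where "e m = 1 / real (Suc m)" for m
  have e: "0 < e m" "e m \<le> 1" for m by (auto simp: e_def)
  have e0: "e \<longlonglongrightarrow> 0"
    using LIMSEQ_inverse_real_of_nat by (simp add: e_def[abs_def] inverse_eq_divide)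
  define F' where "F' m D = max (- R m) (min (R m) (F D))" for m D
  have F': "data_lip n a b (F' m)" "\<bar>F' m D\<bar> \<le> R m" "\<bar>F' m D\<bar> \<le> \<bar>F D\<bar>" for m D
    unfolding F'_def by (rule data_lip_clip[OF F]) (auto simp: R_def)
  have "\<exists>\<phi>. continuous_on UNIV \<phi> \<and> (\<forall>D. \<bar>\<phi> D\<bar> \<le> R m) \<and>
     (\<forall>D. \<bar>\<phi> D - F' m D\<bar> \<le> (a + b * (data_norm n D + e m * sqrt n)) * (e m * sqrt n)) \<and>
     ln (\<integral>D. exp (l * \<phi> D) \<partial>data_law n) \<le> l * (\<integral>D. \<phi> D \<partial>data_law n)
       + c * ((a + b * (e m * sqrt n))\<^sup>2 + b\<^sup>2 * (n * second_moment \<mu>)) * l\<^sup>2 / (1 - 2 * (c * b) * l)" for m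
  proof -
    obtain \<phi> :: "(nat \<Rightarrow> 'z) \<Rightarrow> real" and \<Phi> B where \<phi>:
      "\<And>D. \<bar>\<phi> D\<bar> \<le> R m"
      "\<And>D. \<bar>\<phi> D - F' m D\<bar> \<le> (a + b * (data_norm n D + e m * sqrt n)) * (e m * sqrt n)"
      "data_lip n (a + b * (e m * sqrt n)) b \<phi>"
      "\<And>i D z. i < n \<Longrightarrow> GDERIV (\<lambda>z. \<phi> (D(i:=z))) z :> \<Phi> i (D(i:=z))"
      "\<And>i. i < n \<Longrightarrow> continuous_on UNIV (\<Phi> i)"
      "\<And>i D. i < n \<Longrightarrow> norm (\<Phi> i D) \<le> B"
      using mollification[OF F'(1) ab F'(2) e(1)] by blast
    have a': "0 \<le> a + b * (e m * sqrt n)" using ab less_imp_le[OF e(1)] by simp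
    have "ln (\<integral>D. exp (l * \<phi> D) \<partial>data_law n) \<le> l * (\<integral>D. \<phi> D \<partial>data_law n)
       + c * ((a + b * (e m * sqrt n))\<^sup>2 + b\<^sup>2 * (n * second_moment \<mu>)) * l\<^sup>2 / (1 - 2 * (c * b) * l)"
      by (rule smooth_log_mgf_bound[OF data_lip_continuous[OF \<phi>(3)] \<phi>(1,4,5,6)
            data_lip_gradient_bound[OF \<phi>(3) a' ab(2) \<phi>(4,5)] a' ab(2) l])
    then show ?thesis using \<phi>(1,2) data_lip_continuous[OF \<phi>(3)] by blast
  qed
  then obtain \<phi> where \<phi>: "\<And>m. continuous_on UNIV (\<phi> m)" "\<And>m D. \<bar>\<phi> m D\<bar> \<le> R m"
     "\<And>m D. \<bar>\<phi> m D - F' m D\<bar> \<le> (a + b * (data_norm n D + e m * sqrt n)) * (e m * sqrt n)"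
     "\<And>m. ln (\<integral>D. exp (l * \<phi> m D) \<partial>data_law n) \<le> l * (\<integral>D. \<phi> m D \<partial>data_law n)
       + c * ((a + b * (e m * sqrt n))\<^sup>2 + b\<^sup>2 * (n * second_moment \<mu>)) * l\<^sup>2 / (1 - 2 * (c * b) * l)"
    by metis
  have m\<phi>[measurable]: "\<phi> m \<in> borel_measurable (data_law n)" for m
    by (rule continuous_measurable_data[OF \<phi>(1)])
  have lim: "(\<lambda>m. \<phi> m D) \<longlonglongrightarrow> F D" for D
  proof -
    have "(\<lambda>m. (a + b * (data_norm n D + e m * sqrt n)) * (e m * sqrt n)) \<longlonglongrightarrow>
        (a + b * (data_norm n D + 0 * sqrt n)) * (0 * sqrt n)"
      by (intro tendsto_intros e0)
    then have "(\<lambda>m. (a + b * (data_norm n D + e m * sqrt n)) * (e m * sqrt n)) \<longlonglongrightarrow> 0" by simp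
    then have 1: "(\<lambda>m. \<phi> m D - F' m D) \<longlonglongrightarrow> 0"
      by (rule Lim_null_comparison[OF always_eventually, rotated]) (simp add: \<phi>(3))
    have "\<forall>\<^sub>F m in sequentially. F' m D = F D"
    proof -
      obtain m0 :: nat where m0: "\<bar>F D\<bar> \<le> real m0" using real_arch_simple by blast
      show ?thesis
        using eventually_ge_at_top[of m0] by eventually_elim (use m0 in \<open>auto simp: F'_def R_def\<close>)
    qed
    then have "(\<lambda>m. F' m D) \<longlonglongrightarrow> F D" by (rule tendsto_eventually)
    from tendsto_add[OF 1 this] show ?thesis by simp
  qed
  have iF: "integrable (data_law n) F" by (rule data_lip_integrable[OF F ab])
  \<comment> \<open>Dominates all approximations: the mollification error increases with the scale,
    and the scales are at most 1.\<close>
  define K where "K D = \<bar>F D\<bar> + (a + b * (data_norm n D + sqrt n)) * sqrt n" for D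
  have K: "integrable (data_law n) K"
    unfolding K_def using iF data_norm_integrable[of n] by auto
  have elim: "(\<lambda>m. \<integral>D. \<phi> m D \<partial>data_law n) \<longlonglongrightarrow> (\<integral>D. F D \<partial>data_law n)"
  proof (rule integral_dominated_convergence[where w=K])
    show "AE D in data_law n. norm (\<phi> m D) \<le> K D" for m
    proof (rule AE_I2)
      fix D :: "nat \<Rightarrow> 'z"
      have "e m * sqrt n \<le> 1 * sqrt n" using e[of m] by (intro mult_right_mono) auto
      then have "(a + b * (data_norm n D + e m * sqrt n)) * (e m * sqrt n) \<le> (a + b * (data_norm n D + sqrt n)) * sqrt n"
        using ab e(1)[of m] by (intro mult_mono add_left_mono mult_left_mono add_nonneg_nonneg mult_nonneg_nonneg) auto
      then show "norm (\<phi> m D) \<le> K D" using \<phi>(3)[of m D] F'(3)[of m D] unfolding K_def real_norm_def by linarith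
    qed
  qed (use iF K lim in auto)
  define k where "k m = exp (l * (\<integral>D. \<phi> m D \<partial>data_law n)
       + c * ((a + b * (e m * sqrt n))\<^sup>2 + b\<^sup>2 * (n * second_moment \<mu>)) * l\<^sup>2 / (1 - 2 * (c * b) * l))" for m
  have "k \<longlonglongrightarrow> exp (l * (\<integral>D. F D \<partial>data_law n)
       + c * ((a + b * (0 * sqrt n))\<^sup>2 + b\<^sup>2 * (n * second_moment \<mu>)) * l\<^sup>2 / (1 - 2 * (c * b) * l))"
    unfolding k_def using l by (intro tendsto_intros e0 elim) auto
  then have klim: "k \<longlonglongrightarrow> exp (l * (\<integral>D. F D \<partial>data_law n)
       + c * (a\<^sup>2 + b\<^sup>2 * (n * second_moment \<mu>)) * l\<^sup>2 / (1 - 2 * (c * b) * l))" by simp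
  have ie: "integrable (data_law n) (\<lambda>D. exp (l * \<phi> m D))" for m
    by (rule N.bounded_exp_integrable[OF m\<phi> \<phi>(2)])
  have kb: "(\<integral>D. exp (l * \<phi> m D) \<partial>data_law n) \<le> k m" for m
  proof -
    have "0 < (\<integral>D. exp (l * \<phi> m D) \<partial>data_law n)" by (rule N.mgf_pos[OF m\<phi> \<phi>(2)])
    then have "(\<integral>D. exp (l * \<phi> m D) \<partial>data_law n) = exp (ln (\<integral>D. exp (l * \<phi> m D) \<partial>data_law n))" by simp
    also have "\<dots> \<le> k m" unfolding k_def using \<phi>(4)[of m] by simp
    finally show ?thesis .
  qed
  have el: "(\<lambda>m. exp (l * \<phi> m D)) \<longlonglongrightarrow> exp (l * F D)" for D
    by (intro tendsto_intros lim)
  show "integrable (data_law n) (\<lambda>D. exp (l * F D))"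
    "(\<integral>D. exp (l * F D) \<partial>data_law n) \<le> exp (l * (\<integral>D. F D \<partial>data_law n)
      + c * (a\<^sup>2 + b\<^sup>2 * (n * second_moment \<mu>)) * l\<^sup>2 / (1 - 2 * (c * b) * l))"
    by (rule N.fatou_tendsto[OF ie exp_ge_zero el kb klim])+
qed

lemma data_lip_chernoff:
  assumes F: "data_lip n a b F" and ab: "0 \<le> a" "0 \<le> b"
    and l: "0 < l" "2 * (c * b) * l < 1"
  shows "measure (data_law n) {D \<in> space (data_law n). F D - (\<integral>D. F D \<partial>data_law n) > t}
    \<le> exp (c * (a\<^sup>2 + b\<^sup>2 * (n * second_moment \<mu>)) * l\<^sup>2 / (1 - 2 * (c * b) * l) - l * t)"
proof -
  interpret N: prob_space "data_law n" by (rule prob_space_data)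
  let ?m = "\<integral>D. F D \<partial>data_law n" and ?V = "c * (a\<^sup>2 + b\<^sup>2 * (n * second_moment \<mu>)) * l\<^sup>2 / (1 - 2 * (c * b) * l)"
  have [measurable]: "F \<in> borel_measurable (data_law n)"
    by (rule continuous_measurable_data[OF data_lip_continuous[OF F]])
  note mgf = data_lip_mgf_bound[OF F ab l]
  have "measure (data_law n) {D \<in> space (data_law n). F D - ?m > t}
      \<le> measure (data_law n) {D \<in> space (data_law n). F D \<ge> ?m + t}"
    by (intro N.finite_measure_mono) auto
  also have "\<dots> \<le> exp (- l * (?m + t)) * (\<integral>D\<in>space (data_law n). exp (l * F D) \<partial>data_law n)"
    using mgf(1) by (intro N.Chernoff_ineq_ge l) (auto simp: set_integrable_def cong: Bochner_Integration.integrable_cong)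
  also have "(\<integral>D\<in>space (data_law n). exp (l * F D) \<partial>data_law n) = (\<integral>D. exp (l * F D) \<partial>data_law n)"
    by (rule set_integral_space[OF mgf(1)])
  also have "exp (- l * (?m + t)) * (\<integral>D. exp (l * F D) \<partial>data_law n) \<le> exp (- l * (?m + t)) * exp (l * ?m + ?V)"
    by (intro mult_left_mono mgf(2)) auto
  also have "\<dots> = exp (?V - l * t)" unfolding exp_add[symmetric] by (simp add: algebra_simps)
  finally show ?thesis .
qed

text \<open>The Chernoff exponent \<open>c v l^2 / (1 - 2 c b l) - l t\<close> is evaluated at two
  values of \<open>l\<close>. For \<open>t b \<le> V\<close> the choice \<open>t / (4 c V)\<close>
  keeps the denominator at least 1/2 and leaves at most \<open>- t^2 / (8 c V)\<close>; otherwise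
  \<open>1 / (4 c b)\<close> makes the denominator 1/2 and leaves at most
  \<open>- t / (8 c b)\<close>. The real \<open>k\<close> may exceed \<open>n\<close>: a
  leave-one-out loss has one point fewer than the factor in \<open>theta1\<close>.\<close>

lemma data_lip_tail:
  assumes F: "data_lip n a b F" and ab: "0 \<le> a" "0 \<le> b" and t: "0 < t" and k: "real n \<le> k"
  shows "measure (data_law n) {D \<in> space (data_law n). F D - (\<integral>D. F D \<partial>data_law n) > t}
    \<le> max (exp_frac (t\<^sup>2) (8 * c * (a\<^sup>2 + b\<^sup>2 * k * (second_moment \<mu> + 16 * c)))) (exp_frac t (8 * c * b))"
    (is "?p \<le> _")
proof -
  define V where "V = a\<^sup>2 + b\<^sup>2 * k * (second_moment \<mu> + 16 * c)"
  interpret N: prob_space "data_law n" by (rule prob_space_data)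
  define v where "v = a\<^sup>2 + b\<^sup>2 * (n * second_moment \<mu>)"
  have M0: "0 \<le> second_moment \<mu>" unfolding second_moment_def by (rule Bochner_Integration.integral_nonneg) auto
  have k0: "0 \<le> k" using k by (rule order_trans[rotated]) simp
  have "real n * second_moment \<mu> \<le> k * (second_moment \<mu> + 16 * c)"
    using k M0 k0 c_nonneg by (intro mult_mono) auto
  then have vV: "v \<le> V"
    unfolding v_def V_def mult.assoc[of "b\<^sup>2"] by (intro add_left_mono mult_left_mono) auto
  have v0: "0 \<le> v" unfolding v_def using M0 by auto
  have ch: "?p \<le> exp (c * v * l\<^sup>2 / (1 - 2 * (c * b) * l) - l * t)" if "0 < l" "2 * (c * b) * l < 1" for l
    unfolding v_def by (rule data_lip_chernoff[OF F ab that])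
  have ge0: "0 \<le> exp_frac x y" for x y by (simp add: exp_frac_def)
  show ?thesis
    unfolding V_def[symmetric]
  \<comment> \<open>In the first case the exponent is \<open>- l * t\<close> for every positive
    \<open>l\<close>, so the probability is zero, in agreement with \<open>exp_frac\<close> at a
    vanishing denominator.\<close>
  proof (cases "c * b = 0 \<and> c * v = 0")
    case True
    have "?p \<le> exp (- real m)" for m :: nat
    proof (cases "m = 0")
      case False
      then have "0 < real m / t" using t by simp
      from ch[OF this] True t show ?thesis by (simp add: mult.assoc)
    qed simp
    moreover have "(\<lambda>m. exp (- real m)) \<longlonglongrightarrow> 0" by real_asymp
    ultimately have "?p \<le> 0" by (intro LIMSEQ_le_const) auto
    then show "?p \<le> max (exp_frac (t\<^sup>2) (8 * c * V)) (exp_frac t (8 * c * b))" using ge0 by (auto simp: max_def intro: order_trans)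
  next
    case False
    then have c: "0 < c" using c_nonneg by (cases "c = 0") auto
    have V0: "0 \<le> V" using v0 vV by linarith
    show "?p \<le> max (exp_frac (t\<^sup>2) (8 * c * V)) (exp_frac t (8 * c * b))"
    proof (cases "t * b \<le> V")
      case True
      have V: "0 < V"
      proof (cases "b = 0")
        case True
        then have "0 < v" using False v0 by auto
        then show ?thesis using vV by linarith
      next
        case False
        then have "0 < t * b" using t ab by simp
        then show ?thesis using \<open>t * b \<le> V\<close> by linarith
      qed
      define l where "l = t / (4 * c * V)"
      have l: "0 < l" using t c V by (simp add: l_def)
      have cbl: "4 * (c * b) * l \<le> 1"
        using True c V by (simp add: l_def field_simps)
      have "c * v * l\<^sup>2 / (1 - 2 * (c * b) * l) \<le> 2 * (c * V * l\<^sup>2)"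
      proof -
        have "c * v * l\<^sup>2 \<le> c * V * l\<^sup>2" using vV c by (intro mult_right_mono mult_left_mono) auto
        also have "\<dots> \<le> 2 * (c * V * l\<^sup>2) * (1 - 2 * (c * b) * l)"
          using mult_right_mono[of "1/2" "1 - 2 * (c * b) * l" "2 * (c * V * l\<^sup>2)"] cbl c V by (simp add: mult.commute)
        finally show ?thesis using cbl by (simp add: pos_divide_le_eq)
      qed
      then have "?p \<le> exp (2 * (c * V * l\<^sup>2) - l * t)"
        using ch[OF l] cbl by (auto intro: order_trans)
      also have "2 * (c * V * l\<^sup>2) - l * t = - (t\<^sup>2 / (8 * c * V))"
        using c V by (simp add: l_def power2_eq_square field_simps)
      finally show ?thesis using c V by (simp add: exp_frac_def le_max_iff_disj)
    next
      case False
      then have tb: "V < t * b" by simp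
      then have "0 < t * b" using V0 by linarith
      then have b: "0 < b" using t by (simp add: zero_less_mult_iff)
      define l where "l = 1 / (4 * c * b)"
      have l: "0 < l" "2 * (c * b) * l = 1 / 2" using c b by (auto simp: l_def)
      have "c * v * l\<^sup>2 / (1 - 2 * (c * b) * l) = 2 * (c * v * l\<^sup>2)" unfolding l(2) by simp
      also have "\<dots> \<le> 2 * (c * (t * b) * l\<^sup>2)" using vV tb c by (intro mult_left_mono mult_right_mono) auto
      also have "\<dots> = l * t / 2" using c b by (simp add: l_def power2_eq_square field_simps)
      finally have "?p \<le> exp (- (l * t / 2))"
        using ch[OF l(1)] l(2) by (auto intro: order_trans)
      also have "- (l * t / 2) = - (t / (8 * c * b))" by (simp add: l_def)
      finally show ?thesis using c b by (simp add: exp_frac_def le_max_iff_disj)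
    qed
  qed
qed

end

section \<open>The hypotheses of the theorem\<close>

text \<open>A C1 function in \<open>C1_L2\<close> is its own approximating sequence, so it lies in
  \<open>W12\<close> together with its gradient and is tested by the supremum.\<close>

lemma log_sobolev_space_of_finite:
  fixes \<mu> :: "'z::euclidean_space measure"
  assumes \<mu>: "prob_space \<mu>" "sets \<mu> = sets borel" and fin: "log_sobolev \<mu> < \<infinity>"
  shows "log_sobolev_space \<mu> (enn2real (log_sobolev \<mu>))"
proof -
  interpret prob_space \<mu> by fact
  define c where "c = enn2real (log_sobolev \<mu>)"
  have c: "log_sobolev \<mu> = ennreal c" "0 \<le> c" using fin by (auto simp: c_def)
  show ?thesis
    unfolding c_def[symmetric]
  proof (unfold_locales, rule \<mu>(2), rule c(2))
    fix \<phi> :: "'z \<Rightarrow> real" and \<Phi>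
    assume C: "(\<phi>, \<Phi>) \<in> C1_L2 \<mu>" and i: "integrable \<mu> (\<lambda>z. (\<phi> z)\<^sup>2 * ln ((\<phi> z)\<^sup>2))"
    define I where "I = (\<integral>z. (norm (\<Phi> z))\<^sup>2 \<partial>\<mu>)"
    define r where "r = real_ent \<mu> (\<lambda>z. (\<phi> z)\<^sup>2)"
    have d: "\<And>z. GDERIV \<phi> z :> \<Phi> z" and cont: "continuous_on UNIV \<Phi>"
      and i1: "integrable \<mu> (\<lambda>z. (\<phi> z)\<^sup>2)" and i2: "integrable \<mu> (\<lambda>z. (norm (\<Phi> z))\<^sup>2)"
      using C by (auto simp: C1_L2_def)
    have "\<phi> \<in> borel_measurable \<mu>" "\<Phi> \<in> borel_measurable \<mu>"
      using borel_measurable_continuous_onI[OF gderiv_continuous_on[OF d]] borel_measurable_continuous_onI[OF cont]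
      by (simp_all add: measurable_cong_sets[OF \<mu>(2) refl])
    then have "(\<phi>, \<Phi>) \<in> W12 \<mu>"
      using i1 i2 C unfolding W12_def by (auto intro!: exI[of _ "\<lambda>_. \<phi>"] exI[of _ "\<lambda>_. \<Phi>"])
    then have "(case (\<phi>, \<Phi>) of (f, G) \<Rightarrow> (1 / 2) * (ent \<mu> (\<lambda>z. (f z)\<^sup>2) / (\<integral>\<^sup>+z. ennreal ((norm (G z))\<^sup>2) \<partial>\<mu>)))
        \<le> log_sobolev \<mu>"
      unfolding log_sobolev_def by (rule SUP_upper)
    moreover have "(\<integral>\<^sup>+z. ennreal ((norm (\<Phi> z))\<^sup>2) \<partial>\<mu>) = ennreal I"
      unfolding I_def using i2 by (intro nn_integral_eq_integral) auto
    moreover have "ent \<mu> (\<lambda>z. (\<phi> z)\<^sup>2) = ennreal r"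
      unfolding ent_def r_def real_ent_def using i by simp
    ultimately have le: "(1 / 2) * (ennreal r / ennreal I) \<le> ennreal c" by (simp add: c)
    have I0: "0 \<le> I" unfolding I_def by (rule Bochner_Integration.integral_nonneg) auto
    have "r \<le> 2 * c * I"
    \<comment> \<open>\<open>ennreal\<close> maps negative reals to 0, so the supremum carries
      information about positive \<open>r\<close> only.\<close>
    proof (cases "0 < r")
      case True
      have half: "(1 / 2 :: ennreal) = ennreal (1 / 2)"
        by (metis divide_ennreal ennreal_1 ennreal_numeral zero_le_one zero_le_numeral zero_less_numeral)
      show ?thesis
      \<comment> \<open>Positive entropy over a vanishing gradient would make the supremum infinite,
        against its finiteness.\<close>
      proof (cases "I = 0")
        case True
        then show ?thesis using le \<open>0 < r\<close>
          by (simp add: half ennreal_divide_zero ennreal_mult_top ennreal_top_mult top_unique)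
      next
        case False
        then have I: "0 < I" using I0 by simp
        then have "(1 / 2) * (ennreal r / ennreal I) = ennreal (1 / 2 * (r / I))"
          unfolding half divide_ennreal[OF less_imp_le[OF True] I]
          using I True by (intro ennreal_mult[symmetric]) auto
        then have "1 / 2 * (r / I) \<le> c" using le c(2) by simp
        then show ?thesis using I by (simp add: field_simps)
      qed
    next
      case False
      then show ?thesis using c I0 mult_nonneg_nonneg[of "2 * c" I] by linarith
    qed
    then show "real_ent \<mu> (\<lambda>z. (\<phi> z)\<^sup>2) \<le> 2 * c * (\<integral>z. (norm (\<Phi> z))\<^sup>2 \<partial>\<mu>)" by (simp add: r_def I_def)
  qed
qed

section \<open>From gradient bounds and growth conditions to bounds on increments\<close>

lemma abs_data_inner_le: "\<bar>\<Sum>i<n. G i \<bullet> H i\<bar> \<le> data_norm n G * data_norm n H"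
proof -
  have "\<bar>\<Sum>i<n. G i \<bullet> H i\<bar> \<le> (\<Sum>i<n. \<bar>norm (G i)\<bar> * \<bar>norm (H i)\<bar>)"
    by (rule order_trans[OF sum_abs]) (auto intro!: sum_mono Cauchy_Schwarz_ineq2)
  also have "\<dots> \<le> data_norm n G * data_norm n H"
    unfolding data_norm_def by (rule L2_set_mult_ineq)
  finally show ?thesis .
qed

text \<open>Mean value theorem along the segment from \<open>D'\<close> to \<open>D\<close>, on
  which the data norm is at most the larger end value by convexity. The restriction turns arbitrary
  functions into datasets, the only points at which a gradient is given.\<close>

lemma gradient_bound_data_lip:
  fixes T :: "('a::euclidean_space, 'b::euclidean_space) statistic"
  assumes gb: "gradient_bound T L n d1 d2" and d: "0 \<le> d1 z" "0 \<le> d2 z"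
  shows "data_lip n (d1 z) (d2 z) (\<lambda>D. loss T L n (restrict D {..<n}) z)"
  unfolding data_lip_def
proof (intro allI)
  fix D D' :: "nat \<Rightarrow> 'a \<times> 'b"
  let ?F = "\<lambda>D. loss T L n D z"
  define h where "h i = D i - D' i" for i
  define p where "p s = (\<lambda>i\<in>{..<n}. D' i + s *\<^sub>R h i)" for s :: real
  have p: "p s \<in> {..<n} \<rightarrow>\<^sub>E UNIV" for s by (simp add: p_def)
  have "\<forall>s. \<exists>G. has_data_gradient n ?F (p s) G \<and> data_norm n G \<le> d1 z + d2 z * data_norm n (p s)"
    using gb p unfolding gradient_bound_def by blast
  then obtain G where G: "\<And>s. has_data_gradient n ?F (p s) (G s)"
    "\<And>s. data_norm n (G s) \<le> d1 z + d2 z * data_norm n (p s)"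
    unfolding choice_iff by blast
  define A where "A s = (\<Sum>i<n. G s i \<bullet> h i)" for s
  have pd: "(\<Sum>i<n. g i \<bullet> (p (s + k) i - p s i)) = k * (\<Sum>i<n. g i \<bullet> h i)"
    "data_norm n (\<lambda>i. p (s + k) i - p s i) = \<bar>k\<bar> * data_norm n h" for g s k
  proof -
    have e: "p (s + k) i - p s i = k *\<^sub>R h i" if "i < n" for i
      using that by (simp add: p_def scaleR_add_left)
    then show "(\<Sum>i<n. g i \<bullet> (p (s + k) i - p s i)) = k * (\<Sum>i<n. g i \<bullet> h i)"
      by (simp add: sum_distrib_left)
    have "data_norm n (\<lambda>i. p (s + k) i - p s i) = data_norm n (\<lambda>i. k *\<^sub>R h i)"
      by (rule data_norm_cong) (rule e)
    then show "data_norm n (\<lambda>i. p (s + k) i - p s i) = \<bar>k\<bar> * data_norm n h" by (simp add: data_norm_scaleR)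
  qed
  have der: "DERIV (\<lambda>s. ?F (p s)) s :> A s" for s
    unfolding DERIV_def LIM_eq
  proof (intro allI impI)
    fix r :: real assume r: "0 < r"
    \<comment> \<open>The added 1 permits division when the segment is degenerate and gives the
      strict inequality that the limit asks for.\<close>
    define N where "N = data_norm n h + 1"
    have N: "0 < N" "data_norm n h < N" by (auto simp: N_def add_nonneg_pos)
    obtain d where d: "0 < d" "\<And>D'. D' \<in> {..<n} \<rightarrow>\<^sub>E UNIV \<Longrightarrow> data_norm n (\<lambda>i. D' i - p s i) < d \<Longrightarrow>
        \<bar>?F D' - ?F (p s) - (\<Sum>i<n. G s i \<bullet> (D' i - p s i))\<bar> \<le> (r / N) * data_norm n (\<lambda>i. D' i - p s i)"
      using G(1)[of s, unfolded has_data_gradient_def, rule_format, OF divide_pos_pos[OF r N(1)]] by blast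
    show "\<exists>t>0. \<forall>k. k \<noteq> 0 \<and> norm (k - 0) < t \<longrightarrow> norm ((?F (p (s + k)) - ?F (p s)) / k - A s) < r"
    proof (intro exI[of _ "d / N"] conjI allI impI)
      fix k :: real assume k: "k \<noteq> 0 \<and> norm (k - 0) < d / N"
      then have kN: "\<bar>k\<bar> * N < d" using N by (simp add: field_simps)
      have "\<bar>k\<bar> * data_norm n h \<le> \<bar>k\<bar> * N" using N by (intro mult_left_mono) auto
      then have "\<bar>?F (p (s + k)) - ?F (p s) - k * A s\<bar> \<le> (r / N) * (\<bar>k\<bar> * data_norm n h)"
        using d(2)[OF p, of "s + k"] kN unfolding pd A_def by simp
      also have "\<dots> < (r / N) * (\<bar>k\<bar> * N)" using r N k by (intro mult_strict_left_mono) auto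
      finally have "\<bar>?F (p (s + k)) - ?F (p s) - k * A s\<bar> < r * \<bar>k\<bar>" using N by simp
      then have "\<bar>?F (p (s + k)) - ?F (p s) - k * A s\<bar> / \<bar>k\<bar> < r" using k by (simp add: pos_divide_less_eq)
      moreover have "\<bar>?F (p (s + k)) - ?F (p s) - k * A s\<bar> / \<bar>k\<bar> = \<bar>(?F (p (s + k)) - ?F (p s)) / k - A s\<bar>"
        using k by (simp add: abs_divide[symmetric] diff_divide_distrib)
      ultimately show "norm ((?F (p (s + k)) - ?F (p s)) / k - A s) < r" by simp
    qed (use d N in auto)
  qed
  obtain s where s: "0 < s" "s < 1" "?F (p 1) - ?F (p 0) = (1 - 0) * A s"
    using MVT2[of 0 1 "\<lambda>s. ?F (p s)" A] der by auto
  have "data_norm n (p s) = data_norm n (\<lambda>i. (1 - s) *\<^sub>R D' i + s *\<^sub>R D i)"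
    by (rule data_norm_cong) (simp add: p_def h_def algebra_simps)
  also have "\<dots> \<le> (1 - s) * data_norm n D' + s * data_norm n D"
    using data_norm_triangle[of n "\<lambda>i. (1 - s) *\<^sub>R D' i" "\<lambda>i. s *\<^sub>R D i"] s by (simp add: data_norm_scaleR)
  also have "\<dots> \<le> (1 - s) * max (data_norm n D) (data_norm n D') + s * max (data_norm n D) (data_norm n D')"
    using s by (intro add_mono mult_left_mono) auto
  finally have ps: "data_norm n (p s) \<le> max (data_norm n D) (data_norm n D')" by (simp add: algebra_simps)
  have e: "restrict D {..<n} = p 1" "restrict D' {..<n} = p 0" by (auto simp: p_def h_def fun_eq_iff)
  have "\<bar>?F (p 1) - ?F (p 0)\<bar> = \<bar>A s\<bar>" using s(3) by simp
  also have "\<dots> \<le> data_norm n (G s) * data_norm n h" unfolding A_def by (rule abs_data_inner_le)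
  also have "\<dots> \<le> (d1 z + d2 z * max (data_norm n D) (data_norm n D')) * data_norm n h"
    using G(2)[of s] ps d by (intro mult_right_mono order_trans[OF G(2)] add_left_mono mult_left_mono) auto
  finally show "\<bar>?F (restrict D {..<n}) - ?F (restrict D' {..<n})\<bar>
      \<le> (d1 z + d2 z * max (data_norm n D) (data_norm n D')) * data_norm n (\<lambda>i. D i - D' i)"
    unfolding e h_def .
qed

text \<open>A Lipschitz constant valid under the respective growth condition. The absolute values
  are there because the parameters carry no sign condition.\<close>

fun growth_lip :: "growth \<Rightarrow> real" where
  "growth_lip (Linear K) = \<bar>K\<bar>"
| "growth_lip (Quadratic cl cq) = \<bar>cl\<bar>"

text \<open>Quadratic growth holds at all scales, so subdividing a segment removes the quadratic term.\<close>

lemma has_growth_lipschitz: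
  fixes g :: "'z::euclidean_space \<Rightarrow> real"
  assumes "has_growth \<gamma> g"
  shows "\<bar>g x - g y\<bar> \<le> growth_lip \<gamma> * norm (x - y)"
proof (cases \<gamma>)
  case (Linear K)
  then have "\<forall>z. \<exists>G. (GDERIV g z :> G) \<and> norm G \<le> K" using assms by simp
  then obtain G where G: "\<And>z. GDERIV g z :> G z" "\<And>z. norm (G z) \<le> K" by metis
  have "norm (g x - g y) \<le> K * norm (x - y)"
  proof (rule differentiable_bound[of UNIV g "\<lambda>z h. h \<bullet> G z"])
    fix z :: 'z
    show "(g has_derivative (\<lambda>h. h \<bullet> G z)) (at z within UNIV)" using G(1)[of z] by (simp add: gderiv_def)
    show "onorm (\<lambda>h. h \<bullet> G z) \<le> K"
    proof (rule onorm_le)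
      fix h show "norm (h \<bullet> G z) \<le> K * norm h"
        using Cauchy_Schwarz_ineq2[of h "G z"] mult_right_mono[OF G(2)[of z], of "norm h"]
        by (simp add: mult.commute)
    qed
  qed auto
  also have "\<dots> \<le> \<bar>K\<bar> * norm (x - y)" by (intro mult_right_mono) auto
  finally show ?thesis using Linear by simp
next
  case (Quadratic cl cq)
  define r where "r = norm (x - y)"
  have q: "\<bar>g z1 - g z2\<bar> \<le> cl * norm (z1 - z2) + cq * (norm (z1 - z2))\<^sup>2" for z1 z2
    using assms Quadratic by simp
  have le: "\<bar>g x - g y\<bar> \<le> cl * r + cq * r\<^sup>2 * (1 / real (Suc N))" for N
  proof -
    define p where "p j = y + (real j / real (Suc N)) *\<^sub>R (x - y)" for j :: nat
    have st: "norm (p (Suc j) - p j) = r / real (Suc N)" for j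
    proof -
      have "p (Suc j) - p j = (1 / real (Suc N)) *\<^sub>R (x - y)"
        by (simp add: p_def scaleR_diff_left[symmetric] diff_divide_distrib[symmetric])
      then show ?thesis by (simp add: r_def)
    qed
    have "g x - g y = (\<Sum>j<Suc N. g (p (Suc j)) - g (p j))"
      by (subst sum_lessThan_telescope) (simp add: p_def)
    also have "\<bar>\<dots>\<bar> \<le> (\<Sum>j<Suc N. cl * (r / real (Suc N)) + cq * (r / real (Suc N))\<^sup>2)"
    proof (rule order_trans[OF sum_abs], rule sum_mono)
      fix j show "\<bar>g (p (Suc j)) - g (p j)\<bar> \<le> cl * (r / real (Suc N)) + cq * (r / real (Suc N))\<^sup>2"
        using q[of "p (Suc j)" "p j"] unfolding st .
    qed
    also have "\<dots> = real (Suc N) * (cl * (r / real (Suc N)) + cq * (r / real (Suc N))\<^sup>2)" by simp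
    also have "\<dots> = cl * r + cq * r\<^sup>2 * (1 / real (Suc N))"
      by (simp add: distrib_left power2_eq_square del: of_nat_Suc)
    finally show ?thesis .
  qed
  have "(\<lambda>N. cl * r + cq * r\<^sup>2 * (1 / real (Suc N))) \<longlonglongrightarrow> cl * r + cq * r\<^sup>2 * 0"
    using LIMSEQ_inverse_real_of_nat by (intro tendsto_intros) (simp add: inverse_eq_divide)
  then have "\<bar>g x - g y\<bar> \<le> cl * r + cq * r\<^sup>2 * 0"
    by (rule LIMSEQ_le_const) (use le in auto)
  also have "\<dots> \<le> \<bar>cl\<bar> * r" by (simp add: r_def mult_right_mono)
  finally show ?thesis using Quadratic by (simp add: r_def)
qed

text \<open>Cauchy-Schwarz over the \<open>n\<close> summands costs \<open>sqrt n\<close> against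
  the division by \<open>n\<close>; the resulting \<open>K / sqrt n\<close> produces the factor
  \<open>n\<close> in the exponent of \<open>theta2\<close>. The sign fits deviations of the
  empirical mean below its expectation.\<close>

lemma data_lip_mean:
  assumes g: "\<And>x y. \<bar>g x - g y\<bar> \<le> K * norm (x - y)" and K: "0 \<le> K"
  shows "data_lip n (K / sqrt n) 0 (\<lambda>D. - ((\<Sum>i<n. g (D i)) / n))"
  unfolding data_lip_def
proof (intro allI)
  fix D D' :: "nat \<Rightarrow> 'a"
  have "\<bar>(\<Sum>i<n. g (D' i)) - (\<Sum>i<n. g (D i))\<bar> \<le> (\<Sum>i<n. \<bar>g (D' i) - g (D i)\<bar>)"
    unfolding sum_subtractf[symmetric] by (rule sum_abs)
  also have "\<dots> \<le> (\<Sum>i<n. \<bar>K\<bar> * \<bar>norm (D i - D' i)\<bar>)"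
    using g K by (intro sum_mono) (simp add: norm_minus_commute)
  also have "\<dots> \<le> L2_set (\<lambda>_. K) {..<n} * data_norm n (\<lambda>i. D i - D' i)"
    unfolding data_norm_def by (rule L2_set_mult_ineq)
  also have "L2_set (\<lambda>_. K) {..<n} = K * sqrt n" using K by (simp add: L2_set_def real_sqrt_mult)
  finally have "\<bar>(\<Sum>i<n. g (D' i)) - (\<Sum>i<n. g (D i))\<bar> / n \<le> K * sqrt n * data_norm n (\<lambda>i. D i - D' i) / n"
    by (rule divide_right_mono) simp
  also have "\<dots> = K / sqrt n * data_norm n (\<lambda>i. D i - D' i)"
  proof -
    have "K * sqrt n * data_norm n (\<lambda>i. D i - D' i) / n = K * (sqrt n / n) * data_norm n (\<lambda>i. D i - D' i)" by simp
    also have "sqrt n / n = inverse (sqrt n)" by (rule sqrt_divide_self_eq) simp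
    finally show ?thesis by (simp add: divide_inverse)
  qed
  finally show "\<bar>- ((\<Sum>i<n. g (D i)) / n) - - ((\<Sum>i<n. g (D' i)) / n)\<bar>
      \<le> (K / sqrt n + 0 * max (data_norm n D) (data_norm n D')) * data_norm n (\<lambda>i. D i - D' i)"
    by (simp add: abs_divide diff_divide_distrib[symmetric])
qed

section \<open>Splitting off one observation\<close>

text \<open>Puts a left-out observation back at position \<open>i\<close>, reversing
  \<open>leave_out\<close>, so that a dataset can be generated from an observation and the remaining
  data.\<close>

definition insert_obs :: "nat \<Rightarrow> nat \<Rightarrow> (nat \<Rightarrow> 'z) \<Rightarrow> 'z \<Rightarrow> nat \<Rightarrow> 'z" where
  "insert_obs m i D z = (\<lambda>j\<in>{..<Suc m}. if j < i then D j else if j = i then z else D (j - 1))"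

lemma leave_out_insert_obs:
  assumes "D \<in> {..<m} \<rightarrow>\<^sub>E UNIV" "i \<le> m"
  shows "leave_out (Suc m) i (insert_obs m i D z) = D" "insert_obs m i D z i = z"
proof
  fix j
  show "leave_out (Suc m) i (insert_obs m i D z) j = D j"
    using assms by (cases "j < m") (auto simp: leave_out_def insert_obs_def PiE_def extensional_def)
  show "insert_obs m i D z i = z" using assms(2) by (simp add: insert_obs_def)
qed

context prob_space
begin

lemma prob_space_power: "prob_space (Pi\<^sub>M I (\<lambda>_. M))"
  by (intro prob_space_PiM prob_space_axioms)

text \<open>Insertion at position \<open>i\<close> is appending at the end followed by a permutation
  of the coordinates, and a product of equal laws is invariant under the latter.\<close>

lemma distr_insert_obs:
  assumes i: "i \<le> m"
  shows "(\<lambda>(z, D). insert_obs m i D z) \<in> measurable (M \<Otimes>\<^sub>M Pi\<^sub>M {..<m} (\<lambda>_. M)) (Pi\<^sub>M {..<Suc m} (\<lambda>_. M))"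
    and "distr (M \<Otimes>\<^sub>M Pi\<^sub>M {..<m} (\<lambda>_. M)) (Pi\<^sub>M {..<Suc m} (\<lambda>_. M)) (\<lambda>(z, D). insert_obs m i D z) = Pi\<^sub>M {..<Suc m} (\<lambda>_. M)"
proof -
  let ?P = "Pi\<^sub>M {..<m} (\<lambda>_. M)" and ?Q = "Pi\<^sub>M {..<Suc m} (\<lambda>_. M)"
  \<comment> \<open>\<open>f j\<close> is the coordinate from which position \<open>j\<close> is
    read when the new observation is stored last, at index \<open>m\<close>.\<close>
  define f where "f j = (if j < i then j else if j = i then m else j - 1)" for j
  define r where "r \<omega> = (\<lambda>j\<in>{..<Suc m}. \<omega> (f j))" for \<omega> :: "nat \<Rightarrow> 'a"
  define u where "u = (\<lambda>(z :: 'a, D :: nat \<Rightarrow> 'a). D(m := z))"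
  have ins: "insert m {..<m} = {..<Suc m}" by auto
  have f: "inj_on f {..<Suc m}" "f \<in> {..<Suc m} \<rightarrow> {..<Suc m}"
    using i by (auto simp: f_def inj_on_def split: if_splits)
  have e: "(\<lambda>(z, D). insert_obs m i D z) = r \<circ> u"
    using i by (auto simp: fun_eq_iff insert_obs_def r_def u_def f_def)
  have mu: "u \<in> measurable (M \<Otimes>\<^sub>M ?P) ?Q"
    unfolding u_def case_prod_beta' ins[symmetric] by (intro measurable_fun_upd[where J="{..<m}"] measurable_snd) auto
  have mr: "r \<in> measurable ?Q ?Q"
    unfolding r_def[abs_def] using f(2) by (intro measurable_restrict measurable_component_singleton) auto
  show "(\<lambda>(z, D). insert_obs m i D z) \<in> measurable (M \<Otimes>\<^sub>M ?P) ?Q"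
    unfolding e by (rule measurable_comp[OF mu mr])
  have "distr (M \<Otimes>\<^sub>M ?P) ?Q (r \<circ> u) = distr (distr (M \<Otimes>\<^sub>M ?P) ?Q u) ?Q r"
    by (rule distr_distr[OF mr mu, symmetric])
  also have "distr (M \<Otimes>\<^sub>M ?P) ?Q u = ?Q"
    unfolding u_def using distr_pair_PiM_eq_PiM[of "{..<m}" "\<lambda>_. M" m] prob_space_axioms by (simp add: ins)
  also have "distr ?Q ?Q r = ?Q"
    unfolding r_def[abs_def] using distr_PiM_reindex[OF _ f, of "\<lambda>_. M"] prob_space_axioms by simp
  finally show "distr (M \<Otimes>\<^sub>M ?P) ?Q (\<lambda>(z, D). insert_obs m i D z) = ?Q" unfolding e .
qed

lemma integral_insert_obs:
  fixes h :: "(nat \<Rightarrow> 'a) \<Rightarrow> real"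
  assumes i: "i \<le> m" and h: "integrable (Pi\<^sub>M {..<Suc m} (\<lambda>_. M)) h"
  shows "integrable M (\<lambda>z. \<integral>D. h (insert_obs m i D z) \<partial>Pi\<^sub>M {..<m} (\<lambda>_. M))"
    and "(\<integral>x. h x \<partial>Pi\<^sub>M {..<Suc m} (\<lambda>_. M)) = (\<integral>z. (\<integral>D. h (insert_obs m i D z) \<partial>Pi\<^sub>M {..<m} (\<lambda>_. M)) \<partial>M)"
proof -
  let ?P = "Pi\<^sub>M {..<m} (\<lambda>_. M)" and ?Q = "Pi\<^sub>M {..<Suc m} (\<lambda>_. M)"
  interpret P: prob_space ?P by (rule prob_space_power)
  interpret MP: pair_prob_space M ?P ..
  note d = distr_insert_obs[OF i]
  have ip: "integrable (M \<Otimes>\<^sub>M ?P) (\<lambda>(z, D). h (insert_obs m i D z))"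
    using integrable_distr[OF d(1)] h unfolding d(2) by (simp add: case_prod_beta')
  have e: "(\<integral>x. h x \<partial>?Q) = (\<integral>(z, D). h (insert_obs m i D z) \<partial>(M \<Otimes>\<^sub>M ?P))"
    using integral_distr[OF d(1), of h] h unfolding d(2) by (simp add: case_prod_beta' borel_measurable_integrable)
  show "(\<integral>x. h x \<partial>?Q) = (\<integral>z. (\<integral>D. h (insert_obs m i D z) \<partial>?P) \<partial>M)"
    unfolding e using MP.integral_fst'[OF ip] by simp
  show "integrable M (\<lambda>z. \<integral>D. h (insert_obs m i D z) \<partial>?P)" using MP.integrable_fst'[OF ip] by simp
qed

end

section \<open>The three deviation terms\<close>

lemma data_lip_minus: "data_lip n a b F \<Longrightarrow> data_lip n a b (\<lambda>D. - F D)"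
  unfolding data_lip_def by (simp add: abs_minus_commute)

lemma exp_frac_bounds: "0 \<le> a \<Longrightarrow> 0 \<le> b \<Longrightarrow> exp_frac a b \<le> 1" "0 \<le> exp_frac a b"
  by (auto simp: exp_frac_def)

lemma theta1_nonneg: "0 \<le> theta1 \<mu> c d1 d2 n t z"
  unfolding theta1_def by (rule max.coboundedI1) (rule exp_frac_bounds)

context log_sobolev_space
begin

lemma second_moment_nonneg: "0 \<le> second_moment \<mu>"
  unfolding second_moment_def by (rule Bochner_Integration.integral_nonneg) auto

lemma theta1_integrable:
  assumes [measurable]: "d1 \<in> borel_measurable borel" "d2 \<in> borel_measurable borel"
    and d: "\<And>z. 0 \<le> d2 z" and t: "0 \<le> t"
  shows "integrable \<mu> (theta1 \<mu> c d1 d2 n t)"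
proof (rule integrable_bdd[where B=1])
  show "theta1 \<mu> c d1 d2 n t \<in> borel_measurable \<mu>"
    unfolding theta1_def exp_frac_def by measurable
  show "norm (theta1 \<mu> c d1 d2 n t z) \<le> 1" for z
    using theta1_nonneg[of \<mu> c d1 d2 n t z] d t c_nonneg second_moment_nonneg
    by (auto simp: theta1_def intro!: exp_frac_bounds mult_nonneg_nonneg add_nonneg_nonneg)
qed

text \<open>With \<open>b = 0\<close> only the Gaussian part of \<open>data_lip_tail\<close>
  remains, with denominator \<open>8 c K^2 / n\<close>; hence the \<open>4 c K^2\<close> in the
  constant. The added 1 keeps the constant positive when \<open>c\<close> or \<open>K\<close>
  vanishes. Under quadratic growth this is the first entry of the maximum.\<close>

lemma mean_deviation:
  assumes g: "has_growth \<gamma> g" and n: "0 < n" and t: "0 < t"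
  shows "measure (data_law n) {D \<in> space (data_law n). (\<integral>z. g z \<partial>\<mu>) - (\<Sum>i<n. g (D i)) / n > t}
    \<le> theta2 \<gamma> (4 * c * (growth_lip \<gamma>)\<^sup>2 + 1) n t"
proof -
  interpret N: prob_space "data_law n" by (rule prob_space_data)
  define K where "K = growth_lip \<gamma>"
  have K: "0 \<le> K" unfolding K_def by (cases \<gamma>) auto
  have lip: "\<bar>g x - g y\<bar> \<le> K * norm (x - y)" for x y
    unfolding K_def by (rule has_growth_lipschitz[OF g])
  have lip1: "data_lip 1 K 0 (\<lambda>D. g (D 0))"
    using lip by (auto simp: data_lip_def data_norm_def L2_set_def)
  let ?F = "\<lambda>D. - ((\<Sum>i<n. g (D i)) / n)"
  have F: "data_lip n (K / sqrt n) 0 ?F" by (rule data_lip_mean[OF lip K])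
  have ig: "integrable \<mu> g"
  proof -
    have b: "norm (g z) \<le> norm (\<bar>g 0\<bar> + K * (1 + (norm z)\<^sup>2))" for z
    proof -
      have "norm z \<le> 1 + (norm z)\<^sup>2"
        using zero_le_power2[of "norm z - 1"] zero_le_power2[of "norm z"]
        unfolding power2_diff one_power2 mult_1_right by linarith
      then have "K * norm z \<le> K * (1 + (norm z)\<^sup>2)" using K by (rule mult_left_mono)
      then show ?thesis using lip[of z 0] by simp
    qed
    have i: "integrable \<mu> (\<lambda>z. \<bar>g 0\<bar> + K * (1 + (norm z)\<^sup>2))"
      using second_moment_finite by auto
    have "continuous_on UNIV g"
      by (rule lipschitz_on_continuous_on[of K]) (use lip K in \<open>auto simp: lipschitz_on_def dist_norm\<close>)
    then show ?thesis
      by (intro Bochner_Integration.integrable_bound[OF i] continuous_measurable AE_I2 b)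
  qed
  have comp: "distr (data_law n) \<mu> (\<lambda>D. D i) = \<mu>" if "i < n" for i
    using that by (intro distr_PiM_component) (auto simp: prob_space_axioms)
  have "(\<integral>D. ?F D \<partial>data_law n) = - (\<Sum>i<n. \<integral>D. g (D i) \<partial>data_law n) / n"
  proof -
    have "integrable (data_law n) (\<lambda>D. g (D i))" if "i < n" for i
      using integrable_distr[of "\<lambda>D. D i" "data_law n" \<mu> g] ig comp[OF that] that by simp
    then show ?thesis by simp
  qed
  also have "(\<Sum>i<n. \<integral>D. g (D i) \<partial>data_law n) = (\<Sum>i<n. \<integral>z. g z \<partial>\<mu>)"
  proof (rule sum.cong)
    fix i assume "i \<in> {..<n}"
    then show "(\<integral>D. g (D i) \<partial>data_law n) = (\<integral>z. g z \<partial>\<mu>)"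
      using integral_distr[of "\<lambda>D. D i" "data_law n" \<mu> g] ig comp[of i] by simp
  qed simp
  finally have EF: "(\<integral>D. ?F D \<partial>data_law n) = - (\<integral>z. g z \<partial>\<mu>)" using n by simp
  have "measure (data_law n) {D \<in> space (data_law n). (\<integral>z. g z \<partial>\<mu>) - (\<Sum>i<n. g (D i)) / n > t}
      = measure (data_law n) {D \<in> space (data_law n). ?F D - (\<integral>D. ?F D \<partial>data_law n) > t}"
    unfolding EF by (rule arg_cong[of _ _ "measure (data_law n)"]) auto
  also have "\<dots> \<le> max (exp_frac (t\<^sup>2) (8 * c * ((K / sqrt n)\<^sup>2 + 0\<^sup>2 * real n * (second_moment \<mu> + 16 * c)))) (exp_frac t (8 * c * 0))"
    by (rule data_lip_tail[OF F _ _ t]) (use K in auto)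
  also have "\<dots> = exp_frac (t\<^sup>2) (8 * c * (K\<^sup>2 / n))"
    using exp_frac_bounds(2) by (simp add: exp_frac_def power_divide)
  also have "\<dots> \<le> exp (- (t\<^sup>2 * n) / (2 * (4 * c * K\<^sup>2 + 1)))"
  proof (cases "8 * c * (K\<^sup>2 / n) = 0")
    case False
    then have p: "0 < c * K\<^sup>2" using c_nonneg by (cases "c = 0"; cases "K = 0") auto
    have "t\<^sup>2 * n / (2 * (4 * c * K\<^sup>2 + 1)) \<le> t\<^sup>2 * n / (8 * (c * K\<^sup>2))"
      using p by (intro divide_left_mono) (auto intro!: mult_pos_pos simp: mult.assoc)
    then show ?thesis using False n by (simp add: exp_frac_def mult_ac)
  qed (simp add: exp_frac_def)
  also have "\<dots> \<le> theta2 \<gamma> (4 * c * (growth_lip \<gamma>)\<^sup>2 + 1) n t"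
    by (cases \<gamma>) (auto simp: K_def)
  finally show ?thesis .
qed

end

context
  fixes \<mu> :: "('a::euclidean_space \<times> 'b::euclidean_space) measure" and c :: real
    and T :: "('a, 'b) statistic" and L :: "'b \<Rightarrow> 'b \<Rightarrow> real"
  assumes ls: "log_sobolev_space \<mu> c"
begin

interpretation log_sobolev_space \<mu> c by (rule ls)

text \<open>The left-out observation is independent of the remaining data, and averaging over the
  latter first leaves the expected loss at that observation, whatever \<open>i\<close> is.\<close>

lemma leave_one_out_expectation:
  assumes i: "i \<le> m"
    and int: "integrable (data_law (Suc m)) (\<lambda>D. loss T L m (leave_out (Suc m) i D) (D i))"
  shows "integrable \<mu> (expected_loss \<mu> T L m)"
    and "(\<integral>z. expected_loss \<mu> T L m z \<partial>\<mu>) = (\<integral>D. loss T L m (leave_out (Suc m) i D) (D i) \<partial>data_law (Suc m))"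
proof -
  let ?H = "\<lambda>D. loss T L m (leave_out (Suc m) i D) (D i)"
  have "(\<integral>D. ?H (insert_obs m i D z) \<partial>data_law m) = expected_loss \<mu> T L m z" for z
    unfolding expected_loss_def using i
    by (intro Bochner_Integration.integral_cong refl) (simp add: leave_out_insert_obs space_PiM)
  then show "integrable \<mu> (expected_loss \<mu> T L m)"
    "(\<integral>z. expected_loss \<mu> T L m z \<partial>\<mu>) = (\<integral>D. ?H D \<partial>data_law (Suc m))"
    using integral_insert_obs[OF i int] by simp_all
qed

text \<open>Given the left-out observation \<open>z\<close>, this is the deviation of a loss of
  \<open>m\<close> points from its mean, with tail bound \<open>theta1\<close> at \<open>z\<close>;
  then \<open>z\<close> is integrated out. The bound carries \<open>Suc m\<close> points, which the
  parameter \<open>k\<close> of \<open>data_lip_tail\<close> allows.\<close>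

lemma leave_one_out_deviation:
  assumes i: "i \<le> m"
    and int: "integrable (data_law (Suc m)) (\<lambda>D. loss T L m (leave_out (Suc m) i D) (D i))"
    and gb: "gradient_bound T L m d1 d2" and d: "\<And>z. 0 \<le> d1 z" "\<And>z. 0 \<le> d2 z"
    and md: "d1 \<in> borel_measurable borel" "d2 \<in> borel_measurable borel" and t: "0 < t"
  shows "measure (data_law (Suc m)) {D \<in> space (data_law (Suc m)).
      expected_loss \<mu> T L m (D i) - loss T L m (leave_out (Suc m) i D) (D i) > t}
    \<le> (\<integral>z. theta1 \<mu> c d1 d2 (Suc m) t z \<partial>\<mu>)"
proof -
  let ?Q = "data_law (Suc m)" and ?P = "data_law m" and ?g = "expected_loss \<mu> T L m"
  let ?H = "\<lambda>D. loss T L m (leave_out (Suc m) i D) (D i)"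
  interpret Q: prob_space ?Q by (rule prob_space_data)
  interpret P: prob_space ?P by (rule prob_space_data)
  define S where "S = {D \<in> space ?Q. ?g (D i) - ?H D > t}"
  have [measurable]: "?g \<in> borel_measurable \<mu>" "?H \<in> borel_measurable ?Q"
    using leave_one_out_expectation(1)[OF i int] int by auto
  have S: "S \<in> sets ?Q"
  proof -
    define f where "f D = ?g (D i) - ?H D" for D
    have [measurable]: "f \<in> borel_measurable ?Q"
      unfolding f_def[abs_def] using i int
      by (intro borel_measurable_diff measurable_compose[OF measurable_component_singleton]) auto
    show ?thesis unfolding S_def f_def[symmetric] by measurable
  qed
  have iS: "integrable ?Q (indicator S :: _ \<Rightarrow> real)"
    by (intro integrable_real_indicator S) (simp add: Q.emeasure_finite less_top[symmetric])
  have inner: "(\<integral>D. indicator S (insert_obs m i D z) \<partial>?P) = measure ?P {D \<in> space ?P. ?g z - loss T L m D z > t}" for z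
  proof -
    have "(\<integral>D. (indicator S (insert_obs m i D z) :: real) \<partial>?P)
        = (\<integral>D. indicator {D \<in> space ?P. ?g z - loss T L m D z > t} D \<partial>?P)"
    proof (intro Bochner_Integration.integral_cong refl)
      fix D assume D: "D \<in> space ?P"
      then have "insert_obs m i D z \<in> space ?Q" by (simp add: space_PiM insert_obs_def)
      then show "(indicator S (insert_obs m i D z) :: real) = indicator {D \<in> space ?P. ?g z - loss T L m D z > t} D"
        using D i by (auto simp: S_def indicator_def leave_out_insert_obs space_PiM)
    qed
    also have "\<dots> = measure ?P {D \<in> space ?P. ?g z - loss T L m D z > t}"
      by (subst Bochner_Integration.integral_indicator) (auto intro: arg_cong[of _ _ "measure ?P"])
    finally show ?thesis .
  qed
  have bound: "measure ?P {D \<in> space ?P. ?g z - loss T L m D z > t} \<le> theta1 \<mu> c d1 d2 (Suc m) t z" for z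
  proof -
    let ?F = "\<lambda>D. - loss T L m (restrict D {..<m}) z"
    have F: "data_lip m (d1 z) (d2 z) ?F"
      by (intro data_lip_minus gradient_bound_data_lip[OF gb] d)
    have r: "restrict D {..<m} = D" if "D \<in> space ?P" for D
      using that by (simp add: space_PiM PiE_def extensional_restrict)
    have "(\<integral>D. ?F D \<partial>?P) = (\<integral>D. - loss T L m D z \<partial>?P)"
      by (intro Bochner_Integration.integral_cong refl) (simp add: r)
    then have E: "(\<integral>D. ?F D \<partial>?P) = - ?g z" by (simp add: expected_loss_def)
    have "measure ?P {D \<in> space ?P. ?g z - loss T L m D z > t} = measure ?P {D \<in> space ?P. ?F D - (\<integral>D. ?F D \<partial>?P) > t}"
      unfolding E by (rule arg_cong[of _ _ "measure ?P"]) (auto simp: r)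
    also have "\<dots> \<le> theta1 \<mu> c d1 d2 (Suc m) t z"
      unfolding theta1_def by (rule data_lip_tail[OF F d t]) simp
    finally show ?thesis .
  qed
  have "measure ?Q S = (\<integral>D. indicator S D \<partial>?Q)"
    using sets.sets_into_space[OF S] by (simp add: Int_absorb2)
  also have "\<dots> = (\<integral>z. measure ?P {D \<in> space ?P. ?g z - loss T L m D z > t} \<partial>\<mu>)"
    using integral_insert_obs(2)[OF i iS] unfolding inner .
  also have "\<dots> \<le> (\<integral>z. theta1 \<mu> c d1 d2 (Suc m) t z \<partial>\<mu>)"
    using integral_insert_obs(1)[OF i iS] unfolding inner
    by (intro integral_mono bound theta1_integrable md d) (use t in auto)
  finally show ?thesis unfolding S_def .
qed

text \<open>The increment bound is linear in its coefficients, so integration over \<open>z\<close>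
  keeps its form, with the means of \<open>d1\<close> and \<open>d2\<close>. When one of these means
  is infinite, \<open>theta3\<close> is 1.\<close>

lemma conditional_loss_deviation:
  assumes int: "integrable (data_law n \<Otimes>\<^sub>M \<mu>) (\<lambda>(D, z). loss T L n D z)"
    and gb: "gradient_bound T L n d1 d2" and d: "\<And>z. 0 \<le> d1 z" "\<And>z. 0 \<le> d2 z" and t: "0 < t"
  shows "measure (data_law n) {D \<in> space (data_law n). (\<integral>z. loss T L n D z \<partial>\<mu>)
      - (\<integral>(D, z). loss T L n D z \<partial>(data_law n \<Otimes>\<^sub>M \<mu>)) > t} \<le> theta3 \<mu> c d1 d2 n t"
proof (cases "integrable \<mu> d1 \<and> integrable \<mu> d2")
  case False
  interpret Q: prob_space "data_law n" by (rule prob_space_data)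
  show ?thesis using False by (auto simp: theta3_def)
next
  case True
  let ?Q = "data_law n"
  interpret Q: prob_space ?Q by (rule prob_space_data)
  interpret QM: pair_prob_space ?Q \<mu> ..
  let ?F = "\<lambda>D. \<integral>z. loss T L n (restrict D {..<n}) z \<partial>\<mu>"
  have r: "restrict D {..<n} = D" if "D \<in> space ?Q" for D
    using that by (simp add: space_PiM PiE_def extensional_restrict)
  have rs: "restrict D {..<n} \<in> space ?Q" for D by (simp add: space_PiM)
  have lip: "data_lip n (d1 z) (d2 z) (\<lambda>D. loss T L n (restrict D {..<n}) z)" for z
    by (intro gradient_bound_data_lip[OF gb] d)
  have m: "(\<lambda>z. loss T L n D z) \<in> borel_measurable \<mu>" if "D \<in> space ?Q" for D
    using measurable_compose[OF measurable_Pair1'[OF that, of \<mu>] borel_measurable_integrable[OF int]] by simp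
  have "AE D in ?Q. integrable \<mu> (\<lambda>z. loss T L n D z)"
    using QM.AE_integrable_fst'[OF int] by simp
  \<comment> \<open>Fubini gives integrability in \<open>z\<close> for almost every dataset only;
    one good dataset and the increment bound extend it to all, as \<open>data_lip\<close>
    demands.\<close>
  then obtain D0 where D0: "D0 \<in> space ?Q" "integrable \<mu> (\<lambda>z. loss T L n D0 z)"
    using eventually_happens[of _ "ae_filter ?Q"] Q.prob_space_axioms
    by (metis (mono_tags, lifting) AE_space Q.ae_filter_bot eventually_conj eventually_happens')
  have dl: "\<bar>loss T L n (restrict D {..<n}) z - loss T L n (restrict D' {..<n}) z\<bar>
      \<le> d1 z * data_norm n (\<lambda>i. D i - D' i) + d2 z * (max (data_norm n D) (data_norm n D') * data_norm n (\<lambda>i. D i - D' i))" for D D' z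
    using data_lipD[OF lip[of z], of D D'] by (simp add: algebra_simps)
  have i: "integrable \<mu> (\<lambda>z. loss T L n (restrict D {..<n}) z)" for D
  proof -
    have i1: "integrable \<mu> (\<lambda>z. \<bar>loss T L n D0 z\<bar> + (d1 z * data_norm n (\<lambda>i. D i - D0 i)
        + d2 z * (max (data_norm n D) (data_norm n D0) * data_norm n (\<lambda>i. D i - D0 i))))"
      using D0(2) True by auto
    show ?thesis
    proof (rule Bochner_Integration.integrable_bound[OF i1 m[OF rs]], rule AE_I2)
      fix z
      show "norm (loss T L n (restrict D {..<n}) z) \<le> norm (\<bar>loss T L n D0 z\<bar> + (d1 z * data_norm n (\<lambda>i. D i - D0 i)
        + d2 z * (max (data_norm n D) (data_norm n D0) * data_norm n (\<lambda>i. D i - D0 i))))"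
        using dl[of D z D0] unfolding r[OF D0(1)] real_norm_def by linarith
    qed
  qed
  have F: "data_lip n (\<integral>z. d1 z \<partial>\<mu>) (\<integral>z. d2 z \<partial>\<mu>) ?F"
    unfolding data_lip_def
  proof (intro allI)
    fix D D' :: "nat \<Rightarrow> 'a \<times> 'b"
    have "?F D - ?F D' = (\<integral>z. loss T L n (restrict D {..<n}) z - loss T L n (restrict D' {..<n}) z \<partial>\<mu>)"
      using i by simp
    also have "\<bar>\<dots>\<bar> \<le> (\<integral>z. \<bar>loss T L n (restrict D {..<n}) z - loss T L n (restrict D' {..<n}) z\<bar> \<partial>\<mu>)"
      by (rule integral_abs_bound)
    also have "\<dots> \<le> (\<integral>z. d1 z * data_norm n (\<lambda>i. D i - D' i)
        + d2 z * (max (data_norm n D) (data_norm n D') * data_norm n (\<lambda>i. D i - D' i)) \<partial>\<mu>)"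
      using i True by (intro integral_mono dl) auto
    also have "\<dots> = ((\<integral>z. d1 z \<partial>\<mu>) + (\<integral>z. d2 z \<partial>\<mu>) * max (data_norm n D) (data_norm n D')) * data_norm n (\<lambda>i. D i - D' i)"
      using True by (simp add: algebra_simps)
    finally show "\<bar>?F D - ?F D'\<bar> \<le> ((\<integral>z. d1 z \<partial>\<mu>) + (\<integral>z. d2 z \<partial>\<mu>) * max (data_norm n D) (data_norm n D')) * data_norm n (\<lambda>i. D i - D' i)" .
  qed
  have "(\<integral>D. ?F D \<partial>?Q) = (\<integral>D. (\<integral>z. loss T L n D z \<partial>\<mu>) \<partial>?Q)"
    by (intro Bochner_Integration.integral_cong refl) (simp add: r)
  also have "\<dots> = (\<integral>(D, z). loss T L n D z \<partial>(?Q \<Otimes>\<^sub>M \<mu>))"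
    using QM.integral_fst'[OF int] by simp
  finally have E: "(\<integral>D. ?F D \<partial>?Q) = (\<integral>(D, z). loss T L n D z \<partial>(?Q \<Otimes>\<^sub>M \<mu>))" .
  have "measure ?Q {D \<in> space ?Q. (\<integral>z. loss T L n D z \<partial>\<mu>) - (\<integral>(D, z). loss T L n D z \<partial>(?Q \<Otimes>\<^sub>M \<mu>)) > t}
      = measure ?Q {D \<in> space ?Q. ?F D - (\<integral>D. ?F D \<partial>?Q) > t}"
    unfolding E by (rule arg_cong[of _ _ "measure ?Q"]) (auto simp: r)
  also have "\<dots> \<le> theta3 \<mu> c d1 d2 n t"
    unfolding theta3_def using True
    by (simp only: if_True simp_thms) (rule data_lip_tail[OF F _ _ t]; auto intro!: Bochner_Integration.integral_nonneg d)
  finally show ?thesis .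
qed

end

text \<open>The threshold is divided into thirds, and the bias is charged to the conditional loss,
  whence \<open>\<epsilon> / 3 - d3\<close>. The coefficients for \<open>m\<close> and for
  \<open>n\<close> points are separate parameters, so that either choice of index in
  \<open>theta1\<close> is an instance.\<close>

lemma data_deviation:
  fixes \<mu> :: "('a::euclidean_space \<times> 'b::euclidean_space) measure"
  assumes ls: "log_sobolev_space \<mu> c" and n: "n = Suc m"
    and H: "\<And>i. i < n \<Longrightarrow> integrable (Pi\<^sub>M {..<n} (\<lambda>_. \<mu>)) (\<lambda>D. loss T L m (leave_out n i D) (D i))"
    and int: "integrable ((\<Pi>\<^sub>M i\<in>{..<n}. \<mu>) \<Otimes>\<^sub>M \<mu>) (\<lambda>(D, z). loss T L n D z)"
    and close: "\<And>i. i < n \<Longrightarrow> \<bar>(\<integral>D. loss T L m (leave_out n i D) (D i) \<partial>(\<Pi>\<^sub>M i\<in>{..<n}. \<mu>)) -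
            (\<integral>(D, z). loss T L n D z \<partial>((\<Pi>\<^sub>M i\<in>{..<n}. \<mu>) \<Otimes>\<^sub>M \<mu>))\<bar> < d3"
    and gb: "gradient_bound T L m d1 d2" and d: "\<And>z. 0 \<le> d1 z" "\<And>z. 0 \<le> d2 z"
    and md: "d1 \<in> borel_measurable borel" "d2 \<in> borel_measurable borel"
    and gb': "gradient_bound T L n d1' d2'" and d': "\<And>z. 0 \<le> d1' z" "\<And>z. 0 \<le> d2' z"
    and g: "has_growth \<gamma> (expected_loss \<mu> T L m)" and \<epsilon>: "3 * d3 < \<epsilon>" "0 \<le> d3"
  shows "measure (Pi\<^sub>M {..<n} (\<lambda>_. \<mu>)) {D \<in> space (Pi\<^sub>M {..<n} (\<lambda>_. \<mu>)).
      (\<integral>z. loss T L n D z \<partial>\<mu>) - (\<Sum>i<n. loss T L m (leave_out n i D) (D i)) / n > \<epsilon>}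
    \<le> n * (\<integral>z. theta1 \<mu> c d1 d2 n (\<epsilon> / 3) z \<partial>\<mu>) + theta2 \<gamma> (4 * c * (growth_lip \<gamma>)\<^sup>2 + 1) n (\<epsilon> / 3)
      + theta3 \<mu> c d1' d2' n (\<epsilon> / 3 - d3)"
proof -
  interpret log_sobolev_space \<mu> c by (rule ls)
  let ?Q = "data_law n"
  interpret Q: prob_space ?Q by (rule prob_space_data)
  define h where "h i D = loss T L m (leave_out n i D) (D i)" for i D
  define G where "G = expected_loss \<mu> T L m"
  define F where "F D = (\<integral>z. loss T L n D z \<partial>\<mu>)" for D
  define E where "E = (\<integral>(D, z). loss T L n D z \<partial>(?Q \<Otimes>\<^sub>M \<mu>))"
  have ih: "integrable ?Q (h i)" if "i < n" for i using H[OF that] by (simp add: h_def[abs_def])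
  have G: "integrable \<mu> G" "(\<integral>z. G z \<partial>\<mu>) = (\<integral>D. h i D \<partial>?Q)" if "i < n" for i
    using leave_one_out_expectation[OF ls, where T=T and L=L and m=m and i=i] that ih[OF that]
    unfolding n h_def G_def by auto
  define A where "A = {D \<in> space ?Q. F D - E > \<epsilon> / 3 - d3}"
  define B where "B = {D \<in> space ?Q. (\<integral>z. G z \<partial>\<mu>) - (\<Sum>i<n. G (D i)) / n > \<epsilon> / 3}"
  define C where "C i = {D \<in> space ?Q. G (D i) - h i D > \<epsilon> / 3}" for i
  have mF[measurable]: "F \<in> borel_measurable ?Q"
    unfolding F_def using borel_measurable_lebesgue_integral[of "loss T L n" ?Q] borel_measurable_integrable[OF int] by simp
  have mG: "(\<lambda>D. G (D i)) \<in> borel_measurable ?Q" if "i < n" for i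
    using that G(1)[OF that] by (intro measurable_compose[OF measurable_component_singleton]) auto
  have mh: "h i \<in> borel_measurable ?Q" if "i < n" for i using ih[OF that] by auto
  have mC: "C i \<in> sets ?Q" if "i < n" for i
  proof -
    define f where "f D = G (D i) - h i D" for D
    have [measurable]: "f \<in> borel_measurable ?Q" unfolding f_def[abs_def] by (intro borel_measurable_diff mG mh that)
    show ?thesis unfolding C_def f_def[symmetric] by measurable
  qed
  have mB: "B \<in> sets ?Q"
  proof -
    define f where "f D = (\<Sum>i<n. G (D i))" for D
    have [measurable]: "f \<in> borel_measurable ?Q" unfolding f_def[abs_def] by (intro borel_measurable_sum mG) auto
    show ?thesis unfolding B_def f_def[symmetric] by measurable
  qed
  have mA: "A \<in> sets ?Q" unfolding A_def by measurable
  have n0: "0 < n" using n by simp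
  \<comment> \<open>Outside the events four differences are bounded: \<open>F D - E\<close>,
    \<open>E\<close> minus the mean of \<open>G\<close>, that mean minus its empirical version, and
    the average of \<open>G (D i) - h i D\<close>. Their sum is less than \<open>\<epsilon>\<close>;
    strictness comes from the bias.\<close>
  have "{D \<in> space ?Q. F D - (\<Sum>i<n. h i D) / n > \<epsilon>} \<subseteq> A \<union> B \<union> (\<Union>i<n. C i)"
  proof (rule subsetI, rule ccontr)
    fix D assume D: "D \<in> {D \<in> space ?Q. F D - (\<Sum>i<n. h i D) / n > \<epsilon>}" "D \<notin> A \<union> B \<union> (\<Union>i<n. C i)"
    then have a: "F D - E \<le> \<epsilon> / 3 - d3" "(\<integral>z. G z \<partial>\<mu>) - (\<Sum>i<n. G (D i)) / n \<le> \<epsilon> / 3"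
      and "\<And>i. i < n \<Longrightarrow> G (D i) - h i D \<le> \<epsilon> / 3"
      by (auto simp: A_def B_def C_def not_less)
    then have "(\<Sum>i<n. G (D i) - h i D) \<le> (\<Sum>i<n. \<epsilon> / 3)" by (intro sum_mono) auto
    then have "(\<Sum>i<n. G (D i)) / n - (\<Sum>i<n. h i D) / n \<le> \<epsilon> / 3"
      using n0 by (simp add: sum_subtractf diff_divide_distrib[symmetric] pos_divide_le_eq mult.commute)
    moreover have "\<bar>(\<integral>z. G z \<partial>\<mu>) - E\<bar> < d3"
      using close[OF n0] G(2)[OF n0] by (simp add: h_def E_def)
    moreover have "\<epsilon> < F D - (\<Sum>i<n. h i D) / n" using D(1) by simp
    ultimately show False using a by linarith
  qed
  then have "measure ?Q {D \<in> space ?Q. F D - (\<Sum>i<n. h i D) / n > \<epsilon>} \<le> measure ?Q (A \<union> B \<union> (\<Union>i<n. C i))"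
    by (intro Q.finite_measure_mono sets.Un sets.finite_UN mA mB mC) auto
  also have "\<dots> \<le> measure ?Q (A \<union> B) + measure ?Q (\<Union>i<n. C i)"
    by (intro measure_Un_le sets.Un sets.finite_UN mA mB mC) auto
  also have "measure ?Q (A \<union> B) \<le> measure ?Q A + measure ?Q B" by (intro measure_Un_le mA mB)
  also have "measure ?Q (\<Union>i<n. C i) \<le> (\<Sum>i<n. measure ?Q (C i))"
    by (intro measure_UNION_le) (auto intro: mC)
  also have "\<dots> \<le> (\<Sum>i<n. \<integral>z. theta1 \<mu> c d1 d2 n (\<epsilon> / 3) z \<partial>\<mu>)"
  proof (rule sum_mono)
    fix i assume "i \<in> {..<n}"
    then have i: "i \<le> m" using n by auto
    show "measure ?Q (C i) \<le> (\<integral>z. theta1 \<mu> c d1 d2 n (\<epsilon> / 3) z \<partial>\<mu>)"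
      unfolding C_def G_def h_def n
      by (rule leave_one_out_deviation[OF ls i _ gb d md]) (use H[of i] i n \<epsilon> in auto)
  qed
  also have "measure ?Q B \<le> theta2 \<gamma> (4 * c * (growth_lip \<gamma>)\<^sup>2 + 1) n (\<epsilon> / 3)"
    unfolding B_def G_def by (rule mean_deviation[OF g n0]) (use \<epsilon> in auto)
  also have "measure ?Q A \<le> theta3 \<mu> c d1' d2' n (\<epsilon> / 3 - d3)"
    unfolding A_def F_def E_def by (rule conditional_loss_deviation[OF ls int gb' d']) (use \<epsilon> in auto)
  finally show ?thesis unfolding F_def h_def by simp
qed

section \<open>The random data\<close>

context
  fixes P :: "'w measure" and \<mu> :: "'z::euclidean_space measure"
    and n :: nat and Zs :: "nat \<Rightarrow> 'w \<Rightarrow> 'z" and Z :: "'w \<Rightarrow> 'z"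
  assumes iid: "iid_data P \<mu> n Zs Z"
begin

lemma iid_law: "prob_space \<mu>" "sets \<mu> = sets borel"
proof -
  interpret prob_space P using iid by (simp add: iid_data_def)
  \<comment> \<open>Index \<open>n\<close> of the independent family is the further copy, so this is
    the measurability of \<open>Z\<close>.\<close>
  have "(if n < n then Zs n else Z) \<in> borel_measurable P"
    using iid unfolding iid_data_def indep_vars_def by blast
  then have "Z \<in> borel_measurable P" by simp
  then show "prob_space \<mu>" using iid prob_space_distr[of Z borel] by (auto simp: iid_data_def)
  show "sets \<mu> = sets borel" using iid by (metis iid_data_def sets_distr)
qed

text \<open>The joint law of the \<open>n + 1\<close> independent variables is a product; splitting
  off its last coordinate identifies the law of the dataset together with the further copy.\<close>

lemma iid_joint_distr:
  shows "(\<lambda>\<omega>. (dataset n Zs \<omega>, Z \<omega>)) \<in> measurable P (Pi\<^sub>M {..<n} (\<lambda>_. \<mu>) \<Otimes>\<^sub>M \<mu>)"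
    and "distr P (Pi\<^sub>M {..<n} (\<lambda>_. \<mu>) \<Otimes>\<^sub>M \<mu>) (\<lambda>\<omega>. (dataset n Zs \<omega>, Z \<omega>)) = Pi\<^sub>M {..<n} (\<lambda>_. \<mu>) \<Otimes>\<^sub>M \<mu>"
proof -
  interpret P: prob_space P using iid by (simp add: iid_data_def)
  interpret prob_space \<mu> by (rule iid_law)
  note sets_mu[measurable_cong] = iid_law(2)
  let ?Q = "Pi\<^sub>M {..<n} (\<lambda>_. \<mu>)" and ?Q' = "Pi\<^sub>M {..<Suc n} (\<lambda>_. \<mu>)"
  interpret Q: prob_space ?Q by (rule prob_space_power)
  interpret QM: pair_sigma_finite ?Q \<mu> ..
  define X where "X i = (if i < n then Zs i else Z)" for i
  have ind: "P.indep_vars (\<lambda>_. borel) X {..<Suc n}"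
    using iid unfolding iid_data_def X_def by (simp add: lessThan_Suc_atMost)
  have rv: "X i \<in> borel_measurable P" if "i \<in> {..<Suc n}" for i
    using ind that unfolding P.indep_vars_def by auto
  have dX: "distr P borel (X i) = \<mu>" if "i \<in> {..<Suc n}" for i
    using iid that by (auto simp: iid_data_def X_def)
  define f where "f \<omega> = (\<lambda>i\<in>{..<Suc n}. X i \<omega>)" for \<omega>
  define s where "s x = (restrict x {..<n}, x n)" for x :: "nat \<Rightarrow> 'z"
  have sQ: "sets (Pi\<^sub>M {..<Suc n} (\<lambda>_. borel)) = sets ?Q'"
    by (intro sets_PiM_cong refl sets_mu[symmetric])
  have mf: "f \<in> measurable P ?Q'"
    unfolding f_def[abs_def] using rv sets_mu by (intro measurable_restrict) (simp add: measurable_cong_sets[OF refl sets_mu])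
  have ms: "s \<in> measurable ?Q' (?Q \<Otimes>\<^sub>M \<mu>)"
    unfolding s_def[abs_def]
    by (intro measurable_Pair measurable_restrict_subset measurable_component_singleton) auto
  have "distr P (Pi\<^sub>M {..<Suc n} (\<lambda>_. borel)) f = Pi\<^sub>M {..<Suc n} (\<lambda>i. distr P borel (X i))"
    using ind P.indep_vars_iff_distr_eq_PiM'[where I="{..<Suc n}" and M'="\<lambda>_. borel" and X=X] rv unfolding f_def[abs_def] by auto
  also have "\<dots> = ?Q'" by (intro PiM_cong refl dX)
  finally have df: "distr P ?Q' f = ?Q'" using distr_cong[OF refl sQ, of P f f] by simp
  have e: "(\<lambda>\<omega>. (dataset n Zs \<omega>, Z \<omega>)) = s \<circ> f"
    by (auto simp: fun_eq_iff s_def f_def X_def dataset_def)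
  show "(\<lambda>\<omega>. (dataset n Zs \<omega>, Z \<omega>)) \<in> measurable P (?Q \<Otimes>\<^sub>M \<mu>)"
    unfolding e by (rule measurable_comp[OF mf ms])
  define u where "u = (\<lambda>(z :: 'z, D :: nat \<Rightarrow> 'z). D(n := z))"
  have mu: "u \<in> measurable (\<mu> \<Otimes>\<^sub>M ?Q) ?Q'"
    unfolding u_def case_prod_beta' lessThan_Suc by (intro measurable_fun_upd[where J="{..<n}"] measurable_snd) auto
  have du: "distr (\<mu> \<Otimes>\<^sub>M ?Q) ?Q' u = ?Q'"
    unfolding u_def using distr_pair_PiM_eq_PiM[of "{..<n}" "\<lambda>_. \<mu>" n] prob_space_axioms by (simp add: lessThan_Suc)
  have "distr P (?Q \<Otimes>\<^sub>M \<mu>) (s \<circ> f) = distr (distr P ?Q' f) (?Q \<Otimes>\<^sub>M \<mu>) s"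
    by (rule distr_distr[OF ms mf, symmetric])
  \<comment> \<open>The product law is rebuilt from its last coordinate and the rest, so that
    splitting becomes a swap of two factors.\<close>
  also have "\<dots> = distr (distr (\<mu> \<Otimes>\<^sub>M ?Q) ?Q' u) (?Q \<Otimes>\<^sub>M \<mu>) s" by (simp only: df du)
  also have "\<dots> = distr (\<mu> \<Otimes>\<^sub>M ?Q) (?Q \<Otimes>\<^sub>M \<mu>) (s \<circ> u)"
    by (rule distr_distr[OF ms mu])
  also have "\<dots> = distr (\<mu> \<Otimes>\<^sub>M ?Q) (?Q \<Otimes>\<^sub>M \<mu>) (\<lambda>(x, y). (y, x))"
    by (intro distr_cong refl) (auto simp: s_def u_def space_pair_measure space_PiM PiE_def extensional_def fun_eq_iff)
  also have "\<dots> = ?Q \<Otimes>\<^sub>M \<mu>" by (rule QM.distr_pair_swap[symmetric])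
  finally show "distr P (?Q \<Otimes>\<^sub>M \<mu>) (\<lambda>\<omega>. (dataset n Zs \<omega>, Z \<omega>)) = ?Q \<Otimes>\<^sub>M \<mu>" unfolding e .
qed

lemma iid_dataset_distr:
  shows "dataset n Zs \<in> measurable P (Pi\<^sub>M {..<n} (\<lambda>_. \<mu>))"
    and "distr P (Pi\<^sub>M {..<n} (\<lambda>_. \<mu>)) (dataset n Zs) = Pi\<^sub>M {..<n} (\<lambda>_. \<mu>)"
proof -
  interpret prob_space \<mu> by (rule iid_law)
  let ?Q = "Pi\<^sub>M {..<n} (\<lambda>_. \<mu>)"
  interpret Q: prob_space ?Q by (rule prob_space_power)
  have "dataset n Zs = fst \<circ> (\<lambda>\<omega>. (dataset n Zs \<omega>, Z \<omega>))" by auto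
  note e = this
  show "dataset n Zs \<in> measurable P ?Q"
    by (subst e) (rule measurable_comp[OF iid_joint_distr(1) measurable_fst])
  have "distr P ?Q (dataset n Zs) = distr (distr P (?Q \<Otimes>\<^sub>M \<mu>) (\<lambda>\<omega>. (dataset n Zs \<omega>, Z \<omega>))) ?Q fst"
    by (subst e) (rule distr_distr[OF measurable_fst iid_joint_distr(1), symmetric])
  also have "\<dots> = distr (?Q \<Otimes>\<^sub>M \<mu>) ?Q fst" by (simp only: iid_joint_distr(2))
  also have "\<dots> = ?Q"
  proof (rule measure_eqI)
    fix A assume "A \<in> sets (distr (?Q \<Otimes>\<^sub>M \<mu>) ?Q fst)"
    then have A: "A \<in> sets ?Q" by simp
    then have "fst -` A \<inter> space (?Q \<Otimes>\<^sub>M \<mu>) = A \<times> space \<mu>"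
      using sets.sets_into_space[OF A] by (auto simp: space_pair_measure)
    then show "emeasure (distr (?Q \<Otimes>\<^sub>M \<mu>) ?Q fst) A = emeasure ?Q A"
      using A by (simp add: emeasure_distr emeasure_pair_measure_Times emeasure_space_1)
  qed simp
  finally show "distr P ?Q (dataset n Zs) = ?Q" .
qed

end

text \<open>As \<open>Z\<close> is independent of the dataset, conditioning freezes the dataset and
  integrates \<open>Z\<close> out. The defining property of conditional expectation is checked on
  preimages of measurable sets of datasets, which make up the whole generated sigma-algebra.\<close>

lemma L_loo_eq:
  fixes \<mu> :: "('a::euclidean_space \<times> 'b::euclidean_space) measure"
  assumes iid: "iid_data P \<mu> n Zs Z"
    and int: "integrable ((\<Pi>\<^sub>M i\<in>{..<n}. \<mu>) \<Otimes>\<^sub>M \<mu>) (\<lambda>(D, z). loss T L n D z)"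
  shows "L_loo P T L n Zs Z \<in> borel_measurable P"
    and "AE \<omega> in P. L_loo P T L n Zs Z \<omega> = (\<integral>z. loss T L n (dataset n Zs \<omega>) z \<partial>\<mu>)"
proof -
  interpret P: prob_space P using iid by (simp add: iid_data_def)
  interpret prob_space \<mu> by (rule iid_law[OF iid])
  let ?Q = "Pi\<^sub>M {..<n} (\<lambda>_. \<mu>)" and ?d = "dataset n Zs"
  interpret Q: prob_space ?Q by (rule prob_space_power)
  interpret QM: pair_sigma_finite ?Q \<mu> ..
  define F where "F = vimage_algebra (space P) ?d (\<Pi>\<^sub>M i\<in>{..<n}. borel :: ('a \<times> 'b) measure)"
  define f where "f D = (\<integral>z. loss T L n D z \<partial>\<mu>)" for D
  note j = iid_joint_distr[OF iid] and dd = iid_dataset_distr[OF iid]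
  have sQ: "sets (\<Pi>\<^sub>M i\<in>{..<n}. borel) = sets ?Q"
    by (intro sets_PiM_cong refl iid_law(2)[OF iid, symmetric])
  have F: "F = vimage_algebra (space P) ?d ?Q"
    unfolding F_def vimage_algebra_def sQ ..
  have dsp: "?d \<in> space P \<rightarrow> space ?Q" using dd(1) by (auto simp: measurable_def)
  have sF: "sets F = {?d -` A \<inter> space P |A. A \<in> sets ?Q}"
    unfolding F by (rule sets_vimage_algebra2[OF dsp])
  have sub: "subalgebra P F"
    unfolding subalgebra_def sF using dd(1) by (auto simp: F measurable_sets)
  interpret F: finite_measure_subalgebra P F by unfold_locales (rule sub)
  have f: "f \<in> borel_measurable ?Q"
    unfolding f_def using borel_measurable_lebesgue_integral[of "loss T L n" ?Q] borel_measurable_integrable[OF int] by simp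
  have fi: "integrable ?Q f" unfolding f_def using QM.integrable_fst'[OF int] by simp
  show "L_loo P T L n Zs Z \<in> borel_measurable P"
    unfolding L_loo_def by (rule borel_measurable_cond_exp2)
  have i1: "integrable P (\<lambda>\<omega>. loss T L n (?d \<omega>) (Z \<omega>))"
    using integrable_distr[OF j(1), of "\<lambda>(D, z). loss T L n D z"] int unfolding j(2) by simp
  have i2: "integrable P (\<lambda>\<omega>. f (?d \<omega>))"
    using integrable_distr[OF dd(1), of f] fi unfolding dd(2) by simp
  have mf: "(\<lambda>\<omega>. f (?d \<omega>)) \<in> borel_measurable F"
    unfolding F by (rule measurable_compose[OF measurable_vimage_algebra1[OF dsp] f])
  have "AE \<omega> in P. real_cond_exp P F (\<lambda>\<omega>. loss T L n (?d \<omega>) (Z \<omega>)) \<omega> = f (?d \<omega>)"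
  proof (rule F.real_cond_exp_charact[OF _ i1 i2 mf])
    fix B assume "B \<in> sets F"
    then obtain A where A: "A \<in> sets ?Q" "B = ?d -` A \<inter> space P" by (auto simp: sF)
    have AB: "indicator B \<omega> = (indicator A (?d \<omega>) :: real)" if "\<omega> \<in> space P" for \<omega>
      using that A(2) by (auto simp: indicator_def)
    have iA: "integrable (?Q \<Otimes>\<^sub>M \<mu>) (\<lambda>(D, z). indicator A D * loss T L n D z)"
    proof (rule Bochner_Integration.integrable_bound[OF int])
      have "(\<lambda>x. indicator A (fst x) * (case x of (D, z) \<Rightarrow> loss T L n D z)) \<in> borel_measurable (?Q \<Otimes>\<^sub>M \<mu>)"
        using A(1) int by (intro borel_measurable_times borel_measurable_integrable
          measurable_compose[OF measurable_fst borel_measurable_indicator])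
      then show "(\<lambda>(D, z). indicator A D * loss T L n D z) \<in> borel_measurable (?Q \<Otimes>\<^sub>M \<mu>)"
        by (simp add: case_prod_beta')
    qed (auto simp: indicator_def intro!: AE_I2)
    have "(\<integral>\<omega>\<in>B. loss T L n (?d \<omega>) (Z \<omega>) \<partial>P) = (\<integral>\<omega>. indicator A (?d \<omega>) * loss T L n (?d \<omega>) (Z \<omega>) \<partial>P)"
      unfolding set_lebesgue_integral_def by (intro Bochner_Integration.integral_cong refl) (simp add: AB)
    also have "\<dots> = (\<integral>(D, z). indicator A D * loss T L n D z \<partial>distr P (?Q \<Otimes>\<^sub>M \<mu>) (\<lambda>\<omega>. (?d \<omega>, Z \<omega>)))"
      using integral_distr[OF j(1) borel_measurable_integrable[OF iA]] by simp
    also have "\<dots> = (\<integral>(D, z). indicator A D * loss T L n D z \<partial>(?Q \<Otimes>\<^sub>M \<mu>))" unfolding j(2) ..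
    also have "\<dots> = (\<integral>D. indicator A D * f D \<partial>?Q)"
      using QM.integral_fst'[OF iA] by (simp add: f_def)
    also have "\<dots> = (\<integral>D. indicator A D * f D \<partial>distr P ?Q ?d)" unfolding dd(2) ..
    also have "\<dots> = (\<integral>\<omega>. indicator A (?d \<omega>) * f (?d \<omega>) \<partial>P)"
      by (intro integral_distr dd(1) borel_measurable_times borel_measurable_indicator A(1) f)
    also have "\<dots> = (\<integral>\<omega>\<in>B. f (?d \<omega>) \<partial>P)"
      unfolding set_lebesgue_integral_def by (intro Bochner_Integration.integral_cong refl) (simp add: AB)
    finally show "(\<integral>\<omega>\<in>B. loss T L n (?d \<omega>) (Z \<omega>) \<partial>P) = (\<integral>\<omega>\<in>B. f (?d \<omega>) \<partial>P)" .
  qed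
  then show "AE \<omega> in P. L_loo P T L n Zs Z \<omega> = (\<integral>z. loss T L n (?d \<omega>) z \<partial>\<mu>)"
    unfolding L_loo_def F_def[symmetric] f_def .
qed

text \<open>Both quantities are, up to a null set, functions of the dataset, so the event can be
  measured under the product law.\<close>

lemma L_loo_deviation_law:
  fixes \<mu> :: "('a::euclidean_space \<times> 'b::euclidean_space) measure"
  assumes iid: "iid_data P \<mu> n Zs Z"
    and int: "integrable ((\<Pi>\<^sub>M i\<in>{..<n}. \<mu>) \<Otimes>\<^sub>M \<mu>) (\<lambda>(D, z). loss T L n D z)"
    and H: "\<And>i. i < n \<Longrightarrow> integrable (Pi\<^sub>M {..<n} (\<lambda>_. \<mu>)) (\<lambda>D. loss T L (n - 1) (leave_out n i D) (D i))"
  shows "measure P {\<omega> \<in> space P. L_loo P T L n Zs Z \<omega> - L_loo_hat T L n Zs \<omega> > \<epsilon>}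
    = measure (Pi\<^sub>M {..<n} (\<lambda>_. \<mu>)) {D \<in> space (Pi\<^sub>M {..<n} (\<lambda>_. \<mu>)).
      (\<integral>z. loss T L n D z \<partial>\<mu>) - (\<Sum>i<n. loss T L (n - 1) (leave_out n i D) (D i)) / n > \<epsilon>}"
proof -
  interpret prob_space \<mu> by (rule iid_law[OF iid])
  let ?Q = "Pi\<^sub>M {..<n} (\<lambda>_. \<mu>)" and ?d = "dataset n Zs"
  note dd = iid_dataset_distr[OF iid]
  define g where "g D = (\<Sum>i<n. loss T L (n - 1) (leave_out n i D) (D i)) / n" for D
  define f where "f D = (\<integral>z. loss T L n D z \<partial>\<mu>)" for D
  have f[measurable]: "f \<in> borel_measurable ?Q"
    unfolding f_def using borel_measurable_lebesgue_integral[of "loss T L n" ?Q] borel_measurable_integrable[OF int] by simp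
  have g[measurable]: "g \<in> borel_measurable ?Q"
    unfolding g_def[abs_def] using H by (intro borel_measurable_divide borel_measurable_sum) auto
  have [measurable]: "L_loo P T L n Zs Z \<in> borel_measurable P" by (rule L_loo_eq(1)[OF iid int])
  have hat: "L_loo_hat T L n Zs \<omega> = g (?d \<omega>)" for \<omega>
    unfolding L_loo_hat_def g_def by (intro arg_cong2[of _ _ _ _ "(/)"] sum.cong refl) (simp add: dataset_def)
  have [measurable]: "?d \<in> measurable P ?Q" by (rule dd(1))
  have "measure P {\<omega> \<in> space P. L_loo P T L n Zs Z \<omega> - L_loo_hat T L n Zs \<omega> > \<epsilon>}
      = measure P {\<omega> \<in> space P. f (?d \<omega>) - g (?d \<omega>) > \<epsilon>}"
    unfolding hat
  proof (rule measure_eq_AE)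
    show "AE \<omega> in P. (\<omega> \<in> {\<omega> \<in> space P. L_loo P T L n Zs Z \<omega> - g (?d \<omega>) > \<epsilon>}) = (\<omega> \<in> {\<omega> \<in> space P. f (?d \<omega>) - g (?d \<omega>) > \<epsilon>})"
      using L_loo_eq(2)[OF iid int] by eventually_elim (simp add: f_def)
  qed measurable
  also have "\<dots> = measure P (?d -` {D \<in> space ?Q. f D - g D > \<epsilon>} \<inter> space P)"
    using dd(1) by (intro arg_cong[of _ _ "measure P"]) (auto simp: measurable_def)
  also have "\<dots> = measure (distr P ?Q ?d) {D \<in> space ?Q. f D - g D > \<epsilon>}"
    by (rule measure_distr[OF dd(1), symmetric]) measurable
  finally show ?thesis unfolding dd(2) f_def g_def .
qed

theorem theorem3p6:
  shows "\<exists>C :: growth \<Rightarrow> real \<Rightarrow> real. (\<forall>\<gamma> C1. 0 < C \<gamma> C1) \<and>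
    (\<forall>(P :: 'w measure) (\<mu> :: ((real ^ 'k) \<times> (real ^ 'm)) measure) n Zs Z T L \<delta>1 \<delta>2 \<delta>3 \<gamma> \<epsilon> C1.
       1 \<le> n \<and> iid_data P \<mu> n Zs Z \<and>
       log_sobolev \<mu> < \<infinity> \<and> C1 = enn2real (log_sobolev \<mu>) \<and>
       is_statistic T \<and> is_stable \<mu> T L \<delta>1 \<delta>2 \<delta>3 \<and>
       has_growth \<gamma> (expected_loss \<mu> T L n) \<and> has_growth \<gamma> (expected_loss \<mu> T L (n - 1)) \<and>
       3 * \<delta>3 n < \<epsilon> \<longrightarrow>
       (let p = measure P {\<omega> \<in> space P. L_loo P T L n Zs Z \<omega> - L_loo_hat T L n Zs \<omega> > \<epsilon>} in
          p \<le> deviation_bound \<mu> \<delta>1 \<delta>2 \<delta>3 \<gamma> (C \<gamma> C1) C1 n (n - 1) \<epsilon> \<and>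
          (gradient_bound T L (n - 1) (\<delta>1 n) (\<delta>2 n) \<longrightarrow>
             p \<le> deviation_bound \<mu> \<delta>1 \<delta>2 \<delta>3 \<gamma> (C \<gamma> C1) C1 n n \<epsilon>)))"
proof (intro exI[of _ "\<lambda>\<gamma> C1. 4 * \<bar>C1\<bar> * (growth_lip \<gamma>)\<^sup>2 + 1"] conjI allI impI)
  \<comment> \<open>The absolute value makes the constant positive at every real argument; it
    disappears for the log-Sobolev constant, which is nonnegative.\<close>
  show "0 < 4 * \<bar>C1\<bar> * (growth_lip \<gamma>)\<^sup>2 + 1" for \<gamma> C1
    by (intro add_nonneg_pos mult_nonneg_nonneg) auto
next
  fix P :: "'w measure" and \<mu> :: "((real ^ 'k) \<times> (real ^ 'm)) measure"
    and n Zs Z T L \<delta>1 \<delta>2 \<delta>3 \<gamma> \<epsilon> C1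
  assume "1 \<le> n \<and> iid_data P \<mu> n Zs Z \<and>
       log_sobolev \<mu> < \<infinity> \<and> C1 = enn2real (log_sobolev \<mu>) \<and>
       is_statistic T \<and> is_stable \<mu> T L \<delta>1 \<delta>2 \<delta>3 \<and>
       has_growth \<gamma> (expected_loss \<mu> T L n) \<and> has_growth \<gamma> (expected_loss \<mu> T L (n - 1)) \<and>
       3 * \<delta>3 n < \<epsilon>"
  then have n: "n = Suc (n - 1)" and iid: "iid_data P \<mu> n Zs Z" and fin: "log_sobolev \<mu> < \<infinity>"
    and C1: "C1 = enn2real (log_sobolev \<mu>)" and st: "is_stable \<mu> T L \<delta>1 \<delta>2 \<delta>3"
    and g: "has_growth \<gamma> (expected_loss \<mu> T L (n - 1))" and \<epsilon>: "3 * \<delta>3 n < \<epsilon>"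
    by auto
  have ls: "log_sobolev_space \<mu> C1"
    unfolding C1 by (rule log_sobolev_space_of_finite[OF iid_law[OF iid] fin])
  have C1': "\<bar>C1\<bar> = C1" unfolding C1 by simp
  have \<delta>: "\<And>k z. 0 \<le> \<delta>1 k z" "\<And>k z. 0 \<le> \<delta>2 k z" "0 \<le> \<delta>3 n"
    "\<And>k. \<delta>1 k \<in> borel_measurable borel" "\<And>k. \<delta>2 k \<in> borel_measurable borel"
    "\<And>k. gradient_bound T L k (\<delta>1 k) (\<delta>2 k)"
    using st unfolding is_stable_def by auto
  have st': "integrable (\<Pi>\<^sub>M i\<in>{..<n}. \<mu>) (\<lambda>D. loss T L (n - 1) (leave_out n i D) (D i))"
    "integrable ((\<Pi>\<^sub>M i\<in>{..<n}. \<mu>) \<Otimes>\<^sub>M \<mu>) (\<lambda>(D, z). loss T L n D z)"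
    "\<bar>(\<integral>D. loss T L (n - 1) (leave_out n i D) (D i) \<partial>(\<Pi>\<^sub>M i\<in>{..<n}. \<mu>)) -
            (\<integral>(D, z). loss T L n D z \<partial>((\<Pi>\<^sub>M i\<in>{..<n}. \<mu>) \<Otimes>\<^sub>M \<mu>))\<bar> < \<delta>3 n" if "i < n" for i
    using st fin that unfolding is_stable_def by blast+
  have int: "integrable ((\<Pi>\<^sub>M i\<in>{..<n}. \<mu>) \<Otimes>\<^sub>M \<mu>) (\<lambda>(D, z). loss T L n D z)"
    using n by (intro st'(2)[of 0]) simp
  \<comment> \<open>The index is left free: stability supplies the premise for
    \<open>N = n - 1\<close>, the additional hypothesis supplies it for
    \<open>N = n\<close>.\<close>
  have "measure P {\<omega> \<in> space P. L_loo P T L n Zs Z \<omega> - L_loo_hat T L n Zs \<omega> > \<epsilon>}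
      \<le> deviation_bound \<mu> \<delta>1 \<delta>2 \<delta>3 \<gamma> (4 * \<bar>C1\<bar> * (growth_lip \<gamma>)\<^sup>2 + 1) C1 n N \<epsilon>"
    if "gradient_bound T L (n - 1) (\<delta>1 N) (\<delta>2 N)" for N
    using data_deviation[OF ls n st'(1) int st'(3) that \<delta>(1,2,4,5,6,1,2) g \<epsilon> \<delta>(3)]
      L_loo_deviation_law[OF iid int st'(1), of \<epsilon>]
    unfolding deviation_bound_def C1' by simp
  then show "let p = measure P {\<omega> \<in> space P. L_loo P T L n Zs Z \<omega> - L_loo_hat T L n Zs \<omega> > \<epsilon>} in
          p \<le> deviation_bound \<mu> \<delta>1 \<delta>2 \<delta>3 \<gamma> (4 * \<bar>C1\<bar> * (growth_lip \<gamma>)\<^sup>2 + 1) C1 n (n - 1) \<epsilon> \<and>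
          (gradient_bound T L (n - 1) (\<delta>1 n) (\<delta>2 n) \<longrightarrow>
             p \<le> deviation_bound \<mu> \<delta>1 \<delta>2 \<delta>3 \<gamma> (4 * \<bar>C1\<bar> * (growth_lip \<gamma>)\<^sup>2 + 1) C1 n n \<epsilon>)"
    using \<delta>(6) unfolding Let_def by blast
qed

end
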